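(* Every decision problem $\mathcal{D}:\{0,1\}^*\to\{0,1\}$ in PSPACE is $\mathbf{B}$-programmable in $\mathrm{STA}_{\mathbf{B}}$; that is, there is a term $\underline{\mathtt f}\in\Lambda_{\mathcal B}$ such that for every string $s\in\{0,1\}^*$, the term $\underline{\mathtt f}\,\underline{s}$ is a program (i.e. is closed and $\vdash\underline{\mathtt f}\,\underline{s}:\mathbf{B}$ is derivable), and for $b\in\{0,1\}$: $\mathcal D(s)=b$ if and only if $\models\underline{\mathtt f}\,\underline{s}\Downarrow\underline{\mathtt b}$.
   Context: **Terms.** $\Lambda_{\mathcal{B}}$: $M::= x\mid \mathtt{0}\mid \mathtt{1}\mid \lambda x.M\mid MM\mid \mathtt{if}\ M\ \mathtt{then}\ M\ \mathtt{else}\ M$, up to $\alpha$-equivalence; $\mathtt 0,\mathtt 1$ are the boolean constants. **Types.** Linear types $A,B::=\mathbf{B}\mid\alpha\mid\sigma\multimap A\mid\forall\alpha.A$; types $\sigma,\tau::=A\mid{!\sigma}$. A context is a finite set of assumptions $x:\sigma$ with distinct variables; $!\Gamma=\{x:{!\sigma}\mid x:\sigma\in\Gamma\}$; $\Gamma\#\Delta$ means $\mathrm{dom}(\Gamma)\cap\mathrm{dom}(\Delta)=\emptyset$; FTV = free type variables. **Rules of $\mathrm{STA}_{\mathbf{B}}$.** ($A,B$ linear, $\sigma,\tau$ arbitrary) - $(Ax)$: $x:A\vdash x:A$; $(\mathbf B_{\mathtt 0}I)$: $\vdash\mathtt 0:\mathbf B$; $(\mathbf B_{\mathtt 1}I)$: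 $\vdash\mathtt 1:\mathbf B$. - $(w)$: from $\Gamma\vdash M:\sigma$ infer $\Gamma,x:A\vdash M:\sigma$. - $(\multimap I)$: from $\Gamma,x:\sigma\vdash M:A$ infer $\Gamma\vdash\lambda x.M:\sigma\multimap A$. - $(\multimap E)$: from $\Gamma\vdash M:\sigma\multimap A$, $\Delta\vdash N:\sigma$, $\Gamma\#\Delta$ infer $\Gamma,\Delta\vdash MN:A$. - $(m)$: from $\Gamma,x_1:\sigma,\dots,x_n:\sigma\vdash M:\tau$ infer $\Gamma,x:{!\sigma}\vdash M[x/x_1,\dots,x/x_n]:\tau$. - $(sp)$: from $\Gamma\vdash M:\sigma$ infer $!\Gamma\vdash M:{!\sigma}$. - $(\forall I)$: from $\Gamma\vdash M:A$, $\alpha\notin\mathrm{FTV}(\Gamma)$ infer $\Gamma\vdash M:\forall\alpha.A$; $(\forall E)$: from $\Gamma\vdash M:\forall\alpha.B$ infer $\Gamma\vdash M:B[A/\alpha]$. - $(\mathbf BE)$: from $\Gamma\vdash M:\mathbf B$, $\Gamma\vdash N_0:A$, $\Gamma\vdash N_1:A$ infer $\Gamma\vdash\mathtt{if}\ M\ \mathtt{then}\ N_0\ \mathtt{else}\ N_1:A$. **Machine $\mathrm{K}_{\mathcal{B}}^{\mathcal{C}}$.** An m-context $\mathcal A$ is a sequence of assignments $x:=M$ with distinct variables ($\varepsilon$ empty, $@$ concatenation). $\mathbf B$-contexts: $\mathcal C[\circ]::=\circ\mid(\mathtt{if}\ \mathcal C[\circ]\ \mathtt{then}\ M\ \mathtt{else}\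 N)V_1\cdots V_n$; $\mathcal C[M]$ is the result of filling the hole $\circ$ by $M$ (and $\mathcal C[\mathcal C'[\circ]]$ similarly). The machine derives statements $\mathcal C,\mathcal A\models M\Downarrow\mathtt b$, with $\mathtt b\in\{\mathtt 0,\mathtt 1\}$, by: - $(Ax)$: $\mathcal C,\mathcal A\models\mathtt b\Downarrow\mathtt b$. - $(\beta)$: from $\mathcal C,\mathcal A@\{x':=N\}\models M[x'/x]V_1\cdots V_m\Downarrow\mathtt b$ infer $\mathcal C,\mathcal A\models(\lambda x.M)NV_1\cdots V_m\Downarrow\mathtt b$, $x'$ fresh. - $(h)$: if $\{x:=N\}\in\mathcal A$, from $\mathcal C,\mathcal A\models NV_1\cdots V_m\Downarrow\mathtt b$ infer $\mathcal C,\mathcal A\models xV_1\cdots V_m\Downarrow\mathtt b$. - $(\mathtt{if}\,\mathtt i)$, $\mathtt i\in\{\mathtt 0,\mathtt 1\}$: from $\mathcal C[(\mathtt{if}\ \circ\ \mathtt{then}\ N_{\mathtt 0}\ \mathtt{else}\ N_{\mathtt 1})V_1\cdots V_m],\mathcal A\models M\Downarrow\mathtt i$ and $\mathcal C,\mathcal A\models N_{\mathtt i}V_1\cdots V_m\Downarrow\mathtt b$ infer $\mathcal C,\mathcal A\models(\mathtt{if}\ M\ \mathtt{then}\ N_{\mathtt 0}\ \mathtt{else}\ N_{\mathtt 1})V_1\cdots V_m\Downarrow\mathtt b$. $\models M\Downarrow\mathtt b$ abbreviates $\circ,\varepsilon\models M\Downarrow\mathtt b$. **Encodings.** A string $s=b_0\cdots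 b_n$ over $\{0,1\}$ is encoded by the term $\underline{s}=\lambda c.\lambda z.c\,\mathtt b_0(\cdots(c\,\mathtt b_n z)\cdots)$ where $\mathtt b_i\in\{\mathtt 0,\mathtt 1\}$ is the constant corresponding to $b_i$ (the empty string by $\lambda c.\lambda z.z$); it is typable with $\mathbf S=\forall\alpha.!(\mathbf B\multimap\alpha\multimap\alpha)\multimap\alpha\multimap\alpha$. Output bits $b\in\{0,1\}$ are encoded by the constants $\underline{\mathtt b}\in\{\mathtt 0,\mathtt 1\}$. *)

theory Defs
  imports "HOL-Computational_Algebra.Polynomial"
begin

(* Types and terms are represented locally nameless: free variables are names, bound variables
   are de Bruijn indices, so that alpha-equivalence is equality. The types and terms proper are
   those without dangling indices (wf_lty, is_term). *)

type_synonym name = nat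


section \<open>Types\<close>

datatype lty = TBool | TFree name | TBound nat | Lolli ty lty (infixr "\<multimap>" 65) | TAll lty
  and ty = Lin lty | Bang ty

primrec lc_lty :: "nat \<Rightarrow> lty \<Rightarrow> bool" and lc_ty :: "nat \<Rightarrow> ty \<Rightarrow> bool" where
  "lc_lty k TBool \<longleftrightarrow> True"
| "lc_lty k (TFree \<alpha>) \<longleftrightarrow> True"
| "lc_lty k (TBound i) \<longleftrightarrow> i < k"
| "lc_lty k (\<sigma> \<multimap> A) \<longleftrightarrow> lc_ty k \<sigma> \<and> lc_lty k A"
| "lc_lty k (TAll A) \<longleftrightarrow> lc_lty (Suc k) A"
| "lc_ty k (Lin A) \<longleftrightarrow> lc_lty k A"
| "lc_ty k (Bang \<sigma>) \<longleftrightarrow> lc_ty k \<sigma>"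

abbreviation wf_lty :: "lty \<Rightarrow> bool" where
  "wf_lty \<equiv> lc_lty 0"

primrec ftv_lty :: "lty \<Rightarrow> name set" and ftv_ty :: "ty \<Rightarrow> name set" where
  "ftv_lty TBool = {}"
| "ftv_lty (TFree \<alpha>) = {\<alpha>}"
| "ftv_lty (TBound i) = {}"
| "ftv_lty (\<sigma> \<multimap> A) = ftv_ty \<sigma> \<union> ftv_lty A"
| "ftv_lty (TAll A) = ftv_lty A"
| "ftv_ty (Lin A) = ftv_lty A"
| "ftv_ty (Bang \<sigma>) = ftv_ty \<sigma>"

primrec close_lty :: "nat \<Rightarrow> name \<Rightarrow> lty \<Rightarrow> lty" and close_ty :: "nat \<Rightarrow> name \<Rightarrow> ty \<Rightarrow> ty" where
  "close_lty k \<alpha> TBool = TBool"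
| "close_lty k \<alpha> (TFree \<beta>) = (if \<beta> = \<alpha> then TBound k else TFree \<beta>)"
| "close_lty k \<alpha> (TBound i) = TBound i"
| "close_lty k \<alpha> (\<sigma> \<multimap> A) = close_ty k \<alpha> \<sigma> \<multimap> close_lty k \<alpha> A"
| "close_lty k \<alpha> (TAll A) = TAll (close_lty (Suc k) \<alpha> A)"
| "close_ty k \<alpha> (Lin A) = Lin (close_lty k \<alpha> A)"
| "close_ty k \<alpha> (Bang \<sigma>) = Bang (close_ty k \<alpha> \<sigma>)"

primrec open_lty :: "nat \<Rightarrow> lty \<Rightarrow> lty \<Rightarrow> lty" and open_ty :: "nat \<Rightarrow> lty \<Rightarrow> ty \<Rightarrow> ty" where
  "open_lty k C TBool = TBool"
| "open_lty k C (TFree \<alpha>) = TFree \<alpha>"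
| "open_lty k C (TBound i) = (if i = k then C else TBound i)"
| "open_lty k C (\<sigma> \<multimap> A) = open_ty k C \<sigma> \<multimap> open_lty k C A"
| "open_lty k C (TAll A) = TAll (open_lty (Suc k) C A)"
| "open_ty k C (Lin A) = Lin (open_lty k C A)"
| "open_ty k C (Bang \<sigma>) = Bang (open_ty k C \<sigma>)"

(* The type "forall alpha. A" for a named type variable alpha. *)
definition tall :: "name \<Rightarrow> lty \<Rightarrow> lty" where
  "tall \<alpha> A = TAll (close_lty 0 \<alpha> A)"


section \<open>Terms\<close>

(* The bits 0 and 1 are False and True throughout. *)
datatype trm = Free name | Bound nat | Const bool | Lam trm | App trm trm (infixl "\<cdot>" 70)
  | Cond trm trm trm

primrec lc :: "nat \<Rightarrow> trm \<Rightarrow> bool" where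
  "lc k (Free x) \<longleftrightarrow> True"
| "lc k (Bound i) \<longleftrightarrow> i < k"
| "lc k (Const b) \<longleftrightarrow> True"
| "lc k (Lam M) \<longleftrightarrow> lc (Suc k) M"
| "lc k (M \<cdot> N) \<longleftrightarrow> lc k M \<and> lc k N"
| "lc k (Cond M N P) \<longleftrightarrow> lc k M \<and> lc k N \<and> lc k P"

abbreviation is_term :: "trm \<Rightarrow> bool" where
  "is_term \<equiv> lc 0"

primrec fv :: "trm \<Rightarrow> name set" where
  "fv (Free x) = {x}"
| "fv (Bound i) = {}"
| "fv (Const b) = {}"
| "fv (Lam M) = fv M"
| "fv (M \<cdot> N) = fv M \<union> fv N"
| "fv (Cond M N P) = fv M \<union> fv N \<union> fv P"

primrec close_trm :: "nat \<Rightarrow> name \<Rightarrow> trm \<Rightarrow> trm" where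
  "close_trm k x (Free y) = (if y = x then Bound k else Free y)"
| "close_trm k x (Bound i) = Bound i"
| "close_trm k x (Const b) = Const b"
| "close_trm k x (Lam M) = Lam (close_trm (Suc k) x M)"
| "close_trm k x (M \<cdot> N) = close_trm k x M \<cdot> close_trm k x N"
| "close_trm k x (Cond M N P) = Cond (close_trm k x M) (close_trm k x N) (close_trm k x P)"

primrec open_trm :: "nat \<Rightarrow> trm \<Rightarrow> trm \<Rightarrow> trm" where
  "open_trm k L (Free x) = Free x"
| "open_trm k L (Bound i) = (if i = k then L else Bound i)"
| "open_trm k L (Const b) = Const b"
| "open_trm k L (Lam M) = Lam (open_trm (Suc k) L M)"
| "open_trm k L (M \<cdot> N) = open_trm k L M \<cdot> open_trm k L N"
| "open_trm k L (Cond M N P) = Cond (open_trm k L M) (open_trm k L N) (open_trm k L P)"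

(* The abstraction "lambda x. M" for a named variable x. *)
definition lam :: "name \<Rightarrow> trm \<Rightarrow> trm" where
  "lam x M = Lam (close_trm 0 x M)"

(* merge X x M is M[x/x1,...,x/xn], where X = {x1,...,xn}. *)
primrec merge :: "name set \<Rightarrow> name \<Rightarrow> trm \<Rightarrow> trm" where
  "merge X x (Free y) = Free (if y \<in> X then x else y)"
| "merge X x (Bound i) = Bound i"
| "merge X x (Const b) = Const b"
| "merge X x (Lam M) = Lam (merge X x M)"
| "merge X x (M \<cdot> N) = merge X x M \<cdot> merge X x N"
| "merge X x (Cond M N P) = Cond (merge X x M) (merge X x N) (merge X x P)"

(* apps M [V1,...,Vm] is M V1 ... Vm. *)
abbreviation apps :: "trm \<Rightarrow> trm list \<Rightarrow> trm" where
  "apps M Vs \<equiv> foldl (\<cdot>) M Vs"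


section \<open>The type assignment system\<close>

(* The rules only generate contexts with finite domain. *)
type_synonym ctx = "name \<rightharpoonup> ty"

definition bang_ctx :: "ctx \<Rightarrow> ctx" where
  "bang_ctx \<Gamma> = map_option Bang \<circ> \<Gamma>"

definition ftv_ctx :: "ctx \<Rightarrow> name set" where
  "ftv_ctx \<Gamma> = (\<Union>\<sigma>\<in>ran \<Gamma>. ftv_ty \<sigma>)"

(* const_ctx {x1,...,xn} sigma is x1:sigma,...,xn:sigma. *)
definition const_ctx :: "name set \<Rightarrow> ty \<Rightarrow> ctx" where
  "const_ctx X \<sigma> = (\<lambda>x. if x \<in> X then Some \<sigma> else None)"

(* The well-formedness premises in Ax, W and AllE confine derivations to types without
   dangling indices. *)
inductive typing :: "ctx \<Rightarrow> trm \<Rightarrow> ty \<Rightarrow> bool" ("_ \<turnstile> _ \<Ztypecolon> _" [51, 51, 51] 50) where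
  Ax: "wf_lty A \<Longrightarrow> [x \<mapsto> Lin A] \<turnstile> Free x \<Ztypecolon> Lin A"
| BI: "Map.empty \<turnstile> Const b \<Ztypecolon> Lin TBool"
| W: "\<Gamma> \<turnstile> M \<Ztypecolon> \<sigma> \<Longrightarrow> x \<notin> dom \<Gamma> \<Longrightarrow> wf_lty A \<Longrightarrow> \<Gamma>(x \<mapsto> Lin A) \<turnstile> M \<Ztypecolon> \<sigma>"
| LolliI: "\<Gamma>(x \<mapsto> \<sigma>) \<turnstile> M \<Ztypecolon> Lin A \<Longrightarrow> x \<notin> dom \<Gamma> \<Longrightarrow> \<Gamma> \<turnstile> lam x M \<Ztypecolon> Lin (\<sigma> \<multimap> A)"
| LolliE: "\<Gamma> \<turnstile> M \<Ztypecolon> Lin (\<sigma> \<multimap> A) \<Longrightarrow> \<Delta> \<turnstile> N \<Ztypecolon> \<sigma> \<Longrightarrow> dom \<Gamma> \<inter> dom \<Delta> = {} \<Longrightarrow>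
    \<Gamma> ++ \<Delta> \<turnstile> M \<cdot> N \<Ztypecolon> Lin A"
| M: "\<Gamma> ++ const_ctx X \<sigma> \<turnstile> M \<Ztypecolon> \<tau> \<Longrightarrow> finite X \<Longrightarrow> X \<noteq> {} \<Longrightarrow> dom \<Gamma> \<inter> X = {} \<Longrightarrow> x \<notin> dom \<Gamma> \<Longrightarrow>
    \<Gamma>(x \<mapsto> Bang \<sigma>) \<turnstile> merge X x M \<Ztypecolon> \<tau>"
| Sp: "\<Gamma> \<turnstile> M \<Ztypecolon> \<sigma> \<Longrightarrow> bang_ctx \<Gamma> \<turnstile> M \<Ztypecolon> Bang \<sigma>"
| AllI: "\<Gamma> \<turnstile> M \<Ztypecolon> Lin A \<Longrightarrow> \<alpha> \<notin> ftv_ctx \<Gamma> \<Longrightarrow> \<Gamma> \<turnstile> M \<Ztypecolon> Lin (tall \<alpha> A)"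
| AllE: "\<Gamma> \<turnstile> M \<Ztypecolon> Lin (TAll B) \<Longrightarrow> wf_lty A \<Longrightarrow> \<Gamma> \<turnstile> M \<Ztypecolon> Lin (open_lty 0 A B)"
| BE: "\<Gamma> \<turnstile> M \<Ztypecolon> Lin TBool \<Longrightarrow> \<Gamma> \<turnstile> N0 \<Ztypecolon> Lin A \<Longrightarrow> \<Gamma> \<turnstile> N1 \<Ztypecolon> Lin A \<Longrightarrow>
    \<Gamma> \<turnstile> Cond M N0 N1 \<Ztypecolon> Lin A"

definition closed_term :: "trm \<Rightarrow> bool" where
  "closed_term M \<longleftrightarrow> is_term M \<and> fv M = {}"

definition program :: "trm \<Rightarrow> bool" where
  "program M \<longleftrightarrow> closed_term M \<and> (Map.empty \<turnstile> M \<Ztypecolon> Lin TBool)"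


section \<open>The abstract machine\<close>

type_synonym mctx = "(name \<times> trm) list"

definition fv_mctx :: "mctx \<Rightarrow> name set" where
  "fv_mctx \<A> = (\<Union>(x, N)\<in>set \<A>. insert x (fv N))"

(* CIf C M N Vs is the context (if C then M else N) V1 ... Vn. *)
datatype bctx = Hole | CIf bctx trm trm "trm list"

primrec fv_bctx :: "bctx \<Rightarrow> name set" where
  "fv_bctx Hole = {}"
| "fv_bctx (CIf C M N Vs) = fv_bctx C \<union> fv M \<union> fv N \<union> \<Union>(fv ` set Vs)"

(* fill_bctx C C' is C[C'[.]]. *)
primrec fill_bctx :: "bctx \<Rightarrow> bctx \<Rightarrow> bctx" where
  "fill_bctx Hole C' = C'"
| "fill_bctx (CIf C M N Vs) C' = CIf (fill_bctx C C') M N Vs"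

(* The premise of Ax makes every derivable statement one about an m-context with distinct
   variables. Pitfall: the "then" branch belongs to the constant 0, the "else" branch to 1. *)
inductive eval :: "bctx \<Rightarrow> mctx \<Rightarrow> trm \<Rightarrow> bool \<Rightarrow> bool" ("_, _ \<Turnstile> _ \<Down> _" [51, 51, 51, 51] 50) where
  Ax: "distinct (map fst \<A>) \<Longrightarrow> C, \<A> \<Turnstile> Const b \<Down> b"
| Beta: "C, \<A> @ [(x', N)] \<Turnstile> apps (open_trm 0 (Free x') M) Vs \<Down> b \<Longrightarrow>
    x' \<notin> fv_bctx C \<union> fv_mctx \<A> \<union> fv (apps (Lam M \<cdot> N) Vs) \<Longrightarrow>
    C, \<A> \<Turnstile> apps (Lam M \<cdot> N) Vs \<Down> b"
| H: "(x, N) \<in> set \<A> \<Longrightarrow> C, \<A> \<Turnstile> apps N Vs \<Down> b \<Longrightarrow> C, \<A> \<Turnstile> apps (Free x) Vs \<Down> b"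
| Cond: "fill_bctx C (CIf Hole N0 N1 Vs), \<A> \<Turnstile> M \<Down> i \<Longrightarrow>
    C, \<A> \<Turnstile> apps (if i then N1 else N0) Vs \<Down> b \<Longrightarrow>
    C, \<A> \<Turnstile> apps (Cond M N0 N1) Vs \<Down> b"

abbreviation evaluates :: "trm \<Rightarrow> bool \<Rightarrow> bool" ("\<Turnstile> _ \<Down> _" [51, 51] 50) where
  "\<Turnstile> M \<Down> b \<equiv> eval Hole [] M b"


section \<open>Encoding of strings\<close>

(* lambda c. lambda z. c b0 (... (c bn z) ...), with c = Bound 1 and z = Bound 0 *)
definition enc :: "bool list \<Rightarrow> trm" where
  "enc s = Lam (Lam (foldr (\<lambda>b M. Bound 1 \<cdot> Const b \<cdot> M) s (Bound 0)))"


section \<open>Polynomial space\<close>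

(* Deterministic Turing machines with a single one-way infinite tape. The symbols 0 and 1 of the
   tape alphabet are the input symbols. *)
datatype direction = MoveL | MoveR

record turing_machine =
  states :: "nat set"
  tape_symbols :: "nat set"
  blank :: nat
  start :: nat
  accept :: nat
  reject :: nat
  trans :: "nat \<Rightarrow> nat \<Rightarrow> nat \<times> nat \<times> direction"

definition wf_tm :: "turing_machine \<Rightarrow> bool" where
  "wf_tm T \<longleftrightarrow> finite (states T) \<and> finite (tape_symbols T) \<and>
     {0, 1} \<subseteq> tape_symbols T \<and> blank T \<in> tape_symbols T - {0, 1} \<and>
     {start T, accept T, reject T} \<subseteq> states T \<and> accept T \<noteq> reject T \<and>
     (\<forall>q\<in>states T - {accept T, reject T}. \<forall>a\<in>tape_symbols T.
        trans T q a \<in> states T \<times> tape_symbols T \<times> UNIV)"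

(* (state, head position, tape contents) *)
type_synonym config = "nat \<times> nat \<times> (nat \<Rightarrow> nat)"

definition init_config :: "turing_machine \<Rightarrow> bool list \<Rightarrow> config" where
  "init_config T s =
     (start T, 0, \<lambda>i. if i < length s then of_bool (s ! i) else blank T)"

(* Moving left on the leftmost cell leaves the head where it is (truncated subtraction);
   halting configurations are fixed points. *)
definition step :: "turing_machine \<Rightarrow> config \<Rightarrow> config" where
  "step T = (\<lambda>(q, h, t).
     if q \<in> {accept T, reject T} then (q, h, t)
     else let (q', a, d) = trans T q (t h)
          in (q', case d of MoveL \<Rightarrow> h - 1 | MoveR \<Rightarrow> Suc h, t(h := a)))"

definition run :: "turing_machine \<Rightarrow> bool list \<Rightarrow> nat \<Rightarrow> config" where
  "run T s n = (step T ^^ n) (init_config T s)"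

definition decides :: "turing_machine \<Rightarrow> (bool list \<Rightarrow> bool) \<Rightarrow> bool" where
  "decides T D \<longleftrightarrow> (\<forall>s. \<exists>n. fst (run T s n) = (if D s then accept T else reject T))"

definition scanned_cells :: "turing_machine \<Rightarrow> bool list \<Rightarrow> nat set" where
  "scanned_cells T s = range (\<lambda>n. fst (snd (run T s n)))"

definition runs_in_space :: "turing_machine \<Rightarrow> (nat \<Rightarrow> nat) \<Rightarrow> bool" where
  "runs_in_space T f \<longleftrightarrow>
     (\<forall>s. finite (scanned_cells T s) \<and> card (scanned_cells T s) \<le> f (length s))"

definition PSPACE :: "(bool list \<Rightarrow> bool) set" where
  "PSPACE = {D. \<exists>T p. wf_tm T \<and> decides T D \<and> runs_in_space T (poly p)}"

end

theory Submission
  imports Defs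
begin

text \<open>
  A configuration on m tape cells is a nested pair of m cells, and the type of such tuples grows
  with m. All that is needed of this type is a closed term, the sweeper, that passes a two-way
  finite transducer over the tuple; the pair (empty tape, sweeper) is packed existentially, so that
  a polynomially long iteration of a uniformly typed step can produce it for m polynomial in the
  length of the input. One step of a Turing machine is one sweep.

  The only way to run exponentially many steps is to square the step function polynomially often.
  The step function q is a linear resource, but the guard of a conditional shares its context with
  the branches: the sweeper asks q for the cells of the next configuration one after the other in
  guards, thereby turns them into data, and still has q at hand to continue from there. This
  squares q, and 2 to the power of a polynomial suffices as a bound for the running time.

  The abstract machine computes call-by-name evaluation with substitution, so that programs can be
  verified by head expansion.
\<close>

section \<open>Substitution\<close>

text \<open>Why q may not simply be used twice: contraction would turn the assumption q : A into q :
  !A, so that squaring would have the type !A \<multimap> A, whereas a string iterates only maps A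
  \<multimap> A for one linear type A. The same restriction forces the growing tuple type out of
  sight. A guard returns nothing but a boolean. Hence all data are handled in continuation passing
  style with answer type B, and a list that is not yet a tuple is known only through boolean
  observations of it. The sweeper is polymorphic in the type of the resource behind these
  observations: an ordinary sweep uses the tuple itself, squaring uses q. A derivation is required
  for each input separately, so the number of bangs may vary with the input and is left existential,
  except in the growth of the tuple, where it must be the same before and after. A machine with
  alphabet U that halts on m cells does so within |U|^m \<le> 2^(|U| m) steps. Both m and |U| m are
  replaced by powers (|s| + c)^d, the numbers to which nested iterations along s can count.\<close>

primrec subst :: "name \<Rightarrow> trm \<Rightarrow> trm \<Rightarrow> trm" where
  "subst x L (Free y) = (if y = x then L else Free y)"
| "subst x L (Bound i) = Bound i"
| "subst x L (Const b) = Const b"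
| "subst x L (Lam M) = Lam (subst x L M)"
| "subst x L (M \<cdot> N) = subst x L M \<cdot> subst x L N"
| "subst x L (Cond M N P) = Cond (subst x L M) (subst x L N) (subst x L P)"

lemma lc_mono: "lc k M \<Longrightarrow> k \<le> i \<Longrightarrow> lc i M"
  by (induction M arbitrary: k i) auto

lemma open_trm_lc: "lc k M \<Longrightarrow> k \<le> i \<Longrightarrow> open_trm i L M = M"
  by (induction M arbitrary: k i) auto

lemma open_close: "lc k M \<Longrightarrow> open_trm k L (close_trm k x M) = subst x L M"
  by (induction M arbitrary: k) auto

lemma lc_close: "lc k M \<Longrightarrow> lc (Suc k) (close_trm k x M)"
  by (induction M arbitrary: k) auto

lemma lc_open: "lc (Suc k) M \<Longrightarrow> is_term L \<Longrightarrow> lc k (open_trm k L M)"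
  by (induction M arbitrary: k) (auto simp: lc_mono)

lemma lc_subst: "lc k M \<Longrightarrow> is_term L \<Longrightarrow> lc k (subst x L M)"
  by (induction M arbitrary: k) (auto simp: lc_mono)

lemma fv_close [simp]: "fv (close_trm k x M) = fv M - {x}"
  by (induction M arbitrary: k) auto

lemma fv_open: "fv (open_trm k L M) \<subseteq> fv M \<union> fv L"
  by (induction M arbitrary: k) (simp_all, blast+)

lemma subst_fresh: "x \<notin> fv M \<Longrightarrow> subst x L M = M"
  by (induction M) auto

lemma subst_close: "x \<noteq> y \<Longrightarrow> y \<notin> fv L \<Longrightarrow> subst x L (close_trm k y M) = close_trm k y (subst x L M)"
proof (induction M arbitrary: k)
  case (Free z)
  have "close_trm k y L = L" if "y \<notin> fv L" for k L
    using that by (induction L arbitrary: k) auto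
  with Free show ?case by auto
qed auto

lemma subst_open: "is_term L \<Longrightarrow> subst x L (open_trm k P M) = open_trm k (subst x L P) (subst x L M)"
  by (induction M arbitrary: k) (auto simp: open_trm_lc)

lemma finite_fv [simp]: "finite (fv M)"
  by (induction M) auto

lemma subst_apps: "subst x L (apps M Vs) = apps (subst x L M) (map (subst x L) Vs)"
  by (induction Vs arbitrary: M) auto

lemma fv_apps: "fv (apps M Vs) = fv M \<union> \<Union> (fv ` set Vs)"
  by (induction Vs arbitrary: M) auto

lemma lc_apps: "lc k (apps M Vs) \<longleftrightarrow> lc k M \<and> (\<forall>V\<in>set Vs. lc k V)"
  by (induction Vs arbitrary: M) auto

section \<open>Evaluation by substitution\<close>

text \<open>Reference semantics for the correctness of the program: it has neither assignments nor
  fresh names, so closed terms can be rewritten directly. \<open>Vs\<close> are the pending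
  arguments.\<close>

inductive ev :: "trm \<Rightarrow> bool \<Rightarrow> bool" where
  Const: "ev (Const b) b"
| Beta: "ev (apps (open_trm 0 N M) Vs) b \<Longrightarrow> ev (apps (Lam M \<cdot> N) Vs) b"
| Cond: "ev M i \<Longrightarrow> ev (apps (if i then N1 else N0) Vs) b \<Longrightarrow> ev (apps (Cond M N0 N1) Vs) b"

primrec is_app :: "trm \<Rightarrow> bool" where
  "is_app (Free y) = False"
| "is_app (Bound i) = False"
| "is_app (Const b) = False"
| "is_app (Lam M) = False"
| "is_app (M \<cdot> N) = True"
| "is_app (Cond M N P) = False"

lemma apps_head_exists: "\<exists>h Vs. M = apps h Vs \<and> \<not> is_app h"
proof (induction M)
  case (App M N)
  then obtain h Vs where "M = apps h Vs" "\<not> is_app h" by auto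
  then have "M \<cdot> N = apps h (Vs @ [N])" by simp
  with \<open>\<not> is_app h\<close> show ?case by blast
qed (metis foldl_Nil is_app.simps)+

text \<open>The last arguments are peeled off on both sides; if one list were exhausted first, a
  head would be an application.\<close>

lemma apps_eq_iff:
  assumes "\<not> is_app h" "\<not> is_app h'"
  shows "apps h Vs = apps h' Vs' \<longleftrightarrow> h = h' \<and> Vs = Vs'"
proof (induction Vs arbitrary: Vs' rule: rev_induct)
  case Nil
  then show ?case using assms by (cases Vs' rule: rev_cases) auto
next
  case (snoc V Vs)
  then show ?case using assms by (cases Vs' rule: rev_cases) auto
qed

text \<open>The rules of \<open>ev\<close> match terms through \<open>apps\<close>, which is not a
  constructor; these facts make their inversion possible.\<close>

lemma apps_eq_head:
  "apps (Lam M \<cdot> N) Vs = apps (Lam M' \<cdot> N') Vs' \<longleftrightarrow> M = M' \<and> N = N' \<and> Vs = Vs'"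
  "apps (Cond M N P) Vs = apps (Cond M' N' P') Vs' \<longleftrightarrow> M = M' \<and> N = N' \<and> P = P' \<and> Vs = Vs'"
  "apps (Lam M \<cdot> N) Vs \<noteq> apps (Cond M' N' P') Vs'"
  "apps (Cond M' N' P') Vs' \<noteq> apps (Lam M \<cdot> N) Vs"
  "Const b \<noteq> apps (Lam M \<cdot> N) Vs"
  "apps (Lam M \<cdot> N) Vs \<noteq> Const b"
  "Const b \<noteq> apps (Cond M' N' P') Vs"
  "apps (Cond M' N' P') Vs \<noteq> Const b"
  using apps_eq_iff[of "Lam M" "Lam M'" "N # Vs" "N' # Vs'"] 
   apps_eq_iff[of "Lam M" "Cond M' N' P'" "N # Vs" "Vs'"]
   apps_eq_iff[of "Cond M' N' P'" "Lam M" "Vs'" "N # Vs"]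
   apps_eq_iff[of "Cond M N P" "Cond M' N' P'" Vs Vs']
   apps_eq_iff[of "Const b" "Lam M" "[]" "N # Vs"] apps_eq_iff[of "Const b" "Cond M' N' P'" "[]" "Vs"]
   apps_eq_iff[of "Lam M" "Const b" "N # Vs" "[]"] apps_eq_iff[of "Cond M' N' P'" "Const b" "Vs" "[]"]
  by auto

lemma ev_deterministic: "ev M b \<Longrightarrow> ev M b' \<Longrightarrow> b' = b"
proof (induction arbitrary: b' rule: ev.induct)
  case (Const b)
  then show ?case by (cases rule: ev.cases) (auto simp: apps_eq_head)
next
  case (Beta N M Vs b)
  from Beta.prems have "ev (apps (open_trm 0 N M) Vs) b'"
    by (cases rule: ev.cases) (auto simp: apps_eq_head simp del: foldl_Cons)
  then show ?case by (rule Beta.IH)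
next
  case (Cond M i N1 N0 Vs b)
  from Cond.prems obtain i' where "ev M i'" "ev (apps (if i' then N1 else N0) Vs) b'"
    by (cases rule: ev.cases) (auto simp: apps_eq_head simp del: foldl_Cons)
  with Cond.IH show ?case by metis
qed

section \<open>The machine computes evaluation by substitution\<close>

text \<open>The last assignment is substituted first: its term may mention earlier variables, which
  the remaining substitutions then replace.\<close>

definition unfold_ctx :: "mctx \<Rightarrow> trm \<Rightarrow> trm" where
  "unfold_ctx \<A> M = foldr (\<lambda>(x, N). subst x N) \<A> M"

text \<open>Invariant of the m-contexts in runs that start from a closed term:
  \<open>(\<beta>)\<close> appends an argument that can only mention variables assigned
  before.\<close>

definition ordered_ctx :: "mctx \<Rightarrow> bool" where
  "ordered_ctx \<A> \<longleftrightarrow> distinct (map fst \<A>) \<and> (\<forall>i<length \<A>. is_term (snd (\<A> ! i)) \<and>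
     fv (snd (\<A> ! i)) \<subseteq> set (map fst (take i \<A>)))"

lemma ordered_ctx_Nil: "ordered_ctx []"
  by (simp add: ordered_ctx_def)

lemma ordered_ctx_snoc:
  "ordered_ctx (\<A> @ [(x, N)]) \<longleftrightarrow>
     ordered_ctx \<A> \<and> x \<notin> fst ` set \<A> \<and> is_term N \<and> fv N \<subseteq> fst ` set \<A>"
  by (auto simp: ordered_ctx_def nth_append less_Suc_eq)

lemma ordered_ctx_induct [consumes 1, case_names Nil snoc]:
  assumes "ordered_ctx \<A>" "P []"
    "\<And>\<A> x N. ordered_ctx \<A> \<Longrightarrow> x \<notin> fst ` set \<A> \<Longrightarrow> is_term N \<Longrightarrow> fv N \<subseteq> fst ` set \<A> \<Longrightarrow> P \<A> \<Longrightarrow>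
       P (\<A> @ [(x, N)])"
  shows "P \<A>"
  using assms(1)
proof (induction \<A> rule: rev_induct)
  case (snoc p \<A>)
  then show ?case using assms(3) by (cases p) (auto simp: ordered_ctx_snoc)
qed (rule assms(2))

lemma unfold_ctx_simps [simp]:
  "unfold_ctx \<A> (M \<cdot> N) = unfold_ctx \<A> M \<cdot> unfold_ctx \<A> N"
  "unfold_ctx \<A> (Const b) = Const b"
  "unfold_ctx \<A> (Lam M) = Lam (unfold_ctx \<A> M)"
  "unfold_ctx \<A> (Cond M N P) = Cond (unfold_ctx \<A> M) (unfold_ctx \<A> N) (unfold_ctx \<A> P)"
  by (induction \<A>) (auto simp: unfold_ctx_def)

lemma unfold_ctx_apps: "unfold_ctx \<A> (apps M Vs) = apps (unfold_ctx \<A> M) (map (unfold_ctx \<A>) Vs)"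
  by (induction Vs arbitrary: M) auto

lemma unfold_ctx_snoc: "unfold_ctx (\<A> @ [(x, N)]) M = unfold_ctx \<A> (subst x N M)"
  by (simp add: unfold_ctx_def)

lemma unfold_ctx_open:
  "ordered_ctx \<A> \<Longrightarrow> unfold_ctx \<A> (open_trm k P M) = open_trm k (unfold_ctx \<A> P) (unfold_ctx \<A> M)"
  by (induction arbitrary: P M rule: ordered_ctx_induct)
    (auto simp: unfold_ctx_snoc subst_open unfold_ctx_def)

text \<open>Assignments made after that of x cannot interfere: their variables differ from x and do
  not occur in N.\<close>

lemma ordered_ctx_lookup:
  "ordered_ctx \<A> \<Longrightarrow> (x, N) \<in> set \<A> \<Longrightarrow>
     unfold_ctx \<A> (Free x) = unfold_ctx \<A> N \<and> is_term N \<and> fv N \<subseteq> fst ` set \<A>"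
proof (induction rule: ordered_ctx_induct)
  case (snoc \<A> y P)
  show ?case
  proof (cases "(x, N) = (y, P)")
    case True
    moreover from snoc True have "y \<notin> fv N" by auto
    ultimately show ?thesis using snoc by (auto simp: unfold_ctx_snoc subst_fresh)
  next
    case False
    with snoc.prems have xN: "(x, N) \<in> set \<A>" by auto
    with snoc.hyps have "y \<noteq> x" by force
    moreover from snoc.IH[OF xN] snoc.hyps have "y \<notin> fv N" by auto
    ultimately show ?thesis using snoc.IH[OF xN] by (auto simp: unfold_ctx_snoc subst_fresh)
  qed
qed auto

text \<open>Reconciles the two beta rules: assigning the argument to a fresh variable and unfolding
  it later amounts to substituting it at once.\<close>

lemma subst_open_fresh:
  "x \<notin> fv M \<Longrightarrow> is_term N \<Longrightarrow> subst x N (open_trm k (Free x) M) = open_trm k N M"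
  by (simp add: subst_open subst_fresh)

text \<open>An \<open>(h)\<close> step is invisible after unfolding; every other machine step
  unfolds to the corresponding step of \<open>ev\<close>.\<close>

lemma eval_imp_ev:
  "C, \<A> \<Turnstile> M \<Down> b \<Longrightarrow> ordered_ctx \<A> \<Longrightarrow> is_term M \<Longrightarrow> fv M \<subseteq> fst ` set \<A> \<Longrightarrow> ev (unfold_ctx \<A> M) b"
proof (induction rule: eval.induct)
  case (Ax \<A> C b)
  then show ?case by (simp add: ev.Const)
next
  case (Beta C \<A> x' N M Vs b)
  have fr: "x' \<notin> fst ` set \<A>" "x' \<notin> fv M" "x' \<notin> fv N" "\<forall>V\<in>set Vs. x' \<notin> fv V"
    using Beta.hyps by (force simp: fv_mctx_def fv_apps)+
  from Beta.prems have N: "is_term N" "fv N \<subseteq> fst ` set \<A>" "lc 1 M"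
    by (auto simp: lc_apps fv_apps)
  have vs: "map (subst x' N) Vs = Vs"
    using fr by (intro map_idI) (auto simp: subst_fresh)
  have "ev (unfold_ctx (\<A> @ [(x', N)]) (apps (open_trm 0 (Free x') M) Vs)) b"
  proof (rule Beta.IH)
    show "ordered_ctx (\<A> @ [(x', N)])" using Beta.prems N fr by (simp add: ordered_ctx_snoc)
    show "is_term (apps (open_trm 0 (Free x') M) Vs)" using Beta.prems N by (auto simp: lc_apps lc_open)
    show "fv (apps (open_trm 0 (Free x') M) Vs) \<subseteq> fst ` set (\<A> @ [(x', N)])"
      using Beta.prems fv_open[of 0 "Free x'" M] by (auto simp: fv_apps)
  qed
  then have "ev (unfold_ctx \<A> (apps (open_trm 0 N M) Vs)) b"
    using fr N by (simp add: unfold_ctx_snoc subst_apps vs subst_open_fresh)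
  then have "ev (apps (open_trm 0 (unfold_ctx \<A> N) (unfold_ctx \<A> M)) (map (unfold_ctx \<A>) Vs)) b"
    using Beta.prems by (simp add: unfold_ctx_apps unfold_ctx_open)
  then show ?case using ev.Beta by (simp add: unfold_ctx_apps)
next
  case (H x N \<A> C Vs b)
  then have "is_term N" "fv N \<subseteq> fst ` set \<A>" "unfold_ctx \<A> (Free x) = unfold_ctx \<A> N"
    using ordered_ctx_lookup by blast+
  with H show ?case by (auto simp: unfold_ctx_apps lc_apps fv_apps)
next
  case (Cond C N0 N1 Vs \<A> M i b)
  then have "ev (unfold_ctx \<A> M) i" "ev (unfold_ctx \<A> (apps (if i then N1 else N0) Vs)) b"
    by (auto simp: lc_apps fv_apps split: if_splits)
  then show ?case
    using ev.Cond[of "unfold_ctx \<A> M" i "unfold_ctx \<A> N1" "unfold_ctx \<A> N0" "map (unfold_ctx \<A>) Vs" b]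
    by (auto simp: unfold_ctx_apps if_distrib split: if_splits)
qed

definition in_ctx :: "mctx \<Rightarrow> trm \<Rightarrow> bool" where
  "in_ctx \<A> M \<longleftrightarrow> is_term M \<and> fv M \<subseteq> fst ` set \<A>"

lemma in_ctx_apps: "in_ctx \<A> (apps M Vs) \<longleftrightarrow> in_ctx \<A> M \<and> (\<forall>V\<in>set Vs. in_ctx \<A> V)"
  by (auto simp: in_ctx_def lc_apps fv_apps)

(* Chasing head variables terminates because an assignment only mentions earlier variables. *)
lemma resolve_head:
  assumes "ordered_ctx \<A>" "in_ctx \<A> (apps (Free x) Vs)"
  shows "\<exists>h Us. in_ctx \<A> (apps h (Us @ Vs)) \<and> \<not> is_app h \<and> (\<forall>y. h \<noteq> Free y) \<and>
    unfold_ctx \<A> (apps h (Us @ Vs)) = unfold_ctx \<A> (apps (Free x) Vs) \<and>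
    (\<forall>C b. (C, \<A> \<Turnstile> apps h (Us @ Vs) \<Down> b) \<longrightarrow> (C, \<A> \<Turnstile> apps (Free x) Vs \<Down> b))"
proof -
  obtain i where "i < length \<A>" "fst (\<A> ! i) = x"
    using assms(2) by (auto simp: in_ctx_apps in_ctx_def in_set_conv_nth fv_apps)
  then show ?thesis using assms(2)
  proof (induction i arbitrary: x Vs rule: less_induct)
    case (less i)
    define N where "N = snd (\<A> ! i)"
    have xN: "(x, N) \<in> set \<A>" using less.prems N_def by (metis nth_mem prod.collapse)
    from ordered_ctx_lookup[OF assms(1) xN]
    have N: "in_ctx \<A> N" "unfold_ctx \<A> (Free x) = unfold_ctx \<A> N" by (auto simp: in_ctx_def)
    obtain h Us where hUs: "N = apps h Us" "\<not> is_app h" using apps_head_exists by blast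
    have wf: "in_ctx \<A> (apps h (Us @ Vs))"
      using N less.prems hUs by (auto simp: in_ctx_apps)
    have unf: "unfold_ctx \<A> (apps h (Us @ Vs)) = unfold_ctx \<A> (apps (Free x) Vs)"
      using N hUs by (simp add: unfold_ctx_apps)
    have H: "C, \<A> \<Turnstile> apps h (Us @ Vs) \<Down> b \<Longrightarrow> C, \<A> \<Turnstile> apps (Free x) Vs \<Down> b" for C b
      using eval.H[OF xN] hUs by simp
    show ?case
    proof (cases "\<exists>y. h = Free y")
      case False
      then show ?thesis using wf unf H hUs(2) by blast
    next
      case True
      then obtain y where y: "h = Free y" by blast
      have "fv N \<subseteq> set (map fst (take i \<A>))"
        using assms(1) less.prems by (simp add: ordered_ctx_def N_def)
      then have "y \<in> set (map fst (take i \<A>))" using hUs y by (auto simp: fv_apps)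
      then obtain j where j: "j < i" "j < length \<A>" "fst (\<A> ! j) = y"
        using less.prems(1) by (auto simp: in_set_conv_nth)
      from less.IH[OF j] wf[unfolded y]
      obtain h' Us' where "in_ctx \<A> (apps h' (Us' @ Us @ Vs)) \<and> \<not> is_app h' \<and> (\<forall>z. h' \<noteq> Free z) \<and>
        unfold_ctx \<A> (apps h' (Us' @ Us @ Vs)) = unfold_ctx \<A> (apps (Free y) (Us @ Vs)) \<and>
        (\<forall>C b. (C, \<A> \<Turnstile> apps h' (Us' @ Us @ Vs) \<Down> b) \<longrightarrow> (C, \<A> \<Turnstile> apps (Free y) (Us @ Vs) \<Down> b))"
        by blast
      then show ?thesis
        using unf H y by (intro exI[of _ h'] exI[of _ "Us' @ Us"]) simp
    qed
  qed
qed

text \<open>Looks up variables until the head constructor is the one that the unfolded term shows,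
  so that the next rule of \<open>ev\<close> determines the next rule of the machine.\<close>

lemma rigid_head_exists:
  assumes "ordered_ctx \<A>" "in_ctx \<A> M"
  shows "\<exists>h Vs. in_ctx \<A> (apps h Vs) \<and> \<not> is_app h \<and> (\<forall>y. h \<noteq> Free y) \<and>
    unfold_ctx \<A> (apps h Vs) = unfold_ctx \<A> M \<and>
    (\<forall>C b. (C, \<A> \<Turnstile> apps h Vs \<Down> b) \<longrightarrow> (C, \<A> \<Turnstile> M \<Down> b))"
proof -
  obtain h Vs where M: "M = apps h Vs" "\<not> is_app h" using apps_head_exists by blast
  show ?thesis
  proof (cases "\<exists>x. h = Free x")
    case True
    then show ?thesis using resolve_head assms M by blast
  next
    case False
    then show ?thesis using assms M by blast
  qed
qed

lemma unfold_ctx_is_app: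
  assumes "\<not> is_app h" "\<forall>y. h \<noteq> Free y"
  shows "\<not> is_app (unfold_ctx \<A> h)"
  using assms
proof (cases h)
  case (Bound i)
  have "unfold_ctx \<A> (Bound i) = Bound i" by (induction \<A>) (auto simp: unfold_ctx_def)
  with Bound show ?thesis by simp
qed auto

text \<open>Induction on \<open>ev\<close>, with the claim made for all machine states that unfold
  to the given term: the premises lead to longer m-contexts and deeper B-contexts, and look-ups are
  inserted before each step by \<open>rigid_head_exists\<close>.\<close>

lemma ev_imp_eval:
  "ev P b \<Longrightarrow> ordered_ctx \<A> \<Longrightarrow> in_ctx \<A> M \<Longrightarrow> unfold_ctx \<A> M = P \<Longrightarrow> C, \<A> \<Turnstile> M \<Down> b"
proof (induction arbitrary: C \<A> M rule: ev.induct)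
  case (Const b)
  from rigid_head_exists[OF Const.prems(1,2)] obtain h Vs where
    h: "in_ctx \<A> (apps h Vs)" "\<not> is_app h" "\<forall>y. h \<noteq> Free y"
      "unfold_ctx \<A> (apps h Vs) = unfold_ctx \<A> M" "\<And>C b. C, \<A> \<Turnstile> apps h Vs \<Down> b \<Longrightarrow> C, \<A> \<Turnstile> M \<Down> b" by blast
  have hterm: "is_term h" using h(1) by (simp add: in_ctx_def lc_apps)
  have "apps (unfold_ctx \<A> h) (map (unfold_ctx \<A>) Vs) = apps (Const b) []"
    using h(4) Const.prems by (simp add: unfold_ctx_apps)
  then have *: "unfold_ctx \<A> h = Const b" "Vs = []"
    using apps_eq_iff[OF unfold_ctx_is_app[OF h(2,3)], of "Const b" \<A> _ "[]"] by simp_all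
  then have "h = Const b"
    using hterm h(2,3) by (cases h) auto
  with * h(5) show ?case using Const.prems by (auto intro!: eval.Ax simp: ordered_ctx_def)
next
  case (Beta N P Vs b)
  from rigid_head_exists[OF Beta.prems(1,2)] obtain h Ws where
    h: "in_ctx \<A> (apps h Ws)" "\<not> is_app h" "\<forall>y. h \<noteq> Free y"
      "unfold_ctx \<A> (apps h Ws) = unfold_ctx \<A> M" "\<And>C b. C, \<A> \<Turnstile> apps h Ws \<Down> b \<Longrightarrow> C, \<A> \<Turnstile> M \<Down> b" by blast
  have hterm: "is_term h" using h(1) by (simp add: in_ctx_def lc_apps)
  have "apps (unfold_ctx \<A> h) (map (unfold_ctx \<A>) Ws) = apps (Lam P) (N # Vs)"
    using h(4) Beta.prems by (simp add: unfold_ctx_apps)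
  then have *: "unfold_ctx \<A> h = Lam P" "map (unfold_ctx \<A>) Ws = N # Vs"
    using apps_eq_iff[OF unfold_ctx_is_app[OF h(2,3)], of "Lam P" \<A> _ "N # Vs"] by simp_all
  then obtain P' where P': "h = Lam P'" "unfold_ctx \<A> P' = P"
    using hterm h(2,3) by (cases h) auto
  from * obtain N' Vs' where W: "Ws = N' # Vs'" "unfold_ctx \<A> N' = N" "map (unfold_ctx \<A>) Vs' = Vs"
    by (cases Ws) auto
  obtain x where x: "x \<notin> fv_bctx C \<union> fv_mctx \<A> \<union> fv (apps (Lam P' \<cdot> N') Vs')"
  proof -
    have "finite (fv_bctx C)" by (induction C) auto
    moreover have "finite (fv_mctx \<A>)" by (auto simp: fv_mctx_def)
    ultimately show ?thesis using ex_new_if_finite[of "fv_bctx C \<union> fv_mctx \<A> \<union> fv (apps (Lam P' \<cdot> N') Vs')"] that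
      by (auto simp: infinite_UNIV_nat)
  qed
  have fr: "x \<notin> fst ` set \<A>" "x \<notin> fv P'" "\<forall>V\<in>set Vs'. x \<notin> fv V"
    using x by (force simp: fv_mctx_def fv_apps)+
  have wf: "is_term N'" "fv N' \<subseteq> fst ` set \<A>" "lc 1 P'" "fv P' \<subseteq> fst ` set \<A>" "\<forall>V\<in>set Vs'. in_ctx \<A> V"
    using h(1) P' W by (auto simp: lc_apps fv_apps in_ctx_def simp del: foldl_Cons)
  have vs: "map (subst x N') Vs' = Vs'"
    using fr by (intro map_idI) (auto simp: subst_fresh)
  have "C, \<A> @ [(x, N')] \<Turnstile> apps (open_trm 0 (Free x) P') Vs' \<Down> b"
  proof (rule Beta.IH)
    show "ordered_ctx (\<A> @ [(x, N')])" using Beta.prems fr wf by (simp add: ordered_ctx_snoc)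
    show "in_ctx (\<A> @ [(x, N')]) (apps (open_trm 0 (Free x) P') Vs')"
      using wf fv_open[of 0 "Free x" P'] by (auto simp: in_ctx_def lc_apps fv_apps lc_open)
    show "unfold_ctx (\<A> @ [(x, N')]) (apps (open_trm 0 (Free x) P') Vs') = apps (open_trm 0 N P) Vs"
      unfolding unfold_ctx_snoc subst_apps vs subst_open_fresh[OF fr(2) wf(1)]
      using W P' Beta.prems by (simp add: unfold_ctx_apps unfold_ctx_open)
  qed
  then have "C, \<A> \<Turnstile> apps (Lam P' \<cdot> N') Vs' \<Down> b" using x by (rule eval.Beta)
  then show ?case using h(5) P' W by simp
next
  case (Cond P i N1 N0 Vs b)
  from rigid_head_exists[OF Cond.prems(1,2)] obtain h Ws where
    h: "in_ctx \<A> (apps h Ws)" "\<not> is_app h" "\<forall>y. h \<noteq> Free y"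
      "unfold_ctx \<A> (apps h Ws) = unfold_ctx \<A> M" "\<And>C b. C, \<A> \<Turnstile> apps h Ws \<Down> b \<Longrightarrow> C, \<A> \<Turnstile> M \<Down> b" by blast
  have hterm: "is_term h" using h(1) by (simp add: in_ctx_def lc_apps)
  have "apps (unfold_ctx \<A> h) (map (unfold_ctx \<A>) Ws) = apps (Cond P N0 N1) Vs"
    using h(4) Cond.prems by (simp add: unfold_ctx_apps)
  then have *: "unfold_ctx \<A> h = Cond P N0 N1" "map (unfold_ctx \<A>) Ws = Vs"
    using apps_eq_iff[OF unfold_ctx_is_app[OF h(2,3)], of "Cond P N0 N1"] by auto
  then obtain P' N0' N1' where P': "h = trm.Cond P' N0' N1'" "unfold_ctx \<A> P' = P"
    "unfold_ctx \<A> N0' = N0" "unfold_ctx \<A> N1' = N1"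
    using hterm h(2,3) by (cases h) auto
  have wf: "in_ctx \<A> P'" "in_ctx \<A> N0'" "in_ctx \<A> N1'" "\<forall>V\<in>set Ws. in_ctx \<A> V"
    using h(1) P' by (auto simp: in_ctx_apps) (auto simp: in_ctx_def)
  have "C, \<A> \<Turnstile> apps (trm.Cond P' N0' N1') Ws \<Down> b"
  proof (rule eval.Cond)
    show "fill_bctx C (CIf Hole N0' N1' Ws), \<A> \<Turnstile> P' \<Down> i"
      using Cond.IH(1) Cond.prems wf P' by blast
    show "C, \<A> \<Turnstile> apps (if i then N1' else N0') Ws \<Down> b"
      using Cond.IH(2) Cond.prems wf P' * by (auto simp: in_ctx_apps unfold_ctx_apps)
  qed
  then show ?case using h(5) P' by simp
qed

theorem evaluates_iff_ev:
  assumes "closed_term M"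
  shows "(\<Turnstile> M \<Down> b) \<longleftrightarrow> ev M b"
proof -
  have "unfold_ctx [] M = M" by (simp add: unfold_ctx_def)
  then show ?thesis
    using eval_imp_ev[OF _ ordered_ctx_Nil, of Hole M b] ev_imp_eval[OF _ ordered_ctx_Nil, of M b M Hole] assms
    by (auto simp: closed_term_def in_ctx_def)
qed

section \<open>Admissible rules of the type system\<close>

lemma lc_ty_mono:
  "lc_lty k A \<Longrightarrow> k \<le> i \<Longrightarrow> lc_lty i A" "lc_ty k \<sigma> \<Longrightarrow> k \<le> i \<Longrightarrow> lc_ty i \<sigma>"
  by (induction A and \<sigma> arbitrary: k i and k i) auto

lemma open_lty_lc:
  "lc_lty k A \<Longrightarrow> k \<le> i \<Longrightarrow> open_lty i C A = A" "lc_ty k \<sigma> \<Longrightarrow> k \<le> i \<Longrightarrow> open_ty i C \<sigma> = \<sigma>"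
  by (induction A and \<sigma> arbitrary: k i and k i) auto

lemma close_lty_fresh:
  "\<alpha> \<notin> ftv_lty A \<Longrightarrow> close_lty k \<alpha> A = A" "\<alpha> \<notin> ftv_ty \<sigma> \<Longrightarrow> close_ty k \<alpha> \<sigma> = \<sigma>"
  by (induction A and \<sigma> arbitrary: k and k) auto

definition wf_ctx :: "ctx \<Rightarrow> bool" where
  "wf_ctx \<Gamma> \<longleftrightarrow> finite (dom \<Gamma>) \<and> (\<forall>x \<sigma>. \<Gamma> x = Some \<sigma> \<longrightarrow> lc_ty 0 \<sigma>)"

lemma wf_ctx_mono:
  assumes "wf_ctx \<Delta>" "\<Gamma> \<subseteq>\<^sub>m \<Delta>"
  shows "wf_ctx \<Gamma>"
proof -
  have "lc_ty 0 \<sigma>" if "\<Gamma> x = Some \<sigma>" for x \<sigma>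
  proof -
    have "\<Delta> x = Some \<sigma>" using assms(2) that by (metis domI map_le_def)
    with assms(1) show ?thesis by (simp add: wf_ctx_def)
  qed
  moreover have "finite (dom \<Gamma>)"
    using finite_subset[OF map_le_implies_dom_le[OF assms(2)]] assms(1) by (simp add: wf_ctx_def)
  ultimately show ?thesis by (simp add: wf_ctx_def)
qed

lemma wf_ctxD: "wf_ctx \<Gamma> \<Longrightarrow> \<Gamma> x = Some \<sigma> \<Longrightarrow> lc_ty 0 \<sigma>"
  by (simp add: wf_ctx_def)

lemma wf_ctx_upd: "wf_ctx \<Gamma> \<Longrightarrow> lc_ty 0 \<sigma> \<Longrightarrow> wf_ctx (\<Gamma>(x \<mapsto> \<sigma>))"
  by (simp add: wf_ctx_def)

lemma wf_ctx_bang: "wf_ctx \<Gamma> \<Longrightarrow> wf_ctx (bang_ctx \<Gamma>)"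
proof -
  have "dom (bang_ctx \<Gamma>) = dom \<Gamma>" by (auto simp: bang_ctx_def)
  then show "wf_ctx \<Gamma> \<Longrightarrow> wf_ctx (bang_ctx \<Gamma>)" by (fastforce simp: wf_ctx_def bang_ctx_def simp del: dom_map_option_comp dom_map_option)
qed

lemma wf_ctx_add: "wf_ctx \<Gamma> \<Longrightarrow> wf_ctx \<Delta> \<Longrightarrow> wf_ctx (\<Gamma> ++ \<Delta>)"
  unfolding wf_ctx_def by (auto simp: map_add_Some_iff)

text \<open>In the contraction case \<sigma> is well formed because X is nonempty: some variable of
  X has this type in the premise.\<close>

lemma typing_wf_ctx: "\<Gamma> \<turnstile> M \<Ztypecolon> \<tau> \<Longrightarrow> wf_ctx \<Gamma>"
proof (induction rule: typing.induct)
  case (Ax A x)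
  then show ?case by (intro wf_ctx_upd) (auto simp: wf_ctx_def)
next
  case (BI b)
  show ?case by (simp add: wf_ctx_def)
next
  case (W \<Gamma> M \<sigma> x A)
  then show ?case by (intro wf_ctx_upd) auto
next
  case (LolliI \<Gamma> x \<sigma> M A)
  show ?case using LolliI.hyps by (intro wf_ctx_mono[OF LolliI.IH]) (auto simp: map_le_def)
next
  case (LolliE \<Gamma> M \<sigma> A \<Delta> N)
  then show ?case by (intro wf_ctx_add)
next
  case (M \<Gamma> X \<sigma> M \<tau> x)
  from M.hyps obtain y where "y \<in> X" by auto
  then have "(\<Gamma> ++ const_ctx X \<sigma>) y = Some \<sigma>" by (simp add: map_add_def const_ctx_def)
  then have "lc_ty 0 \<sigma>" by (rule wf_ctxD[OF M.IH])
  moreover have "\<Gamma> \<subseteq>\<^sub>m \<Gamma> ++ const_ctx X \<sigma>"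
    using M.hyps by (auto simp: map_le_def map_add_def const_ctx_def)
  ultimately show ?case by (intro wf_ctx_upd wf_ctx_mono[OF M.IH]) auto
next
  case (Sp \<Gamma> M \<sigma>)
  then show ?case by (intro wf_ctx_bang)
qed

section \<open>Renaming of free variables\<close>

primrec ren :: "(name \<Rightarrow> name) \<Rightarrow> trm \<Rightarrow> trm" where
  "ren \<pi> (Free y) = Free (\<pi> y)"
| "ren \<pi> (Bound i) = Bound i"
| "ren \<pi> (Const b) = Const b"
| "ren \<pi> (Lam M) = Lam (ren \<pi> M)"
| "ren \<pi> (M \<cdot> N) = ren \<pi> M \<cdot> ren \<pi> N"
| "ren \<pi> (Cond M N P) = Cond (ren \<pi> M) (ren \<pi> N) (ren \<pi> P)"

lemma ren_close: "inj \<pi> \<Longrightarrow> ren \<pi> (close_trm k x M) = close_trm k (\<pi> x) (ren \<pi> M)"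
  by (induction M arbitrary: k) (auto simp: inj_eq)

lemma ren_merge: "inj \<pi> \<Longrightarrow> ren \<pi> (merge X x M) = merge (\<pi> ` X) (\<pi> x) (ren \<pi> M)"
  by (induction M) (auto simp: inj_image_mem_iff)

lemma ren_ren: "ren f (ren g M) = ren (\<lambda>x. f (g x)) M"
  by (induction M) auto

lemma ren_ident: "(\<And>x. x \<in> fv M \<Longrightarrow> f x = x) \<Longrightarrow> ren f M = M"
  by (induction M) auto

lemma merge_eq_ren: "merge X x M = ren (\<lambda>y. if y \<in> X then x else y) M"
  by (induction M) auto

text \<open>Binding and merging of names commute only with injective renamings; for a bijection the
  renamed context is \<Gamma> composed with the inverse.\<close>

lemma typing_ren: "\<Gamma> \<turnstile> M \<Ztypecolon> \<tau> \<Longrightarrow> bij \<pi> \<Longrightarrow> \<Gamma> \<circ> inv \<pi> \<turnstile> ren \<pi> M \<Ztypecolon> \<tau>"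
proof (induction rule: typing.induct)
  have upd: "\<Gamma>(x \<mapsto> \<sigma>) \<circ> inv \<pi> = (\<Gamma> \<circ> inv \<pi>)(\<pi> x \<mapsto> \<sigma>)" if "bij \<pi>" for \<Gamma> :: ctx and x \<sigma>
    using that by (auto simp: fun_eq_iff bij_is_inj bij_is_surj inv_f_f surj_f_inv_f)
  have add: "(\<Gamma> ++ \<Delta>) \<circ> inv \<pi> = (\<Gamma> \<circ> inv \<pi>) ++ (\<Delta> \<circ> inv \<pi>)" for \<Gamma> \<Delta> :: ctx
    by (simp add: map_add_def comp_def)
  have dom: "dom (\<Gamma> \<circ> inv \<pi>) = \<pi> ` dom \<Gamma>" if "bij \<pi>" for \<Gamma> :: ctx
    using bij_vimage_eq_inv_image[OF bij_imp_bij_inv[OF that], of "dom \<Gamma>"] that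
    by (auto simp: dom_def inv_inv_eq)
  have const: "const_ctx X \<sigma> \<circ> inv \<pi> = const_ctx (\<pi> ` X) \<sigma>" if "bij \<pi>" for X \<sigma>
    using that by (auto simp: const_ctx_def fun_eq_iff bij_is_inj inv_f_f)
      (metis bij_inv_eq_iff image_eqI)
  {
    case (Ax A x)
    have "[x \<mapsto> Lin A] \<circ> inv \<pi> = [\<pi> x \<mapsto> Lin A]" using upd[OF Ax.prems, of Map.empty] by (simp add: comp_def)
    with typing.Ax[OF Ax.hyps] show ?case by (simp only: ren.simps)
  next
    case (BI b)
    then show ?case using typing.BI by (simp add: comp_def)
  next
    case (W \<Gamma> M \<sigma> x A)
    have "\<pi> x \<notin> dom (\<Gamma> \<circ> inv \<pi>)"
      using W by (simp only: dom bij_is_inj inj_image_mem_iff not_False_eq_True)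
    from typing.W[OF W.IH[OF W.prems] this W.hyps(3)] show ?case unfolding upd[OF W.prems] .
  next
    case (LolliI \<Gamma> x \<sigma> M A)
    have "\<pi> x \<notin> dom (\<Gamma> \<circ> inv \<pi>)"
      using LolliI by (simp only: dom bij_is_inj inj_image_mem_iff not_False_eq_True)
    from typing.LolliI[OF LolliI.IH[OF LolliI.prems, unfolded upd[OF LolliI.prems]] this]
    show ?case by (simp only: lam_def ren_close[OF bij_is_inj[OF LolliI.prems]] ren.simps)
  next
    case (LolliE \<Gamma> M \<sigma> A \<Delta> N)
    have "dom (\<Gamma> \<circ> inv \<pi>) \<inter> dom (\<Delta> \<circ> inv \<pi>) = {}"
      using LolliE by (simp only: dom image_Int[symmetric] bij_is_inj image_empty)
    from typing.LolliE[OF LolliE.IH(1)[OF LolliE.prems] LolliE.IH(2)[OF LolliE.prems] this]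
    show ?case unfolding add ren.simps .
  next
    case (M \<Gamma> X \<sigma> M \<tau> x)
    have "finite (\<pi> ` X)" "\<pi> ` X \<noteq> {}" using M.hyps by auto
    moreover have "dom (\<Gamma> \<circ> inv \<pi>) \<inter> \<pi> ` X = {}"
      using M by (simp only: dom image_Int[symmetric] bij_is_inj image_empty)
    moreover have "\<pi> x \<notin> dom (\<Gamma> \<circ> inv \<pi>)"
      using M by (simp only: dom bij_is_inj inj_image_mem_iff not_False_eq_True)
    ultimately show ?case unfolding upd[OF M.prems] ren_merge[OF bij_is_inj[OF M.prems]]
      by (rule typing.M[OF M.IH[OF M.prems, unfolded add const[OF M.prems]]])
  next
    case (Sp \<Gamma> M \<sigma>)
    have "bang_ctx \<Gamma> \<circ> inv \<pi> = bang_ctx (\<Gamma> \<circ> inv \<pi>)" by (auto simp: bang_ctx_def)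
    with typing.Sp[OF Sp.IH[OF Sp.prems]] show ?case by (simp only:)
  next
    case (AllI \<Gamma> M A \<alpha>)
    have "ftv_ctx (\<Gamma> \<circ> inv \<pi>) \<subseteq> ftv_ctx \<Gamma>" by (auto simp: ftv_ctx_def ran_def)
    then have "\<alpha> \<notin> ftv_ctx (\<Gamma> \<circ> inv \<pi>)" using AllI.hyps by auto
    from typing.AllI[OF AllI.IH[OF AllI.prems] this] show ?case .
  next
    case (AllE \<Gamma> M B A)
    from typing.AllE[OF AllE.IH[OF AllE.prems] AllE.hyps(2)] show ?case .
  next
    case (BE \<Gamma> M N0 A N1)
    from typing.BE[OF BE.IH(1)[OF BE.prems] BE.IH(2)[OF BE.prems] BE.IH(3)[OF BE.prems]]
    show ?case unfolding ren.simps .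
  }
qed

section \<open>Contraction, weakening and shared contexts\<close>

text \<open>Rule \<open>M\<close> for {x, y} with x itself as the merged name. The case x = y puts a
  bang on a single assumption.\<close>

lemma typing_contract:
  assumes "\<Theta> \<turnstile> M \<Ztypecolon> \<tau>" "\<Theta> x = Some \<sigma>" "\<Theta> y = Some \<sigma>"
  shows "(\<Theta>(y := None))(x \<mapsto> Bang \<sigma>) \<turnstile> ren (\<lambda>z. if z = y then x else z) M \<Ztypecolon> \<tau>"
proof -
  have "\<Theta>(x := None, y := None) ++ const_ctx {x, y} \<sigma> = \<Theta>"
    using assms by (auto simp: map_add_def const_ctx_def fun_eq_iff)
  then have "(\<Theta>(x := None, y := None))(x \<mapsto> Bang \<sigma>) \<turnstile> merge {x, y} x M \<Ztypecolon> \<tau>"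
    using assms by (intro typing.M) auto
  moreover have "(\<Theta>(x := None, y := None))(x \<mapsto> Bang \<sigma>) = (\<Theta>(y := None))(x \<mapsto> Bang \<sigma>)" by auto
  moreover have "(\<lambda>z. if z \<in> {x, y} then x else z) = (\<lambda>z. if z = y then x else z)" by auto
  ultimately show ?thesis by (simp add: merge_eq_ren)
qed

definition bang_on :: "name set \<Rightarrow> ctx \<Rightarrow> ctx" where
  "bang_on X \<Gamma> = (\<lambda>x. if x \<in> X then map_option Bang (\<Gamma> x) else \<Gamma> x)"

text \<open>Contraction of one variable is dereliction: it turns x : \<sigma> into x : !\<sigma>.
  This is done for the variables of X one after the other.\<close>

lemma typing_bang_on:
  assumes "\<Gamma> \<turnstile> M \<Ztypecolon> \<tau>"
  shows "bang_on X \<Gamma> \<turnstile> M \<Ztypecolon> \<tau>"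
proof -
  have fin: "finite (X \<inter> dom \<Gamma>)" using typing_wf_ctx[OF assms] by (simp add: wf_ctx_def)
  have "finite Y \<Longrightarrow> Y \<subseteq> dom \<Gamma> \<Longrightarrow> bang_on Y \<Gamma> \<turnstile> M \<Ztypecolon> \<tau>" for Y
  proof (induction Y rule: finite_induct)
    case empty
    then show ?case using assms by (simp add: bang_on_def)
  next
    case (insert y Y)
    then obtain \<sigma> where \<sigma>: "\<Gamma> y = Some \<sigma>" by auto
    with insert have y: "bang_on Y \<Gamma> y = Some \<sigma>" by (simp add: bang_on_def)
    have M: "(bang_on Y \<Gamma>)(y \<mapsto> Bang \<sigma>) \<turnstile> ren (\<lambda>z. if z = y then y else z) M \<Ztypecolon> \<tau>"
      using typing_contract[OF insert.IH y y] insert.prems by simp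
    have "bang_on (insert y Y) \<Gamma> = (bang_on Y \<Gamma>)(y \<mapsto> Bang \<sigma>)"
      using \<sigma> by (auto simp: bang_on_def)
    moreover have "ren (\<lambda>z. if z = y then y else z) M = M" by (simp add: ren_ident)
    ultimately show ?case using M by metis
  qed
  from this[of "X \<inter> dom \<Gamma>"] fin have "bang_on (X \<inter> dom \<Gamma>) \<Gamma> \<turnstile> M \<Ztypecolon> \<tau>" by simp
  moreover have "bang_on (X \<inter> dom \<Gamma>) \<Gamma> = bang_on X \<Gamma>"
    by (auto simp: bang_on_def fun_eq_iff)
  ultimately show ?thesis by simp
qed

text \<open>Rule \<open>W\<close> introduces linear types only; an assumption !\<sigma> arises by
  adding \<sigma> and putting a bang on it.\<close>

lemma typing_weaken1:
  "\<Gamma> \<turnstile> M \<Ztypecolon> \<tau> \<Longrightarrow> x \<notin> dom \<Gamma> \<Longrightarrow> lc_ty 0 \<sigma> \<Longrightarrow> \<Gamma>(x \<mapsto> \<sigma>) \<turnstile> M \<Ztypecolon> \<tau>"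
proof (induction \<sigma> rule: ty.induct[where ?P1.0 = "\<lambda>_. True"])
  case (Lin A)
  then show ?case by (intro typing.W) auto
next
  case (Bang \<sigma>)
  then have "\<Gamma>(x \<mapsto> \<sigma>) \<turnstile> M \<Ztypecolon> \<tau>" by (simp del: fun_upd_apply)
  then have "bang_on {x} (\<Gamma>(x \<mapsto> \<sigma>)) \<turnstile> M \<Ztypecolon> \<tau>" by (rule typing_bang_on)
  moreover have "bang_on {x} (\<Gamma>(x \<mapsto> \<sigma>)) = \<Gamma>(x \<mapsto> Bang \<sigma>)" by (auto simp: bang_on_def)
  ultimately show ?case by (simp del: fun_upd_apply)
qed auto

lemma typing_weaken:
  assumes "\<Gamma> \<turnstile> M \<Ztypecolon> \<tau>" "\<Gamma> \<subseteq>\<^sub>m \<Delta>" "wf_ctx \<Delta>"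
  shows "\<Delta> \<turnstile> M \<Ztypecolon> \<tau>"
proof -
  have "finite X \<Longrightarrow> X \<inter> dom \<Gamma> = {} \<Longrightarrow> X \<subseteq> dom \<Delta> \<Longrightarrow> \<Gamma> ++ (\<Delta> |` X) \<turnstile> M \<Ztypecolon> \<tau>" for X
  proof (induction X rule: finite_induct)
    case empty
    then show ?case using assms(1) by (simp add: restrict_map_def map_add_def)
  next
    case (insert x X)
    then obtain \<sigma> where \<sigma>: "\<Delta> x = Some \<sigma>" by auto
    have "(\<Gamma> ++ (\<Delta> |` X))(x \<mapsto> \<sigma>) \<turnstile> M \<Ztypecolon> \<tau>"
      using insert \<sigma> assms(3) by (intro typing_weaken1) (auto simp: wf_ctx_def)
    moreover have "(\<Gamma> ++ (\<Delta> |` X))(x \<mapsto> \<sigma>) = \<Gamma> ++ (\<Delta> |` insert x X)"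
      using \<sigma> by (auto simp: map_add_def restrict_map_def fun_eq_iff)
    ultimately show ?case by simp
  qed
  from this[of "dom \<Delta> - dom \<Gamma>"] assms have "\<Gamma> ++ (\<Delta> |` (dom \<Delta> - dom \<Gamma>)) \<turnstile> M \<Ztypecolon> \<tau>"
    by (auto simp: wf_ctx_def)
  moreover have "\<Gamma> ++ (\<Delta> |` (dom \<Delta> - dom \<Gamma>)) = \<Delta>"
  proof
    fix x
    show "(\<Gamma> ++ (\<Delta> |` (dom \<Delta> - dom \<Gamma>))) x = \<Delta> x"
      using assms(2) by (cases "\<Gamma> x"; cases "\<Delta> x")
        (auto simp: map_add_def restrict_map_def map_le_def dom_def split: option.splits)
  qed
  ultimately show ?thesis by simp
qed

(* Application with a shared part of the context: rename the shared variables of the argument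
   apart by a shift and contract each pair. *)
lemma typing_app_shared:
  assumes M: "\<Gamma> \<turnstile> M \<Ztypecolon> Lin (\<sigma> \<multimap> A)" and N: "\<Delta> \<turnstile> N \<Ztypecolon> \<sigma>"
    and agree: "\<And>x. x \<in> dom \<Gamma> \<inter> dom \<Delta> \<Longrightarrow> \<Gamma> x = \<Delta> x"
  shows "bang_on (dom \<Gamma> \<inter> dom \<Delta>) (\<Gamma> ++ \<Delta>) \<turnstile> M \<cdot> N \<Ztypecolon> Lin A"
proof -
  define Z where "Z = dom \<Gamma> \<inter> dom \<Delta>"
  have fin: "finite (dom \<Gamma> \<union> dom \<Delta> \<union> fv M \<union> fv N)"
    using typing_wf_ctx[OF M] typing_wf_ctx[OF N] by (simp add: wf_ctx_def)
  then obtain K where K0: "\<forall>x\<in>dom \<Gamma> \<union> dom \<Delta> \<union> fv M \<union> fv N. x < K"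
    unfolding finite_nat_set_iff_bounded ..
  have K: "x < K" if "x \<in> dom \<Gamma> \<union> dom \<Delta> \<union> fv M \<union> fv N" for x
    using K0 that by (rule bspec)
  have ZK: "x < K" if "x \<in> Z" for x using K that by (auto simp: Z_def)
  have finZ: "finite Z" using fin by (auto simp: Z_def)
  \<comment> \<open>An involution that exchanges each shared variable with its shift by K, which
    lies beyond all names in use.\<close>
  define \<pi> where "\<pi> = (\<lambda>x. if x \<in> Z then x + K else if K \<le> x \<and> x - K \<in> Z then x - K else x)"
  have \<pi>\<pi>: "\<pi> (\<pi> x) = x" for x using ZK by (force simp: \<pi>_def)
  then have bij: "bij \<pi>" by (metis bij_betw_def inj_def surj_def)
  have inv: "inv \<pi> = \<pi>" using \<pi>\<pi> by (metis bij bij_inv_eq_iff ext)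
  define \<Delta>' where "\<Delta>' = \<Delta> \<circ> \<pi>"
  have N': "\<Delta>' \<turnstile> ren \<pi> N \<Ztypecolon> \<sigma>" using typing_ren[OF N bij] by (simp add: inv \<Delta>'_def)
  have disj: "dom \<Gamma> \<inter> dom \<Delta>' = {}"
  proof (rule ccontr)
    assume "dom \<Gamma> \<inter> dom \<Delta>' \<noteq> {}"
    then obtain x where x: "x \<in> dom \<Gamma>" "\<pi> x \<in> dom \<Delta>" by (auto simp: \<Delta>'_def dom_def)
    then have "x < K" "\<pi> x < K" using K by auto
    then have "x \<notin> Z" "\<pi> x = x" by (auto simp: \<pi>_def split: if_splits)
    with x show False by (simp add: Z_def)
  qed
  define \<Theta> where "\<Theta> = \<Gamma> ++ \<Delta>'"
  have app: "\<Theta> \<turnstile> M \<cdot> ren \<pi> N \<Ztypecolon> Lin A"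
    unfolding \<Theta>_def using typing.LolliE[OF M N' disj] .
  \<comment> \<open>\<open>\<rho> P\<close> and \<open>\<Xi> P\<close> are the renaming and the
    context reached once the pairs belonging to the variables of P have been contracted.\<close>
  define \<rho> where "\<rho> = (\<lambda>P x. if K \<le> x \<and> x - K \<in> P then x - K else x)"
  define \<Xi> where "\<Xi> = (\<lambda>P x. if K \<le> x \<and> x - K \<in> P then None else bang_on P \<Theta> x)"
  have "finite P \<Longrightarrow> P \<subseteq> Z \<Longrightarrow> \<Xi> P \<turnstile> ren (\<rho> P) (M \<cdot> ren \<pi> N) \<Ztypecolon> Lin A" for P
  proof (induction P rule: finite_induct)
    case empty
    then show ?case using app by (simp add: \<Xi>_def \<rho>_def bang_on_def ren_ident)
  next
    case (insert x P)
    then have x: "x \<in> Z" "x < K" "x \<notin> P" "P \<subseteq> Z" using ZK by auto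
    have "\<not> (x + K < K)" by simp
    then have nK: "x + K \<notin> P" "x + K \<notin> dom \<Gamma>" "x + K \<notin> Z" using x ZK K by (blast, blast, blast)
    from x obtain \<sigma>' where \<sigma>': "\<Gamma> x = Some \<sigma>'" "\<Delta> x = Some \<sigma>'" using agree by (auto simp: Z_def)
    have "x \<notin> dom \<Delta>'" using disj \<sigma>' by auto
    then have "\<Theta> x = Some \<sigma>'" using \<sigma>' by (simp add: \<Theta>_def map_add_dom_app_simps)
    then have 1: "\<Xi> P x = Some \<sigma>'" using x by (simp add: \<Xi>_def bang_on_def)
    have "\<Delta>' (x + K) = Some \<sigma>'" using x nK \<sigma>' by (simp add: \<Delta>'_def \<pi>_def)
    then have "\<Theta> (x + K) = Some \<sigma>'" by (simp add: \<Theta>_def)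
    then have 2: "\<Xi> P (x + K) = Some \<sigma>'" using x nK by (simp add: \<Xi>_def bang_on_def)
    have "(\<Xi> P)(x + K := None, x \<mapsto> Bang \<sigma>') \<turnstile>
      ren (\<lambda>z. if z = x + K then x else z) (ren (\<rho> P) (M \<cdot> ren \<pi> N)) \<Ztypecolon> Lin A"
      by (rule typing_contract[OF insert.IH[OF x(4)] 1 2])
    moreover have "(\<Xi> P)(x + K := None, x \<mapsto> Bang \<sigma>') = \<Xi> (insert x P)"
      using x nK 1 by (auto simp: \<Xi>_def bang_on_def fun_eq_iff)
    moreover have "(\<lambda>z. if \<rho> P z = x + K then x else \<rho> P z) = \<rho> (insert x P)"
    proof
      fix z
      have "z - K \<noteq> x + K" if "z - K \<in> P" using that nK by auto
      then show "(if \<rho> P z = x + K then x else \<rho> P z) = \<rho> (insert x P) z"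
        by (auto simp: \<rho>_def)
    qed
    ultimately show ?case by (simp only: ren_ren)
  qed
  from this[OF finZ order_refl] have "\<Xi> Z \<turnstile> ren (\<rho> Z) M \<cdot> ren (\<rho> Z) (ren \<pi> N) \<Ztypecolon> Lin A" by simp
  moreover have "ren (\<rho> Z) M = M"
    using K by (intro ren_ident) (force simp: \<rho>_def)
  moreover have "ren (\<rho> Z) (ren \<pi> N) = N"
    unfolding ren_ren
  proof (rule ren_ident)
    fix x assume "x \<in> fv N"
    then have "x < K" using K by simp
    then show "\<rho> Z (\<pi> x) = x" by (auto simp: \<rho>_def \<pi>_def)
  qed
  moreover have "\<Xi> Z = bang_on Z (\<Gamma> ++ \<Delta>)"
  proof
    fix x
    consider "K \<le> x" "x - K \<in> Z" | "x < K" | "K \<le> x" "x - K \<notin> Z" by linarith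
    then show "\<Xi> Z x = bang_on Z (\<Gamma> ++ \<Delta>) x"
    proof cases
      case 1
      then have "x \<notin> dom \<Gamma>" "x \<notin> dom \<Delta>" "x \<notin> Z" using K[of x] ZK[of x] by auto
      then have "bang_on Z (\<Gamma> ++ \<Delta>) x = None" by (auto simp: bang_on_def map_add_def split: option.splits)
      with 1 show ?thesis by (simp add: \<Xi>_def)
    next
      case 2
      have "\<Theta> x = (\<Gamma> ++ \<Delta>) x"
      proof (cases "x \<in> Z")
        case True
        then have "\<Gamma> x = \<Delta> x" "x \<notin> dom \<Delta>'" using agree disj by (auto simp: Z_def)
        with True show ?thesis by (auto simp: \<Theta>_def map_add_def Z_def split: option.splits)
      next
        case False
        with 2 have "\<pi> x = x" by (simp add: \<pi>_def)
        then show ?thesis by (simp add: \<Theta>_def \<Delta>'_def map_add_def)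
      qed
      with 2 show ?thesis by (simp add: \<Xi>_def bang_on_def)
    next
      case 3
      then have "x \<notin> dom \<Gamma>" "x \<notin> dom \<Delta>" "x \<notin> Z" using K[of x] ZK[of x] by auto
      moreover have "\<pi> x = x" using 3 calculation by (simp add: \<pi>_def)
      ultimately show ?thesis using 3 by (simp add: \<Xi>_def bang_on_def \<Theta>_def \<Delta>'_def map_add_def)
    qed
  qed
  ultimately show ?thesis by (simp add: Z_def)
qed

section \<open>Typing with duplicable assumptions\<close>

definition bangs :: "nat \<Rightarrow> ctx \<Rightarrow> ctx" where
  "bangs r \<Psi> = map_option (Bang ^^ r) \<circ> \<Psi>"

(* The assumptions of \<Psi> may be used arbitrarily often; each use of contraction or promotion
   costs one more bang on all of them, and the number r of bangs is not tracked. *)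
definition typed :: "ctx \<Rightarrow> ctx \<Rightarrow> trm \<Rightarrow> ty \<Rightarrow> bool" ("_; _ \<tturnstile> _ \<Ztypecolon> _" [51, 51, 51, 51] 50) where
  "\<Psi>; \<Gamma> \<tturnstile> M \<Ztypecolon> \<tau> \<longleftrightarrow> (\<exists>r. (bangs r \<Psi> ++ \<Gamma>) |` fv M \<turnstile> M \<Ztypecolon> \<tau>)"

text \<open>Dereliction of all duplicable assumptions at once. Premises with different numbers of
  bangs can therefore be brought to a common number.\<close>

lemma typed_rank:
  assumes "(bangs r \<Psi> ++ \<Gamma>) |` fv M \<turnstile> M \<Ztypecolon> \<tau>" "r \<le> r'"
  shows "(bangs r' \<Psi> ++ \<Gamma>) |` fv M \<turnstile> M \<Ztypecolon> \<tau>"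
  using assms(2)
proof (induction rule: dec_induct)
  case base
  show ?case by (rule assms(1))
next
  case (step r)
  have "bang_on (dom \<Psi> - dom \<Gamma>) ((bangs r \<Psi> ++ \<Gamma>) |` fv M) = (bangs (Suc r) \<Psi> ++ \<Gamma>) |` fv M"
  proof
    fix x
    show "bang_on (dom \<Psi> - dom \<Gamma>) ((bangs r \<Psi> ++ \<Gamma>) |` fv M) x = ((bangs (Suc r) \<Psi> ++ \<Gamma>) |` fv M) x"
      by (cases "\<Psi> x"; cases "\<Gamma> x") (auto simp: bang_on_def restrict_map_def map_add_def bangs_def dom_def)
  qed
  then show ?case using typing_bang_on[OF step.IH, of "dom \<Psi> - dom \<Gamma>"] by simp
qed

lemma typed_var:
  "(\<Psi> ++ \<Gamma>) x = Some (Lin A) \<Longrightarrow> wf_lty A \<Longrightarrow> \<Psi>; \<Gamma> \<tturnstile> Free x \<Ztypecolon> Lin A"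
proof -
  assume *: "(\<Psi> ++ \<Gamma>) x = Some (Lin A)" "wf_lty A"
  have "(bangs 0 \<Psi> ++ \<Gamma>) |` fv (Free x) = [x \<mapsto> Lin A]"
    using * by (auto simp: bangs_def restrict_map_def fun_eq_iff map_add_def option.map_id0)
  with typing.Ax[OF *(2), of x] have "(bangs 0 \<Psi> ++ \<Gamma>) |` fv (Free x) \<turnstile> Free x \<Ztypecolon> Lin A"
    by (simp only:)
  then show ?thesis unfolding typed_def ..
qed

lemma typed_const: "\<Psi>; \<Gamma> \<tturnstile> Const b \<Ztypecolon> Lin TBool"
  by (auto simp: typed_def restrict_map_def typing.BI)

lemma fv_lam [simp]: "fv (lam x M) = fv M - {x}"
  by (simp add: lam_def)

lemma typed_lam:
  assumes "lc_ty 0 \<sigma>" "\<Psi>; \<Gamma>(x \<mapsto> \<sigma>) \<tturnstile> M \<Ztypecolon> Lin A"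
  shows "\<Psi>; \<Gamma> \<tturnstile> lam x M \<Ztypecolon> Lin (\<sigma> \<multimap> A)"
proof -
  from assms(2) obtain r where r: "(bangs r \<Psi> ++ \<Gamma>(x \<mapsto> \<sigma>)) |` fv M \<turnstile> M \<Ztypecolon> Lin A"
    by (auto simp: typed_def)
  let ?\<Delta> = "(bangs r \<Psi> ++ \<Gamma>) |` (fv M - {x})"
  have "?\<Delta>(x \<mapsto> \<sigma>) \<turnstile> M \<Ztypecolon> Lin A"
  proof (rule typing_weaken[OF r])
    show "(bangs r \<Psi> ++ \<Gamma>(x \<mapsto> \<sigma>)) |` fv M \<subseteq>\<^sub>m ?\<Delta>(x \<mapsto> \<sigma>)"
      by (auto simp: map_le_def restrict_map_def)
    have "finite (fv M)" by simp
    have "lc_ty 0 \<tau>" if "(?\<Delta>(x \<mapsto> \<sigma>)) y = Some \<tau>" for y \<tau>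
      using that assms(1) typing_wf_ctx[OF r]
      by (cases "y = x") (auto simp: wf_ctx_def restrict_map_def split: if_splits)
    then show "wf_ctx (?\<Delta>(x \<mapsto> \<sigma>))" by (simp add: wf_ctx_def finite_subset[OF _ \<open>finite (fv M)\<close>])
  qed
  then have "?\<Delta> \<turnstile> lam x M \<Ztypecolon> Lin (\<sigma> \<multimap> A)" by (rule typing.LolliI) auto
  then show ?thesis by (auto simp: typed_def)
qed

text \<open>Abstraction of a duplicable variable: here the hidden number of bangs surfaces, on the
  argument type.\<close>

lemma typed_lam_dup:
  assumes "lc_ty 0 \<sigma>" "\<Psi>(x \<mapsto> \<sigma>); \<Gamma> \<tturnstile> M \<Ztypecolon> Lin A" "x \<notin> dom \<Gamma>"
  shows "\<exists>r. \<Psi>; \<Gamma> \<tturnstile> lam x M \<Ztypecolon> Lin ((Bang ^^ r) \<sigma> \<multimap> A)"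
proof -
  from assms(2) obtain r where r: "(bangs r (\<Psi>(x \<mapsto> \<sigma>)) ++ \<Gamma>) |` fv M \<turnstile> M \<Ztypecolon> Lin A"
    by (auto simp: typed_def)
  let ?\<Delta> = "(bangs r \<Psi> ++ \<Gamma>) |` (fv M - {x})"
  have lc: "lc_ty 0 ((Bang ^^ r) \<sigma>)" using assms(1) by (induction r) auto
  have "?\<Delta>(x \<mapsto> (Bang ^^ r) \<sigma>) \<turnstile> M \<Ztypecolon> Lin A"
  proof (rule typing_weaken[OF r])
    show "(bangs r (\<Psi>(x \<mapsto> \<sigma>)) ++ \<Gamma>) |` fv M \<subseteq>\<^sub>m ?\<Delta>(x \<mapsto> (Bang ^^ r) \<sigma>)"
      using assms(3) by (auto simp: map_le_def restrict_map_def map_add_def bangs_def dom_def split: option.splits)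
    have fin: "finite (fv M)" by simp
    have "lc_ty 0 \<tau>" if "(?\<Delta>(x \<mapsto> (Bang ^^ r) \<sigma>)) y = Some \<tau>" for y \<tau>
    proof (cases "y = x")
      case False
      with that have "((bangs r (\<Psi>(x \<mapsto> \<sigma>)) ++ \<Gamma>) |` fv M) y = Some \<tau>"
        by (cases "\<Gamma> y") (auto simp: restrict_map_def bangs_def map_add_def split: if_splits)
      then show ?thesis by (rule wf_ctxD[OF typing_wf_ctx[OF r]])
    qed (use that lc in auto)
    then show "wf_ctx (?\<Delta>(x \<mapsto> (Bang ^^ r) \<sigma>))" by (simp add: wf_ctx_def finite_subset[OF _ fin])
  qed
  then have "?\<Delta> \<turnstile> lam x M \<Ztypecolon> Lin ((Bang ^^ r) \<sigma> \<multimap> A)" by (rule typing.LolliI) auto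
  then show ?thesis by (auto simp: typed_def)
qed

text \<open>Assumptions of \<Psi> that occur on both sides are contracted and gain a bang; linear
  assumptions have to be split between function and argument.\<close>

lemma typed_app:
  assumes "\<Psi>; \<Gamma> \<tturnstile> M \<Ztypecolon> Lin (\<sigma> \<multimap> A)" "\<Psi>; \<Gamma> \<tturnstile> N \<Ztypecolon> \<sigma>" "fv M \<inter> fv N \<inter> dom \<Gamma> = {}"
  shows "\<Psi>; \<Gamma> \<tturnstile> M \<cdot> N \<Ztypecolon> Lin A"
proof -
  from assms(1,2) obtain r1 r2 where
    r: "(bangs r1 \<Psi> ++ \<Gamma>) |` fv M \<turnstile> M \<Ztypecolon> Lin (\<sigma> \<multimap> A)" "(bangs r2 \<Psi> ++ \<Gamma>) |` fv N \<turnstile> N \<Ztypecolon> \<sigma>"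
    by (auto simp: typed_def)
  define r where "r = max r1 r2"
  define \<Theta> where "\<Theta> = bangs r \<Psi> ++ \<Gamma>"
  define \<Gamma>' where "\<Gamma>' = bang_on (dom (\<Theta> |` fv M) \<inter> dom (\<Theta> |` fv N)) (\<Theta> |` fv M ++ \<Theta> |` fv N)"
  have "\<Theta> |` fv M \<turnstile> M \<Ztypecolon> Lin (\<sigma> \<multimap> A)" "\<Theta> |` fv N \<turnstile> N \<Ztypecolon> \<sigma>"
    unfolding \<Theta>_def using r by (auto intro: typed_rank simp: r_def)
  then have "\<Gamma>' \<turnstile> M \<cdot> N \<Ztypecolon> Lin A"
    unfolding \<Gamma>'_def by (rule typing_app_shared) (auto simp: restrict_map_def)
  \<comment> \<open>The shared variables have gained a bang already. The unshared duplicable ones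
    get one too, so that all of \<Psi> ends up with r + 1.\<close>
  from typing_bang_on[OF this, of "dom \<Psi> - dom \<Gamma> - fv M \<inter> fv N"]
  have "bang_on (dom \<Psi> - dom \<Gamma> - fv M \<inter> fv N) \<Gamma>' \<turnstile> M \<cdot> N \<Ztypecolon> Lin A" .
  moreover have "bang_on (dom \<Psi> - dom \<Gamma> - fv M \<inter> fv N) \<Gamma>' = (bangs (Suc r) \<Psi> ++ \<Gamma>) |` fv (M \<cdot> N)"
  proof
    fix x
    show "bang_on (dom \<Psi> - dom \<Gamma> - fv M \<inter> fv N) \<Gamma>' x = ((bangs (Suc r) \<Psi> ++ \<Gamma>) |` fv (M \<cdot> N)) x"
      using assms(3)
      by (cases "\<Gamma> x"; cases "\<Psi> x"; cases "x \<in> fv M"; cases "x \<in> fv N")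
        (auto simp: \<Gamma>'_def \<Theta>_def bang_on_def restrict_map_def map_add_def bangs_def dom_def)
  qed
  ultimately show ?thesis unfolding typed_def by metis
qed

text \<open>Guard and branches live in the same context, linear assumptions included. This additive
  sharing is what allows a linear resource to be consulted in a guard and used again
  afterwards.\<close>

lemma typed_cond:
  assumes "\<Psi>; \<Gamma> \<tturnstile> M \<Ztypecolon> Lin TBool" "\<Psi>; \<Gamma> \<tturnstile> N0 \<Ztypecolon> Lin A" "\<Psi>; \<Gamma> \<tturnstile> N1 \<Ztypecolon> Lin A"
  shows "\<Psi>; \<Gamma> \<tturnstile> Cond M N0 N1 \<Ztypecolon> Lin A"
proof -
  from assms obtain r1 r2 r3 where
    r: "(bangs r1 \<Psi> ++ \<Gamma>) |` fv M \<turnstile> M \<Ztypecolon> Lin TBool" "(bangs r2 \<Psi> ++ \<Gamma>) |` fv N0 \<turnstile> N0 \<Ztypecolon> Lin A"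
      "(bangs r3 \<Psi> ++ \<Gamma>) |` fv N1 \<turnstile> N1 \<Ztypecolon> Lin A"
    by (auto simp: typed_def)
  define r where "r = Max {r1, r2, r3}"
  define \<Theta> where "\<Theta> = bangs r \<Psi> ++ \<Gamma>"
  have t: "\<Theta> |` fv M \<turnstile> M \<Ztypecolon> Lin TBool" "\<Theta> |` fv N0 \<turnstile> N0 \<Ztypecolon> Lin A" "\<Theta> |` fv N1 \<turnstile> N1 \<Ztypecolon> Lin A"
    unfolding \<Theta>_def using r by (auto intro: typed_rank simp: r_def)
  let ?X = "fv M \<union> fv N0 \<union> fv N1"
  have "lc_ty 0 \<tau>" if "(\<Theta> |` ?X) x = Some \<tau>" for x \<tau>
  proof -
    from that have "(\<Theta> |` fv M) x = Some \<tau> \<or> (\<Theta> |` fv N0) x = Some \<tau> \<or> (\<Theta> |` fv N1) x = Some \<tau>"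
      by (auto simp: restrict_map_def split: if_splits)
    then show ?thesis using t[THEN typing_wf_ctx, THEN wf_ctxD] by blast
  qed
  then have wf: "wf_ctx (\<Theta> |` ?X)" by (simp add: wf_ctx_def)
  have "\<Theta> |` fv M \<subseteq>\<^sub>m \<Theta> |` ?X" "\<Theta> |` fv N0 \<subseteq>\<^sub>m \<Theta> |` ?X" "\<Theta> |` fv N1 \<subseteq>\<^sub>m \<Theta> |` ?X"
    by (auto simp: map_le_def restrict_map_def)
  then have "\<Theta> |` ?X \<turnstile> Cond M N0 N1 \<Ztypecolon> Lin A"
    using t wf by (blast intro: typing.BE typing_weaken)
  then show ?thesis unfolding typed_def \<Theta>_def fv.simps by blast
qed

text \<open>Promotion puts a bang on every assumption of the context, which only those of \<Psi> can
  absorb in their hidden number.\<close>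

lemma typed_box:
  assumes "\<Psi>; \<Gamma> \<tturnstile> M \<Ztypecolon> \<sigma>" "fv M \<inter> dom \<Gamma> = {}"
  shows "\<Psi>; \<Gamma> \<tturnstile> M \<Ztypecolon> (Bang ^^ n) \<sigma>"
proof (induction n)
  case 0
  then show ?case using assms(1) by simp
next
  case (Suc n)
  then obtain r where "(bangs r \<Psi> ++ \<Gamma>) |` fv M \<turnstile> M \<Ztypecolon> (Bang ^^ n) \<sigma>"
    by (auto simp: typed_def)
  then have "bang_ctx ((bangs r \<Psi> ++ \<Gamma>) |` fv M) \<turnstile> M \<Ztypecolon> (Bang ^^ Suc n) \<sigma>"
    by (simp add: typing.Sp)
  moreover have "bang_ctx ((bangs r \<Psi> ++ \<Gamma>) |` fv M) = (bangs (Suc r) \<Psi> ++ \<Gamma>) |` fv M"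
    using assms(2) by (auto simp: bang_ctx_def bangs_def restrict_map_def fun_eq_iff map_add_def
        option.map_comp comp_def split: option.splits)
  ultimately show ?case unfolding typed_def by metis
qed

text \<open>Promotion with exact counting: n bangs on the only assumption give n bangs on the
  result. The growth of the tuple depends on it, because its input and output types must
  coincide.\<close>

lemma typed_box_var:
  assumes "Map.empty; [x \<mapsto> \<sigma>] \<tturnstile> M \<Ztypecolon> \<tau>" "fv M \<subseteq> {x}" "\<Gamma> x = Some ((Bang ^^ n) \<sigma>)"
  shows "\<Psi>; \<Gamma> \<tturnstile> M \<Ztypecolon> (Bang ^^ n) \<tau>"
proof -
  have e: "bangs r Map.empty = Map.empty" for r by (simp add: bangs_def)
  from assms(1) have "[x \<mapsto> \<sigma>] |` fv M \<turnstile> M \<Ztypecolon> \<tau>" by (simp add: typed_def e)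
  then have "[x \<mapsto> (Bang ^^ n) \<sigma>] |` fv M \<turnstile> M \<Ztypecolon> (Bang ^^ n) \<tau>"
  proof (induction n)
    case (Suc n)
    have "bang_ctx ([x \<mapsto> (Bang ^^ n) \<sigma>] |` fv M) = [x \<mapsto> (Bang ^^ Suc n) \<sigma>] |` fv M"
      by (auto simp: bang_ctx_def restrict_map_def fun_eq_iff)
    with typing.Sp[OF Suc.IH[OF Suc.prems]] show ?case by (simp del: fun_upd_apply restrict_fun_upd)
  qed simp
  moreover have "[x \<mapsto> (Bang ^^ n) \<sigma>] |` fv M = (bangs 0 \<Psi> ++ \<Gamma>) |` fv M"
    using assms(2,3) by (auto simp: restrict_map_def fun_eq_iff)
  ultimately show ?thesis unfolding typed_def by metis
qed

lemma typed_allI: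
  assumes "\<Psi>; \<Gamma> \<tturnstile> M \<Ztypecolon> Lin A" "\<And>x \<sigma>. x \<in> fv M \<Longrightarrow> (\<Psi> ++ \<Gamma>) x = Some \<sigma> \<Longrightarrow> \<alpha> \<notin> ftv_ty \<sigma>"
  shows "\<Psi>; \<Gamma> \<tturnstile> M \<Ztypecolon> Lin (tall \<alpha> A)"
proof -
  from assms(1) obtain r where r: "(bangs r \<Psi> ++ \<Gamma>) |` fv M \<turnstile> M \<Ztypecolon> Lin A" by (auto simp: typed_def)
  have ftv: "ftv_ty ((Bang ^^ r) \<sigma>) = ftv_ty \<sigma>" for \<sigma> by (induction r) auto
  have "\<alpha> \<notin> ftv_ctx ((bangs r \<Psi> ++ \<Gamma>) |` fv M)"
  proof
    assume "\<alpha> \<in> ftv_ctx ((bangs r \<Psi> ++ \<Gamma>) |` fv M)"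
    then obtain x \<tau> where "((bangs r \<Psi> ++ \<Gamma>) |` fv M) x = Some \<tau>" "\<alpha> \<in> ftv_ty \<tau>"
      unfolding ftv_ctx_def ran_def by blast
    then have x: "x \<in> fv M" "(bangs r \<Psi> ++ \<Gamma>) x = Some \<tau>" "\<alpha> \<in> ftv_ty \<tau>"
      by (simp_all add: restrict_map_def split: if_splits)
    then show False using assms(2)[OF x(1)] ftv
      by (cases "\<Gamma> x") (auto simp: bangs_def map_add_def)
  qed
  with r show ?thesis unfolding typed_def by (blast intro: typing.AllI)
qed

lemma typed_allE: "\<Psi>; \<Gamma> \<tturnstile> M \<Ztypecolon> Lin (TAll B) \<Longrightarrow> wf_lty A \<Longrightarrow> \<Psi>; \<Gamma> \<tturnstile> M \<Ztypecolon> Lin (open_lty 0 A B)"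
  by (auto simp: typed_def intro: typing.AllE)

lemma typed_closed: "\<Psi>; \<Gamma> \<tturnstile> M \<Ztypecolon> \<tau> \<Longrightarrow> fv M = {} \<Longrightarrow> Map.empty \<turnstile> M \<Ztypecolon> \<tau>"
  by (simp add: typed_def restrict_map_def)

section \<open>Head expansion\<close>

text \<open>The quantification over \<open>Vs\<close> makes the relation stable under application to
  further arguments. A value of the reduct is a value of the redex.\<close>

definition hexp :: "trm \<Rightarrow> trm \<Rightarrow> bool" (infix "\<leadsto>" 50) where
  "M \<leadsto> M' \<longleftrightarrow> (\<forall>Vs b. ev (apps M' Vs) b \<longrightarrow> ev (apps M Vs) b)"

lemma hexp_refl [simp]: "M \<leadsto> M"
  by (simp add: hexp_def)

lemma hexp_trans [trans]: "M \<leadsto> M' \<Longrightarrow> M' \<leadsto> M'' \<Longrightarrow> M \<leadsto> M''"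
  by (simp add: hexp_def)

lemma hexp_app: "M \<leadsto> M' \<Longrightarrow> M \<cdot> N \<leadsto> M' \<cdot> N"
  unfolding hexp_def by (metis foldl_Cons)

lemma hexp_apps: "M \<leadsto> M' \<Longrightarrow> apps M Vs \<leadsto> apps M' Vs"
  by (induction Vs arbitrary: M M') (auto intro: hexp_app)

lemma hexp_ev: "M \<leadsto> M' \<Longrightarrow> ev M' b \<Longrightarrow> ev M b"
  unfolding hexp_def by (metis foldl_Nil)

lemma hexp_beta: "is_term M \<Longrightarrow> lam x M \<cdot> N \<leadsto> subst x N M"
  unfolding hexp_def lam_def using ev.Beta by (metis open_close)

lemma is_term_lam [simp]: "is_term M \<Longrightarrow> is_term (lam x M)"
  by (simp add: lam_def lc_close)

lemma closed_term_simps [simp]: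
  "closed_term (M \<cdot> N) \<longleftrightarrow> closed_term M \<and> closed_term N"
  "closed_term (Const b)"
  "is_term M \<Longrightarrow> closed_term (lam x M) \<longleftrightarrow> fv M \<subseteq> {x}"
  by (auto simp: closed_term_def)

lemma closed_termI: "is_term M \<Longrightarrow> fv M = {} \<Longrightarrow> closed_term M"
  by (simp add: closed_term_def)

lemma closed_termD [simp]: "closed_term M \<Longrightarrow> is_term M" "closed_term M \<Longrightarrow> fv M = {}"
  by (auto simp: closed_term_def)

lemma subst_closed [simp]: "closed_term M \<Longrightarrow> subst x L M = M"
  by (simp add: subst_fresh)

lemma subst_lam [simp]:
  "closed_term L \<Longrightarrow> subst x L (lam y M) = (if x = y then lam y M else lam y (subst x L M))"
  by (auto simp: lam_def subst_close subst_fresh)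

lemma is_term_subst [simp]: "is_term M \<Longrightarrow> closed_term L \<Longrightarrow> is_term (subst x L M)"
  by (simp add: lc_subst)

text \<open>Every argument but the last is substituted under a remaining binder, which is
  unproblematic for closed arguments.\<close>

lemma hexp_beta2:
  assumes "is_term M" "closed_term N1" "x1 \<noteq> x2"
  shows "lam x1 (lam x2 M) \<cdot> N1 \<cdot> N2 \<leadsto> subst x2 N2 (subst x1 N1 M)"
proof -
  have "lam x1 (lam x2 M) \<cdot> N1 \<leadsto> lam x2 (subst x1 N1 M)"
    using hexp_beta[of "lam x2 M" x1 N1] assms by simp
  then have "lam x1 (lam x2 M) \<cdot> N1 \<cdot> N2 \<leadsto> lam x2 (subst x1 N1 M) \<cdot> N2" by (rule hexp_app)
  also have "\<dots> \<leadsto> subst x2 N2 (subst x1 N1 M)" using assms by (intro hexp_beta) simp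
  finally show ?thesis .
qed

lemma hexp_beta3:
  assumes "is_term M" "closed_term N1" "closed_term N2" "x1 \<noteq> x2" "x1 \<noteq> x3" "x2 \<noteq> x3"
  shows "lam x1 (lam x2 (lam x3 M)) \<cdot> N1 \<cdot> N2 \<cdot> N3 \<leadsto> subst x3 N3 (subst x2 N2 (subst x1 N1 M))"
proof -
  have "lam x1 (lam x2 (lam x3 M)) \<cdot> N1 \<leadsto> lam x2 (lam x3 (subst x1 N1 M))"
    using hexp_beta[of "lam x2 (lam x3 M)" x1 N1] assms by simp
  then have "lam x1 (lam x2 (lam x3 M)) \<cdot> N1 \<cdot> N2 \<cdot> N3 \<leadsto> lam x2 (lam x3 (subst x1 N1 M)) \<cdot> N2 \<cdot> N3"
    by (intro hexp_app)
  also have "\<dots> \<leadsto> subst x3 N3 (subst x2 N2 (subst x1 N1 M))" using assms by (intro hexp_beta2) simp_all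
  finally show ?thesis .
qed

lemma hexp_beta4:
  assumes "is_term M" "closed_term N1" "closed_term N2" "closed_term N3" "distinct [x1, x2, x3, x4]"
  shows "lam x1 (lam x2 (lam x3 (lam x4 M))) \<cdot> N1 \<cdot> N2 \<cdot> N3 \<cdot> N4 \<leadsto>
    subst x4 N4 (subst x3 N3 (subst x2 N2 (subst x1 N1 M)))"
proof -
  have "lam x1 (lam x2 (lam x3 (lam x4 M))) \<cdot> N1 \<leadsto> lam x2 (lam x3 (lam x4 (subst x1 N1 M)))"
    using hexp_beta[of "lam x2 (lam x3 (lam x4 M))" x1 N1] assms by simp
  then have "lam x1 (lam x2 (lam x3 (lam x4 M))) \<cdot> N1 \<cdot> N2 \<cdot> N3 \<cdot> N4 \<leadsto>
      lam x2 (lam x3 (lam x4 (subst x1 N1 M))) \<cdot> N2 \<cdot> N3 \<cdot> N4"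
    by (intro hexp_app)
  also have "\<dots> \<leadsto> subst x4 N4 (subst x3 N3 (subst x2 N2 (subst x1 N1 M)))"
    using assms by (intro hexp_beta3) simp_all
  finally show ?thesis .
qed

lemma ev_Cond: "ev M i \<Longrightarrow> ev (if i then N1 else N0) b \<Longrightarrow> ev (Cond M N0 N1) b"
  using ev.Cond[of M i N1 N0 "[]" b] by simp

section \<open>Finite types\<close>

(* 0 <= i < n is encoded as the projection from n booleans to the i-th one. *)

primrec ignore :: "nat \<Rightarrow> trm \<Rightarrow> trm" where
  "ignore 0 M = M"
| "ignore (Suc n) M = lam 18 (ignore n M)"

primrec fin :: "nat \<Rightarrow> nat \<Rightarrow> trm" where
  "fin 0 i = Const False"
| "fin (Suc n) i = (case i of 0 \<Rightarrow> lam 19 (ignore n (Free 19)) | Suc j \<Rightarrow> lam 18 (fin n j))"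

lemma fv_ignore [simp]: "18 \<notin> fv M \<Longrightarrow> fv (ignore n M) = fv M"
  by (induction n) auto

lemma is_term_ignore [simp]: "is_term M \<Longrightarrow> is_term (ignore n M)"
  by (induction n) auto

lemma subst_ignore [simp]: "closed_term L \<Longrightarrow> x \<noteq> 18 \<Longrightarrow> subst x L (ignore n M) = ignore n (subst x L M)"
  by (induction n) auto

lemma closed_fin [simp]: "closed_term (fin n i)"
  by (induction n arbitrary: i) (auto split: nat.splits)

lemma ignore_apps: "closed_term M \<Longrightarrow> apps (ignore (length Vs) M) Vs \<leadsto> M"
proof (induction Vs)
  case (Cons V Vs)
  have "closed_term (ignore n M)" for n using Cons.prems by (induction n) auto
  then have "lam 18 (ignore (length Vs) M) \<cdot> V \<leadsto> ignore (length Vs) M"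
    using hexp_beta[of "ignore (length Vs) M" 18 V] Cons.prems by simp
  then have "apps (lam 18 (ignore (length Vs) M) \<cdot> V) Vs \<leadsto> apps (ignore (length Vs) M) Vs"
    by (rule hexp_apps)
  also have "\<dots> \<leadsto> M" using Cons by simp
  finally show ?case by simp
qed simp

lemma fin_apps: "i < length Vs \<Longrightarrow> \<forall>V\<in>set Vs. closed_term V \<Longrightarrow> apps (fin (length Vs) i) Vs \<leadsto> Vs ! i"
proof (induction Vs arbitrary: i)
  case (Cons V Vs)
  show ?case
  proof (cases i)
    case 0
    have "lam 19 (ignore (length Vs) (Free 19)) \<cdot> V \<leadsto> ignore (length Vs) V"
      using hexp_beta[of "ignore (length Vs) (Free 19)" 19 V] Cons.prems by simp
    then have "apps (lam 19 (ignore (length Vs) (Free 19)) \<cdot> V) Vs \<leadsto> apps (ignore (length Vs) V) Vs"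
      by (rule hexp_apps)
    also have "\<dots> \<leadsto> V" using Cons.prems by (simp add: ignore_apps)
    finally show ?thesis using 0 by simp
  next
    case (Suc j)
    have "lam 18 (fin (length Vs) j) \<cdot> V \<leadsto> fin (length Vs) j"
      using hexp_beta[of "fin (length Vs) j" 18 V] Cons.prems by simp
    then have "apps (lam 18 (fin (length Vs) j) \<cdot> V) Vs \<leadsto> apps (fin (length Vs) j) Vs"
      by (rule hexp_apps)
    also have "\<dots> \<leadsto> Vs ! j" using Cons Suc by simp
    finally show ?thesis using Suc by simp
  qed
qed simp

(* The constant 0 selects the then branch, so a successful test returns 0. *)
definition tst :: "nat \<Rightarrow> nat \<Rightarrow> trm \<Rightarrow> trm" where
  "tst n j M = apps M (map (\<lambda>i. Const (i \<noteq> j)) [0..<n])"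

lemma ev_tst: "i < n \<Longrightarrow> ev (tst n j (fin n i)) (i \<noteq> j)"
  using fin_apps[of i "map (\<lambda>i. Const (i \<noteq> j)) [0..<n]"] ev.Const[of "i \<noteq> j"]
  by (auto simp: tst_def intro: hexp_ev)

lemma tst_simps [simp]:
  "fv (tst n j M) = fv M" "is_term (tst n j M) \<longleftrightarrow> is_term M" "subst x L (tst n j M) = tst n j (subst x L M)"
  by (auto simp: tst_def fv_apps lc_apps subst_apps comp_def)

text \<open>A cascade of conditionals rather than a projection applied to n branches: in
  conditionals all guards and branches share the same linear resources. The final
  \<open>Const False\<close> is the answer if no guard succeeds.\<close>

definition switch :: "nat \<Rightarrow> (nat \<Rightarrow> trm) \<Rightarrow> (nat \<Rightarrow> trm) \<Rightarrow> trm" where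
  "switch n G X = foldr (\<lambda>i M. Cond (G i) (X i) M) [0..<n] (Const False)"

lemma switch_simps [simp]:
  "fv (switch n G X) = (\<Union>i<n. fv (G i) \<union> fv (X i))"
  "is_term (switch n G X) \<longleftrightarrow> (\<forall>i<n. is_term (G i) \<and> is_term (X i))"
  "subst x L (switch n G X) = switch n (\<lambda>i. subst x L (G i)) (\<lambda>i. subst x L (X i))"
proof -
  have "fv (foldr (\<lambda>i M. Cond (G i) (X i) M) is (Const False)) = (\<Union>i\<in>set is. fv (G i) \<union> fv (X i))" for "is"
    by (induction "is") auto
  then show "fv (switch n G X) = (\<Union>i<n. fv (G i) \<union> fv (X i))"
    by (simp add: switch_def atLeast0LessThan)
  have "is_term (foldr (\<lambda>i M. Cond (G i) (X i) M) is (Const False)) \<longleftrightarrow>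
      (\<forall>i\<in>set is. is_term (G i) \<and> is_term (X i))" for "is"
    by (induction "is") auto
  then show "is_term (switch n G X) \<longleftrightarrow> (\<forall>i<n. is_term (G i) \<and> is_term (X i))"
    by (auto simp: switch_def)
  have "subst x L (foldr (\<lambda>i M. Cond (G i) (X i) M) is (Const False)) =
      foldr (\<lambda>i M. Cond (subst x L (G i)) (subst x L (X i)) M) is (Const False)" for "is"
    by (induction "is") auto
  then show "subst x L (switch n G X) = switch n (\<lambda>i. subst x L (G i)) (\<lambda>i. subst x L (X i))"
    by (simp add: switch_def)
qed

text \<open>The guards before i return 1 and fall through; the guard of i returns 0 and selects
  \<open>X i\<close>.\<close>

lemma ev_switch:
  assumes "\<And>j. j < n \<Longrightarrow> ev (G j) (i \<noteq> j)" "i < n" "ev (X i) b"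
  shows "ev (switch n G X) b"
proof -
  have "set is \<subseteq> {..<n} \<Longrightarrow> i \<in> set is \<Longrightarrow>
      ev (foldr (\<lambda>i M. Cond (G i) (X i) M) is (Const False)) b" for "is"
  proof (induction "is")
    case (Cons j js)
    show ?case unfolding foldr.simps comp_def
      by (rule ev_Cond[OF assms(1)[of j]]) (use Cons assms(3) in auto)
  qed simp
  then show ?thesis unfolding switch_def using assms(2) by (simp add: subset_iff)
qed

section \<open>Iteration over the encoding of a string\<close>

lemma enc_fold:
  assumes "closed_term F" "closed_term Z"
  shows "enc s \<cdot> F \<cdot> Z \<leadsto> foldr (\<lambda>b M. F \<cdot> Const b \<cdot> M) s Z"
proof -
  define B where "B = foldr (\<lambda>b M. Bound 1 \<cdot> Const b \<cdot> M) s (Bound 0)"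
  have 1: "open_trm 1 F B = foldr (\<lambda>b M. F \<cdot> Const b \<cdot> M) s (Bound 0)"
    unfolding B_def by (induction s) auto
  have 2: "open_trm 0 Z (foldr (\<lambda>b M. F \<cdot> Const b \<cdot> M) s (Bound 0)) = foldr (\<lambda>b M. F \<cdot> Const b \<cdot> M) s Z"
    using assms by (induction s) (auto simp: open_trm_lc[of 0])
  show ?thesis
    unfolding hexp_def
  proof (intro allI impI)
    fix Vs b
    assume "ev (apps (foldr (\<lambda>b M. F \<cdot> Const b \<cdot> M) s Z) Vs) b"
    then have "ev (apps (Lam (open_trm 1 F B) \<cdot> Z) Vs) b"
      unfolding 1 by (intro ev.Beta) (simp only: 2)
    then have "ev (apps (open_trm 0 F (Lam B)) (Z # Vs)) b" by simp
    then have "ev (apps (Lam (Lam B) \<cdot> F) (Z # Vs)) b" by (rule ev.Beta)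
    then show "ev (apps (enc s \<cdot> F \<cdot> Z) Vs) b" by (simp add: enc_def B_def)
  qed
qed

lemma closed_enc [simp]: "closed_term (enc s)"
proof -
  have "lc 2 (foldr (\<lambda>b M. Bound 1 \<cdot> Const b \<cdot> M) s (Bound 0))"
    "fv (foldr (\<lambda>b M. Bound 1 \<cdot> Const b \<cdot> M) s (Bound 0)) = {}"
    by (induction s) auto
  then show ?thesis by (simp add: enc_def closed_term_def numeral_2_eq_2 del: closed_termD)
qed

text \<open>Nested loops along the string. Level j + 1 runs level j first c times and then once per
  bit of s, the bit being the ignored name 15. Altogether G is applied (length s + c)^j times at
  level j, by a term that depends on s only through its use as an iterator.\<close>

primrec iter :: "trm \<Rightarrow> nat \<Rightarrow> nat \<Rightarrow> trm \<Rightarrow> trm" where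
  "iter s c 0 G = G"
| "iter s c (Suc j) G =
    lam 14 (s \<cdot> lam 15 (iter s c j G) \<cdot> ((\<lambda>M. iter s c j G \<cdot> M) ^^ c) (Free 14))"

lemma fv_app_funpow: "fv (((\<lambda>M. G \<cdot> M) ^^ c) Z) = (if c = 0 then {} else fv G) \<union> fv Z"
  by (induction c) auto

lemma is_term_app_funpow: "is_term G \<Longrightarrow> is_term Z \<Longrightarrow> is_term (((\<lambda>M. G \<cdot> M) ^^ c) Z)"
  by (induction c) auto

lemma subst_app_funpow:
  "subst x L (((\<lambda>M. G \<cdot> M) ^^ c) Z) = ((\<lambda>M. subst x L G \<cdot> M) ^^ c) (subst x L Z)"
  by (induction c) auto

lemma fv_iter: "14 \<notin> fv s \<union> fv G \<Longrightarrow> 15 \<notin> fv s \<union> fv G \<Longrightarrow>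
    fv (iter s c j G) = fv G \<union> (if j = 0 then {} else fv s)"
  by (induction j) (auto simp: fv_app_funpow)

lemma is_term_iter [simp]: "is_term s \<Longrightarrow> is_term G \<Longrightarrow> is_term (iter s c j G)"
  by (induction j) (auto simp: is_term_app_funpow)

lemma closed_iter [simp]: "closed_term s \<Longrightarrow> closed_term G \<Longrightarrow> closed_term (iter s c j G)"
  by (auto simp: closed_term_def fv_iter simp del: closed_termD)

lemma subst_iter [simp]:
  "closed_term L \<Longrightarrow> x \<notin> {14, 15} \<Longrightarrow> subst x L (iter s c j G) = iter (subst x L s) c j (subst x L G)"
  by (induction j) (auto simp: subst_app_funpow)

text \<open>\<open>R i X\<close> is to be read as: X is the outcome of i steps. It must be stable
  under head expansion, since the loops compute only up to it.\<close>

lemma iter_correct: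
  assumes step: "\<And>i X. R i X \<Longrightarrow> R (Suc i) (G \<cdot> X)"
    and expand: "\<And>i X Y. closed_term X \<Longrightarrow> X \<leadsto> Y \<Longrightarrow> R i Y \<Longrightarrow> R i X"
    and closed: "\<And>i X. R i X \<Longrightarrow> closed_term X" "closed_term G"
    and "R i X"
  shows "R (i + (length s + c) ^ j) (iter (enc s) c j G \<cdot> X)"
  using \<open>R i X\<close>
proof (induction j arbitrary: i X)
  case 0
  then show ?case using step by simp
next
  case (Suc j)
  define I where "I = iter (enc s) c j G"
  define p where "p = (length s + c) ^ j"
  have I: "closed_term I" using closed by (simp add: I_def)
  have IH: "R (i + p) (I \<cdot> X)" if "R i X" for i X using Suc.IH[OF that] by (simp add: I_def p_def)
  have "R (i + k * p) (((\<lambda>M. I \<cdot> M) ^^ k) X)" for k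
  proof (induction k)
    case (Suc k)
    then show ?case using IH[OF Suc] by (simp add: ac_simps)
  qed (use Suc.prems in simp)
  from this[of c] have c: "R (i + c * p) (((\<lambda>M. I \<cdot> M) ^^ c) X)" .
  let ?X = "((\<lambda>M. I \<cdot> M) ^^ c) X"
  have fold: "R (i + c * p + length s * p) (foldr (\<lambda>b M. lam 15 I \<cdot> Const b \<cdot> M) s ?X)"
  proof (induction s)
    case Nil
    then show ?case using c by simp
  next
    case (Cons b s)
    let ?M = "foldr (\<lambda>b M. lam 15 I \<cdot> Const b \<cdot> M) s ?X"
    have "closed_term ?M" using closed(1) Cons by blast
    moreover have "lam 15 I \<cdot> Const b \<leadsto> I" using hexp_beta[of I 15 "Const b"] I by simp
    then have "lam 15 I \<cdot> Const b \<cdot> ?M \<leadsto> I \<cdot> ?M" by (rule hexp_app)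
    ultimately have "R (i + c * p + length s * p + p) (lam 15 I \<cdot> Const b \<cdot> ?M)"
      using expand IH[OF Cons] I by simp
    then show ?case by (simp add: algebra_simps)
  qed
  have X: "closed_term X" "closed_term ?X" using closed(1) Suc.prems c by blast+
  have "iter (enc s) c (Suc j) G \<cdot> X \<leadsto> enc s \<cdot> lam 15 I \<cdot> ?X"
    using hexp_beta[of "enc s \<cdot> lam 15 I \<cdot> ((\<lambda>M. I \<cdot> M) ^^ c) (Free 14)" 14 X] I X
    by (simp add: I_def[symmetric] is_term_app_funpow subst_app_funpow)
  also have "\<dots> \<leadsto> foldr (\<lambda>b M. lam 15 I \<cdot> Const b \<cdot> M) s ?X"
    by (rule enc_fold) (use I X in auto)
  finally have *: "iter (enc s) c (Suc j) G \<cdot> X \<leadsto> foldr (\<lambda>b M. lam 15 I \<cdot> Const b \<cdot> M) s ?X" .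
  have "closed_term (iter (enc s) c (Suc j) G \<cdot> X)"
    using closed_iter[OF closed_enc closed(2), of s c "Suc j"] X by (simp only: closed_term_simps)
  then have "R (i + c * p + length s * p) (iter (enc s) c (Suc j) G \<cdot> X)"
    using expand * fold by blast
  then show ?case by (simp add: p_def algebra_simps)
qed

section \<open>The program: two-way transducers on lists\<close>

text \<open>Cell contents and messages share the range {..<n}, so that \<open>fin n\<close> encodes
  both. \<open>last\<close> is the answer of the right end; the message \<open>idle\<close> passes
  through the list without altering it, which makes a sweep a copy.\<close>

locale transducer =
  fixes n :: nat and lo :: "nat \<Rightarrow> nat \<Rightarrow> nat" and ro out :: "nat \<Rightarrow> nat \<Rightarrow> nat \<Rightarrow> nat"
    and last idle :: nat
  assumes lo_less: "l < n \<Longrightarrow> a < n \<Longrightarrow> lo l a < n"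
    and ro_less: "l < n \<Longrightarrow> a < n \<Longrightarrow> m < n \<Longrightarrow> ro l a m < n"
    and out_less: "l < n \<Longrightarrow> a < n \<Longrightarrow> m < n \<Longrightarrow> out l a m < n"
    and last_less: "last < n"
    and idle_less: "idle < n"
    and idle: "a < n \<Longrightarrow> lo idle a = idle" "a < n \<Longrightarrow> out idle a m = a"
begin

(* lo: message passed on to the right, ro: message returned to the left, out: new content. *)
fun sweep :: "nat \<Rightarrow> nat list \<Rightarrow> nat \<times> nat list" where
  "sweep l [] = (last, [])"
| "sweep l (a # t) = (let (m, t') = sweep (lo l a) t in (ro l a m, out l a m # t'))"

section \<open>Terms of the program\<close>

definition cons :: "trm \<Rightarrow> trm \<Rightarrow> trm" where
  "cons a t = lam 17 (Free 17 \<cdot> a \<cdot> t)"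

lemma cons_simps [simp]:
  "17 \<notin> fv a \<union> fv t \<Longrightarrow> fv (cons a t) = fv a \<union> fv t"
  "is_term a \<Longrightarrow> is_term t \<Longrightarrow> is_term (cons a t)"
  "closed_term L \<Longrightarrow> x \<noteq> 17 \<Longrightarrow> subst x L (cons a t) = cons (subst x L a) (subst x L t)"
  by (auto simp: cons_def)

abbreviation "vr \<equiv> 20 :: name"
abbreviation "vo \<equiv> 21 :: name"
abbreviation "vl \<equiv> 2 :: name"
abbreviation "vk \<equiv> 3 :: name"
abbreviation "vp \<equiv> 4 :: name"
abbreviation "vP \<equiv> 5 :: name"
abbreviation "va \<equiv> 6 :: name"
abbreviation "vt \<equiv> 7 :: name"
abbreviation "vm \<equiv> 8 :: name"
abbreviation "vv \<equiv> 9 :: name"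
abbreviation "vs \<equiv> 10 :: name"
abbreviation "vq \<equiv> 11 :: name"
abbreviation "vc \<equiv> 12 :: name"
abbreviation "vx \<equiv> 13 :: name"
abbreviation "vb \<equiv> 15 :: name"
abbreviation "vg \<equiv> 16 :: name"

definition uncons :: "trm \<Rightarrow> trm" where
  "uncons M = lam vp (Free vp \<cdot> lam va (lam vt M))"

text \<open>The oracle X is not asked here: observers of the tail are turned into observers of the
  whole list.\<close>

definition tail :: "trm \<Rightarrow> trm" where
  "tail X = lam vr (lam vP (X \<cdot> Free vr \<cdot> uncons (Free vP \<cdot> Free vt)))"

text \<open>Continuation for the sweeper of the tail: once the answer m from the right is known, the
  new first cell is put in front. The switch turns m into a known index, so that \<open>ro\<close>
  and \<open>out\<close> enter the term only as tables.\<close>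

definition return :: "trm \<Rightarrow> nat \<Rightarrow> nat \<Rightarrow> trm" where
  "return K a l = lam vr (lam vm (lam vt (switch n (\<lambda>m. tst n m (Free vm))
     (\<lambda>m. K \<cdot> Free vr \<cdot> fin n (ro l a m) \<cdot> cons (fin n (out l a m)) (Free vt)))))"

(* A sweeper for lists of length k turns an oracle vo, which can only be asked for boolean
   observations of a list, into an actual list, to which it applies the transducer. The resource
   vr is needed by the oracle; since all its uses in the tests are additive, it can still be
   handed over to the continuation vk. *)
definition ext :: "trm \<Rightarrow> trm" where
  "ext v = lam vr (lam vo (lam vl (lam vk (
     switch n (\<lambda>a. Free vo \<cdot> Free vr \<cdot> uncons (tst n a (Free va)))
       (\<lambda>a. switch n (\<lambda>l. tst n l (Free vl))
         (\<lambda>l. v \<cdot> Free vr \<cdot> tail (Free vo) \<cdot> fin n (lo l a) \<cdot> return (Free vk) a l))))))"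

text \<open>The tuple for the empty list is the constant 0, so the tuple types start from B.\<close>

definition sweeper0 :: trm where
  "sweeper0 = lam vr (lam vo (lam vl (lam vk (Free vk \<cdot> Free vr \<cdot> fin n last \<cdot> Const False))))"

text \<open>The list is already a tuple t: it serves as its own resource, and the oracle applies the
  observer to it. The resource handed back at the end is dropped by \<open>lam vr K\<close>.\<close>

definition run_sweep :: "trm \<Rightarrow> nat \<Rightarrow> trm \<Rightarrow> trm \<Rightarrow> trm" where
  "run_sweep v l t K = v \<cdot> t \<cdot> lam vr (lam vP (Free vP \<cdot> Free vr)) \<cdot> fin n l \<cdot> lam vr K"

text \<open>The resource is q, and the oracle evaluates q at c. The sweep with \<open>idle\<close>
  only copies; its continuation gets q back together with the copy t.\<close>

definition square :: "trm \<Rightarrow> trm" where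
  "square v = lam vq (lam vc (lam vP (v \<cdot> Free vq \<cdot> lam vq (Free vq \<cdot> Free vc) \<cdot> fin n idle \<cdot>
     lam vq (lam vm (lam vt (Free vq \<cdot> Free vt \<cdot> Free vP))))))"

definition single :: "nat \<Rightarrow> trm \<Rightarrow> trm" where
  "single l v = lam vc (lam vP (run_sweep v l (Free vc) (lam vm (lam vt (Free vP \<cdot> Free vt)))))"

definition grow :: "nat \<Rightarrow> trm" where
  "grow a = lam vx (lam vk (Free vx \<cdot> lam vt (lam vv (Free vk \<cdot> cons (fin n a) (Free vt) \<cdot> ext (Free vv)))))"

definition grow0 :: trm where
  "grow0 = lam vk (Free vk \<cdot> Const False \<cdot> sweeper0)"

text \<open>Step of a fold over the input: the bit b chooses the message of a sweep over the list
  delivered by g. The fold inserts the bits from the last to the first.\<close>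

definition load :: "nat \<Rightarrow> nat \<Rightarrow> trm \<Rightarrow> trm" where
  "load l0 l1 v = lam vb (lam vg (lam vP (Free vg \<cdot> lam vt (Cond (Free vb)
     (run_sweep v l0 (Free vt) (lam vm (Free vP))) (run_sweep v l1 (Free vt) (lam vm (Free vP)))))))"

section \<open>Representation of lists and specification of the terms\<close>

text \<open>Any closed term represents the empty list, for \<open>sweeper0\<close> never looks at
  it.\<close>

fun holds :: "nat list \<Rightarrow> trm \<Rightarrow> bool" where
  "holds [] M \<longleftrightarrow> closed_term M"
| "holds (a # t) M \<longleftrightarrow> closed_term M \<and> a < n \<and>
     (\<exists>T. holds t T \<and> (\<forall>k. closed_term k \<longrightarrow> M \<cdot> k \<leadsto> k \<cdot> fin n a \<cdot> T))"

text \<open>A list in continuation passing style. The observer must give the answer b on all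
  representations of t, because t does not determine which of them X hands over.\<close>

definition delivers :: "nat list \<Rightarrow> trm \<Rightarrow> bool" where
  "delivers t X \<longleftrightarrow> closed_term X \<and>
     (\<forall>P b. closed_term P \<longrightarrow> (\<forall>T. holds t T \<longrightarrow> ev (P \<cdot> T) b) \<longrightarrow> ev (X \<cdot> P) b)"

text \<open>Resource and oracle are arbitrary as long as the oracle, given the resource, delivers t;
  this is the semantic side of the polymorphism in the resource. The continuation receives r once
  more.\<close>

definition sweeps :: "nat \<Rightarrow> trm \<Rightarrow> bool" where
  "sweeps k v \<longleftrightarrow> closed_term v \<and> (\<forall>t r X l K b. length t = k \<longrightarrow> set t \<subseteq> {..<n} \<longrightarrow> l < n \<longrightarrow>
     closed_term r \<longrightarrow> delivers t (X \<cdot> r) \<longrightarrow> closed_term K \<longrightarrow>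
     (\<forall>T. holds (snd (sweep l t)) T \<longrightarrow> ev (K \<cdot> r \<cdot> fin n (fst (sweep l t)) \<cdot> T) b) \<longrightarrow>
     ev (v \<cdot> r \<cdot> X \<cdot> fin n l \<cdot> K) b)"

lemma holds_closed: "holds t M \<Longrightarrow> closed_term M"
  by (cases t) auto

lemma holds_bounds: "holds t M \<Longrightarrow> set t \<subseteq> {..<n}"
  by (induction t arbitrary: M) auto

lemma length_sweep [simp]: "length (snd (sweep l t)) = length t"
  by (induction l t rule: sweep.induct) (auto split: prod.splits)

lemma closed_cons [simp]: "closed_term a \<Longrightarrow> closed_term t \<Longrightarrow> closed_term (cons a t)"
  by (simp add: cons_def)

lemma holds_cons: "holds t T \<Longrightarrow> a < n \<Longrightarrow> holds (a # t) (cons (fin n a) T)"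
proof -
  assume T: "holds t T" "a < n"
  then have "closed_term T" by (simp add: holds_closed)
  moreover from this have "cons (fin n a) T \<cdot> k \<leadsto> k \<cdot> fin n a \<cdot> T" for k
    using hexp_beta[of "Free 17 \<cdot> fin n a \<cdot> T" 17 k] by (simp add: cons_def)
  ultimately show ?thesis using T by auto
qed

lemma uncons_simps [simp]:
  "fv (uncons M) = fv M - {va, vt, vp}"
  "is_term M \<Longrightarrow> is_term (uncons M)"
  "closed_term L \<Longrightarrow> x \<notin> {va, vt, vp} \<Longrightarrow> subst x L (uncons M) = uncons (subst x L M)"
  by (auto simp: uncons_def)


lemma closed_uncons [simp]: "is_term M \<Longrightarrow> fv M \<subseteq> {va, vt, vp} \<Longrightarrow> closed_term (uncons M)"
  by (intro closed_termI) auto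

lemma tail_simps [simp]:
  "fv X \<inter> {vr, vP, vt, va, vp} = {} \<Longrightarrow> fv (tail X) = fv X"
  "is_term X \<Longrightarrow> is_term (tail X)"
  "closed_term L \<Longrightarrow> x \<notin> {vr, vP, vt, va, vp} \<Longrightarrow> subst x L (tail X) = tail (subst x L X)"
  "closed_term L \<Longrightarrow> subst vr L (tail X) = tail X"
  by (auto simp: tail_def)

lemma closed_tail [simp]: "closed_term X \<Longrightarrow> closed_term (tail X)"
  by (intro closed_termI) simp_all

lemma return_simps [simp]:
  "fv (return K a l) \<subseteq> fv K"
  "is_term K \<Longrightarrow> is_term (return K a l)"
  "closed_term L \<Longrightarrow> x \<notin> {vr, vm, vt, 17} \<Longrightarrow> subst x L (return K a l) = return (subst x L K) a l"
  "closed_term L \<Longrightarrow> subst vr L (return K a l) = return K a l"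
  by (auto simp: return_def)

lemma ext_simps [simp]:
  "is_term v \<Longrightarrow> is_term (ext v)"
  "closed_term L \<Longrightarrow> x \<notin> {vr, vo, vl, vk, vp, va, vt, vP, vm, 17} \<Longrightarrow> subst x L (ext v) = ext (subst x L v)"
  by (auto simp: ext_def)

lemma fv_ext: "fv (ext v) \<subseteq> fv v"
  unfolding ext_def by (auto dest!: subsetD[OF return_simps(1)])

lemma closed_ext [simp]: "closed_term v \<Longrightarrow> closed_term (ext v)"
  using fv_ext[of v] by (intro closed_termI) simp_all

section \<open>Correctness of the sweepers\<close>

lemma ev_uncons:
  assumes "holds (a # t) T" "is_term M" "fv M \<subseteq> {va, vt}"
    "\<And>T'. holds t T' \<Longrightarrow> ev (subst vt T' (subst va (fin n a) M)) b"
  shows "ev (uncons M \<cdot> T) b"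
proof -
  from assms(1) obtain T' where T': "closed_term T" "holds t T'"
    "\<And>k. closed_term k \<Longrightarrow> T \<cdot> k \<leadsto> k \<cdot> fin n a \<cdot> T'" by auto
  have k: "closed_term (lam va (lam vt M))" using assms by auto
  have "uncons M \<cdot> T \<leadsto> T \<cdot> lam va (lam vt M)"
    using hexp_beta[of "Free vp \<cdot> lam va (lam vt M)" vp T] T'(1) k assms(2)
    unfolding uncons_def by (simp del: closed_term_simps subst_lam)
  also have "\<dots> \<leadsto> lam va (lam vt M) \<cdot> fin n a \<cdot> T'" by (rule T'(3)[OF k])
  also have "\<dots> \<leadsto> subst vt T' (subst va (fin n a) M)"
    by (rule hexp_beta2) (use assms in auto)
  finally show ?thesis using assms(4)[OF T'(2)] by (rule hexp_ev)
qed

lemma delivers_tail: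
  assumes "delivers (a # t) (X \<cdot> r)"
  shows "delivers t (tail X \<cdot> r)"
  unfolding delivers_def
proof (intro conjI allI impI)
  have X: "closed_term X" "closed_term r" using assms by (simp_all add: delivers_def)
  then show "closed_term (tail X \<cdot> r)" by simp
  fix P b
  assume P: "closed_term P" "\<forall>T. holds t T \<longrightarrow> ev (P \<cdot> T) b"
  have "tail X \<cdot> r \<cdot> P \<leadsto> X \<cdot> r \<cdot> uncons (P \<cdot> Free vt)"
    using hexp_beta2[of "X \<cdot> Free vr \<cdot> uncons (Free vP \<cdot> Free vt)" r vr vP P] X P(1) by (simp add: tail_def)
  moreover have "ev (X \<cdot> r \<cdot> uncons (P \<cdot> Free vt)) b"
  proof -
    have "closed_term (uncons (P \<cdot> Free vt))" using P by simp
    moreover have "ev (uncons (P \<cdot> Free vt) \<cdot> T) b" if "holds (a # t) T" for T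
      by (rule ev_uncons[OF that]) (use P in auto)
    ultimately show ?thesis using assms unfolding delivers_def by blast
  qed
  ultimately show "ev (tail X \<cdot> r \<cdot> P) b" by (rule hexp_ev)
qed

lemma sweep_less: "l < n \<Longrightarrow> set t \<subseteq> {..<n} \<Longrightarrow> fst (sweep l t) < n \<and> set (snd (sweep l t)) \<subseteq> {..<n}"
proof (induction t arbitrary: l)
  case (Cons a t)
  then show ?case using lo_less ro_less out_less by (auto simp: Let_def split: prod.splits) (metis fst_conv snd_conv subset_iff lessThan_iff)+
qed (simp add: last_less)

text \<open>The outer guards find the first cell a by asking the oracle, the inner ones identify l.
  The hypothesis then applies to the tail oracle, with \<open>return\<close> as
  continuation.\<close>

lemma sweeps_ext:
  assumes "sweeps k v"
  shows "sweeps (Suc k) (ext v)"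
  unfolding sweeps_def
proof (intro conjI allI impI)
  have v: "closed_term v" using assms by (simp add: sweeps_def)
  then show "closed_term (ext v)" by simp
  fix t r X l K b
  assume t: "length t = Suc k" "set t \<subseteq> {..<n}" and l: "l < n" and r: "closed_term r"
    and X: "delivers t (X \<cdot> r)" and K: "closed_term K"
    and ev: "\<forall>T. holds (snd (sweep l t)) T \<longrightarrow> ev (K \<cdot> r \<cdot> fin n (fst (sweep l t)) \<cdot> T) b"
  obtain a u where u: "t = a # u" using t(1) by (cases t) auto
  have a: "a < n" "length u = k" "set u \<subseteq> {..<n}" using t u by auto
  have cX: "closed_term X" using X by (simp add: delivers_def)
  obtain m u' where m: "sweep (lo l a) u = (m, u')" by fastforce
  have mn: "m < n" "length u' = length u" using sweep_less[OF lo_less[OF l a(1)] a(3)] length_sweep[of "lo l a" u] m by auto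
  have sw: "sweep l t = (ro l a m, out l a m # u')" using u m by simp
  have "ext v \<cdot> r \<cdot> X \<cdot> fin n l \<cdot> K \<leadsto> switch n (\<lambda>a. X \<cdot> r \<cdot> uncons (tst n a (Free va)))
      (\<lambda>a. switch n (\<lambda>l'. tst n l' (fin n l)) (\<lambda>l. v \<cdot> r \<cdot> tail X \<cdot> fin n (lo l a) \<cdot> return K a l))"
    (is "_ \<leadsto> ?M")
    using hexp_beta4[of "switch n (\<lambda>a. Free vo \<cdot> Free vr \<cdot> uncons (tst n a (Free va)))
       (\<lambda>a. switch n (\<lambda>l. tst n l (Free vl))
         (\<lambda>l. v \<cdot> Free vr \<cdot> tail (Free vo) \<cdot> fin n (lo l a) \<cdot> return (Free vk) a l))" r X "fin n l" vr vo vl vk K]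
      v r cX K by (simp add: ext_def)
  moreover have "ev ?M b"
  proof (rule ev_switch[where i = a])
    fix j assume "j < n"
    have "ev (uncons (tst n j (Free va)) \<cdot> T) (a \<noteq> j)" if "holds t T" for T
      by (rule ev_uncons[OF that[unfolded u]]) (use ev_tst[OF a(1)] in auto)
    then show "ev (X \<cdot> r \<cdot> uncons (tst n j (Free va))) (a \<noteq> j)"
      using X unfolding delivers_def by simp
  next
    show "ev (switch n (\<lambda>l'. tst n l' (fin n l)) (\<lambda>l. v \<cdot> r \<cdot> tail X \<cdot> fin n (lo l a) \<cdot> return K a l)) b"
    proof (rule ev_switch[where i = l])
      have cR: "closed_term (return K a l)" using return_simps(1)[of K a l] K by (intro closed_termI) simp_all
      have "ev (return K a l \<cdot> r \<cdot> fin n m \<cdot> T) b" if T: "holds u' T" for T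
      proof -
        have "return K a l \<cdot> r \<cdot> fin n m \<cdot> T \<leadsto> switch n (\<lambda>m'. tst n m' (fin n m))
            (\<lambda>m. K \<cdot> r \<cdot> fin n (ro l a m) \<cdot> cons (fin n (out l a m)) T)" (is "_ \<leadsto> ?N")
          using hexp_beta3[of "switch n (\<lambda>m. tst n m (Free vm))
            (\<lambda>m. K \<cdot> Free vr \<cdot> fin n (ro l a m) \<cdot> cons (fin n (out l a m)) (Free vt))" r "fin n m" vr vm vt T]
            K r holds_closed[OF T] by (simp add: return_def)
        moreover have "ev ?N b"
        proof (rule ev_switch[where i = m])
          show "ev (K \<cdot> r \<cdot> fin n (ro l a m) \<cdot> cons (fin n (out l a m)) T) b"
            using ev sw holds_cons[OF T] out_less[OF l a(1) mn(1)] by simp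
        qed (use mn ev_tst in auto)
        ultimately show ?thesis by (rule hexp_ev)
      qed
      then show "ev (v \<cdot> r \<cdot> tail X \<cdot> fin n (lo l a) \<cdot> return K a l) b"
        using assms delivers_tail[OF X[unfolded u]] a r cR m lo_less[OF l a(1)]
        unfolding sweeps_def by fastforce
    qed (use l ev_tst in auto)
  qed (use a in auto)
  ultimately show "ev (ext v \<cdot> r \<cdot> X \<cdot> fin n l \<cdot> K) b" by (rule hexp_ev)
qed

lemma sweeps_sweeper0: "sweeps 0 sweeper0"
  unfolding sweeps_def
proof (intro conjI allI impI)
  show "closed_term sweeper0" by (auto simp: sweeper0_def)
  fix t r X l K b
  assume "length t = 0" "set t \<subseteq> {..<n}" "l < n" and r: "closed_term r" and X: "delivers t (X \<cdot> r)"
    and K: "closed_term K"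
    and ev: "\<forall>T. holds (snd (sweep l t)) T \<longrightarrow> ev (K \<cdot> r \<cdot> fin n (fst (sweep l t)) \<cdot> T) b"
  then have ev: "ev (K \<cdot> r \<cdot> fin n last \<cdot> Const False) b" by simp
  have "closed_term X" using X by (simp add: delivers_def)
  then have "sweeper0 \<cdot> r \<cdot> X \<cdot> fin n l \<cdot> K \<leadsto> K \<cdot> r \<cdot> fin n last \<cdot> Const False"
    using hexp_beta4[of "Free vk \<cdot> Free vr \<cdot> fin n last \<cdot> Const False" r X "fin n l" vr vo vl vk K] r K
    by (simp add: sweeper0_def)
  then show "ev (sweeper0 \<cdot> r \<cdot> X \<cdot> fin n l \<cdot> K) b" using ev by (rule hexp_ev)
qed

lemma sweepsD:
  assumes "sweeps k v" "length t = k" "set t \<subseteq> {..<n}" "l < n" "closed_term r" "delivers t (X \<cdot> r)"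
    "closed_term K" "\<And>T. holds (snd (sweep l t)) T \<Longrightarrow> ev (K \<cdot> r \<cdot> fin n (fst (sweep l t)) \<cdot> T) b"
  shows "ev (v \<cdot> r \<cdot> X \<cdot> fin n l \<cdot> K) b"
  using assms unfolding sweeps_def by blast

lemma run_sweep_simps [simp]:
  "fv (run_sweep v l t K) = fv v \<union> fv t \<union> (fv K - {vr})"
  "is_term v \<Longrightarrow> is_term t \<Longrightarrow> is_term K \<Longrightarrow> is_term (run_sweep v l t K)"
  "closed_term L \<Longrightarrow> x \<noteq> vr \<Longrightarrow> x \<noteq> vP \<Longrightarrow>
     subst x L (run_sweep v l t K) = run_sweep (subst x L v) l (subst x L t) (subst x L K)"
  by (auto simp: run_sweep_def)

lemma delivers_apply: "holds t T \<Longrightarrow> delivers t (lam vr (lam vP (Free vP \<cdot> Free vr)) \<cdot> T)"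
  unfolding delivers_def
proof (intro conjI allI impI)
  assume T: "holds t T"
  then have cT: "closed_term T" by (rule holds_closed)
  then show "closed_term (lam vr (lam vP (Free vP \<cdot> Free vr)) \<cdot> T)" by auto
  fix P b
  assume P: "closed_term P" "\<forall>T. holds t T \<longrightarrow> ev (P \<cdot> T) b"
  have "lam vr (lam vP (Free vP \<cdot> Free vr)) \<cdot> T \<cdot> P \<leadsto> P \<cdot> T"
    using hexp_beta2[of "Free vP \<cdot> Free vr" T vr vP P] cT P by simp
  then show "ev (lam vr (lam vP (Free vP \<cdot> Free vr)) \<cdot> T \<cdot> P) b" using P T by (blast intro: hexp_ev)
qed

lemma ev_run_sweep:
  assumes "sweeps (length t) v" "holds t T" "l < n" "closed_term K"
    "\<And>T'. holds (snd (sweep l t)) T' \<Longrightarrow> ev (K \<cdot> fin n (fst (sweep l t)) \<cdot> T') b"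
  shows "ev (run_sweep v l T K) b"
proof -
  have "ev (lam vr K \<cdot> T \<cdot> fin n (fst (sweep l t)) \<cdot> T') b" if T': "holds (snd (sweep l t)) T'" for T'
  proof -
    have "lam vr K \<cdot> T \<leadsto> K" using hexp_beta[of K vr T] assms(4) by simp
    then have "lam vr K \<cdot> T \<cdot> fin n (fst (sweep l t)) \<cdot> T' \<leadsto> K \<cdot> fin n (fst (sweep l t)) \<cdot> T'"
      by (intro hexp_app)
    then show ?thesis using assms(5)[OF T'] by (rule hexp_ev)
  qed
  moreover have "closed_term (lam vr K)" using assms(4) by simp
  ultimately show ?thesis
    using assms(1) holds_bounds[OF assms(2)] assms(3) holds_closed[OF assms(2)] delivers_apply[OF assms(2)]
    unfolding sweeps_def run_sweep_def by blast
qed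

section \<open>Step functions and repeated squaring\<close>

text \<open>The result of a step is delivered, whereas its argument has to be a tuple. Composing two
  steps therefore requires delivered lists to be turned into tuples.\<close>

definition computes :: "nat \<Rightarrow> (nat list \<Rightarrow> nat list) \<Rightarrow> trm \<Rightarrow> bool" where
  "computes k f q \<longleftrightarrow> closed_term q \<and>
     (\<forall>t T. length t = k \<longrightarrow> holds t T \<longrightarrow> delivers (f t) (q \<cdot> T))"

lemma delivers_hexp: "closed_term X \<Longrightarrow> X \<leadsto> Y \<Longrightarrow> delivers t Y \<Longrightarrow> delivers t X"
  unfolding delivers_def by (blast intro: hexp_ev hexp_app)

lemma computes_hexp:
  assumes "closed_term q" "q \<leadsto> q'" "computes k f q'"
  shows "computes k f q"
  unfolding computes_def
proof (intro conjI allI impI)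
  fix t T assume T: "length t = k" "holds t T"
  then have "closed_term (q \<cdot> T)" using assms by (simp add: holds_closed)
  moreover have "q \<cdot> T \<leadsto> q' \<cdot> T" using assms(2) by (rule hexp_app)
  ultimately show "delivers (f t) (q \<cdot> T)"
    using assms(3) T unfolding computes_def by (blast intro: delivers_hexp)
qed (rule assms)

lemma computes_single:
  assumes v: "sweeps k v" and l: "l < n"
  shows "computes k (\<lambda>t. snd (sweep l t)) (single l v)"
  unfolding computes_def
proof (intro conjI allI impI)
  have cv: "closed_term v" using v by (simp add: sweeps_def)
  then show c: "closed_term (single l v)" by (auto simp: single_def)
  fix t T assume T: "length t = k" "holds t T"
  then have cT: "closed_term T" by (simp add: holds_closed)
  show "delivers (snd (sweep l t)) (single l v \<cdot> T)"
    unfolding delivers_def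
  proof (intro conjI allI impI)
    show "closed_term (single l v \<cdot> T)" using c cT by simp
    fix P b assume P: "closed_term P" "\<forall>T. holds (snd (sweep l t)) T \<longrightarrow> ev (P \<cdot> T) b"
    have "single l v \<cdot> T \<cdot> P \<leadsto> run_sweep v l T (lam vm (lam vt (P \<cdot> Free vt)))"
      using hexp_beta2[of "run_sweep v l (Free vc) (lam vm (lam vt (Free vP \<cdot> Free vt)))" T vc vP P] cv cT P(1)
      by (simp add: single_def run_sweep_def)
    moreover have "ev (run_sweep v l T (lam vm (lam vt (P \<cdot> Free vt)))) b"
    proof (rule ev_run_sweep[OF v[folded T(1)] T(2) l])
      fix T' assume T': "holds (snd (sweep l t)) T'"
      have "lam vm (lam vt (P \<cdot> Free vt)) \<cdot> fin n (fst (sweep l t)) \<cdot> T' \<leadsto> P \<cdot> T'"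
        using hexp_beta2[of "P \<cdot> Free vt" "fin n (fst (sweep l t))" vm vt T'] P(1) by simp
      then show "ev (lam vm (lam vt (P \<cdot> Free vt)) \<cdot> fin n (fst (sweep l t)) \<cdot> T') b"
        using P T' by (blast intro: hexp_ev)
    qed (use P in simp)
    ultimately show "ev (single l v \<cdot> T \<cdot> P) b" by (rule hexp_ev)
  qed
qed

lemma sweep_idle: "set t \<subseteq> {..<n} \<Longrightarrow> snd (sweep idle t) = t"
  by (induction t) (auto simp: idle split: prod.splits)

lemma computes_square:
  assumes v: "sweeps k v" and q: "computes k f q" and f: "\<And>t. length (f t) = length t"
  shows "computes k (f \<circ> f) (square v \<cdot> q)"
  unfolding computes_def
proof (intro conjI allI impI)
  have cv: "closed_term v" "closed_term q" using v q by (simp_all add: sweeps_def computes_def)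
  then show c: "closed_term (square v \<cdot> q)" by (auto simp: square_def)
  fix t T assume T: "length t = k" "holds t T"
  then have cT: "closed_term T" by (simp add: holds_closed)
  show "delivers ((f \<circ> f) t) (square v \<cdot> q \<cdot> T)"
    unfolding delivers_def
  proof (intro conjI allI impI)
    show "closed_term (square v \<cdot> q \<cdot> T)" using c cT by simp
    fix P b assume P: "closed_term P" "\<forall>T. holds ((f \<circ> f) t) T \<longrightarrow> ev (P \<cdot> T) b"
    let ?O = "lam vq (Free vq \<cdot> T)" and ?K = "lam vq (lam vm (lam vt (Free vq \<cdot> Free vt \<cdot> P)))"
    have "square v \<cdot> q \<cdot> T \<cdot> P \<leadsto> v \<cdot> q \<cdot> ?O \<cdot> fin n idle \<cdot> ?K"
      using hexp_beta3[of "v \<cdot> Free vq \<cdot> lam vq (Free vq \<cdot> Free vc) \<cdot> fin n idle \<cdot>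
         lam vq (lam vm (lam vt (Free vq \<cdot> Free vt \<cdot> Free vP)))" q T vq vc vP P] cv cT P(1)
      by (simp add: square_def)
    moreover have "ev (v \<cdot> q \<cdot> ?O \<cdot> fin n idle \<cdot> ?K) b"
    proof -
      have "?O \<cdot> q \<leadsto> q \<cdot> T" using hexp_beta[of "Free vq \<cdot> T" vq q] cT by simp
      moreover have "delivers (f t) (q \<cdot> T)" using q T by (simp add: computes_def)
      ultimately have O: "delivers (f t) (?O \<cdot> q)" using cv cT by (auto intro: delivers_hexp)
      have "ev (?K \<cdot> q \<cdot> fin n (fst (sweep idle (f t))) \<cdot> T') b" if T': "holds (f t) T'" for T'
      proof -
        have "?K \<cdot> q \<cdot> fin n (fst (sweep idle (f t))) \<cdot> T' \<leadsto> q \<cdot> T' \<cdot> P"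
          using hexp_beta3[of "Free vq \<cdot> Free vt \<cdot> P" q "fin n (fst (sweep idle (f t)))" vq vm vt T'] cv P(1)
          by simp
        moreover have "delivers (f (f t)) (q \<cdot> T')" using q T f T' by (simp add: computes_def)
        ultimately show ?thesis using P unfolding delivers_def by (simp add: hexp_ev)
      qed
      \<comment> \<open>A representation of f t bounds its entries by n, as the sweeper requires. If
        there were none, every observer would satisfy the condition of delivery vacuously, and q at
        T would evaluate to both booleans.\<close>
      moreover have "\<exists>T'. holds (f t) T'"
      proof (rule ccontr)
        assume *: "\<nexists>T'. holds (f t) T'"
        have "ev (q \<cdot> T \<cdot> Const b') b''" for b' b''
          using q T * unfolding computes_def delivers_def by simp
        from ev_deterministic[OF this[of _ True] this[of _ False]] show False by simp
      qed
      then have "set (f t) \<subseteq> {..<n}" using holds_bounds by blast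
      moreover have "closed_term ?K" using P by auto
      ultimately show ?thesis
        using T f by (intro sweepsD[OF v _ _ idle_less cv(2) O]) (simp_all add: sweep_idle)
    qed
    ultimately show "ev (square v \<cdot> q \<cdot> T \<cdot> P) b" by (rule hexp_ev)
  qed
qed

text \<open>The iteration counts squarings: i of them turn f into its 2^i-th power.\<close>

lemma computes_iter_square:
  assumes v: "sweeps k v" and q: "computes k f q" and f: "\<And>t. length (f t) = length t"
  shows "computes k (f ^^ (2 ^ ((length s + c) ^ j))) (iter (enc s) c j (square v) \<cdot> q)"
proof -
  have len: "length ((f ^^ i) t) = length t" for i t
    by (induction i) (auto simp: f)
  have cv: "closed_term v" using v by (simp add: sweeps_def)
  have "computes k (f ^^ (2 ^ (0 + (length s + c) ^ j))) (iter (enc s) c j (square v) \<cdot> q)"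
  proof (rule iter_correct[where R = "\<lambda>i X. computes k (f ^^ (2 ^ i)) X"])
    fix i X assume "computes k (f ^^ (2 ^ i)) X"
    then have "computes k (f ^^ (2 ^ i) \<circ> f ^^ (2 ^ i)) (square v \<cdot> X)"
      using computes_square v len by blast
    then show "computes k (f ^^ (2 ^ Suc i)) (square v \<cdot> X)"
      by (simp add: funpow_add[symmetric] mult_2)
  next
    show "computes k (f ^^ (2 ^ 0)) q" using q by simp
    show "closed_term (square v)" using cv by (auto simp: square_def)
  qed (erule (2) computes_hexp, simp add: computes_def)
  then show ?thesis by simp
qed

section \<open>Supply of a blank tuple with its sweeper\<close>

definition supplies :: "nat \<Rightarrow> nat \<Rightarrow> trm \<Rightarrow> bool" where
  "supplies a k x \<longleftrightarrow> closed_term x \<and> (\<forall>K b. closed_term K \<longrightarrow>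
     (\<forall>T v. holds (replicate k a) T \<longrightarrow> sweeps k v \<longrightarrow> ev (K \<cdot> T \<cdot> v) b) \<longrightarrow> ev (x \<cdot> K) b)"

lemma supplies_hexp: "closed_term x \<Longrightarrow> x \<leadsto> y \<Longrightarrow> supplies a k y \<Longrightarrow> supplies a k x"
  unfolding supplies_def by (blast intro: hexp_ev hexp_app)

lemma supplies_grow0: "supplies a 0 grow0"
  unfolding supplies_def
proof (intro conjI allI impI)
  have c: "closed_term sweeper0" using sweeps_sweeper0 by (simp add: sweeps_def)
  then show "closed_term grow0" by (auto simp: grow0_def)
  fix K b
  assume K: "closed_term K" "\<forall>T v. holds (replicate 0 a) T \<longrightarrow> sweeps 0 v \<longrightarrow> ev (K \<cdot> T \<cdot> v) b"
  have "grow0 \<cdot> K \<leadsto> K \<cdot> Const False \<cdot> sweeper0"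
    using hexp_beta[of "Free vk \<cdot> Const False \<cdot> sweeper0" vk K] c by (simp add: grow0_def)
  moreover have "ev (K \<cdot> Const False \<cdot> sweeper0) b" using K(2) sweeps_sweeper0 by simp
  ultimately show "ev (grow0 \<cdot> K) b" by (rule hexp_ev)
qed

lemma closed_grow: "closed_term (grow a)"
  using fv_ext[of "Free vv"] by (auto simp: grow_def)

lemma subst_ext_var [simp]: "x \<noteq> vv \<Longrightarrow> subst x L (ext (Free vv)) = ext (Free vv)"
  using fv_ext[of "Free vv"] by (intro subst_fresh) auto

lemma supplies_grow:
  assumes x: "supplies a k x" and a: "a < n"
  shows "supplies a (Suc k) (grow a \<cdot> x)"
  unfolding supplies_def
proof (intro conjI allI impI)
  have c: "closed_term x" using x by (simp add: supplies_def)
  then show "closed_term (grow a \<cdot> x)" by (simp add: closed_grow)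
  fix K b
  assume K: "closed_term K" "\<forall>T v. holds (replicate (Suc k) a) T \<longrightarrow> sweeps (Suc k) v \<longrightarrow> ev (K \<cdot> T \<cdot> v) b"
  let ?K = "lam vt (lam vv (K \<cdot> cons (fin n a) (Free vt) \<cdot> ext (Free vv)))"
  have "grow a \<cdot> x \<cdot> K \<leadsto> x \<cdot> ?K"
    using hexp_beta2[of "Free vx \<cdot> lam vt (lam vv (Free vk \<cdot> cons (fin n a) (Free vt) \<cdot> ext (Free vv)))" x vx vk K]
      c K(1) by (simp add: grow_def)
  moreover have "ev (x \<cdot> ?K) b"
  proof -
    have "ev (?K \<cdot> T \<cdot> v) b" if T: "holds (replicate k a) T" and v: "sweeps k v" for T v
    proof -
      have cT: "closed_term T" "closed_term v" using T v by (simp_all add: holds_closed sweeps_def)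
      have "?K \<cdot> T \<cdot> v \<leadsto> K \<cdot> cons (fin n a) T \<cdot> ext v"
        using hexp_beta2[of "K \<cdot> cons (fin n a) (Free vt) \<cdot> ext (Free vv)" T vt vv v] K(1) cT
        by simp
      moreover have "ev (K \<cdot> cons (fin n a) T \<cdot> ext v) b"
        using K(2) holds_cons[OF T a] sweeps_ext[OF v] by simp
      ultimately show ?thesis by (rule hexp_ev)
    qed
    moreover have "closed_term ?K" using K fv_ext[of "Free vv"] by auto
    ultimately show ?thesis using x unfolding supplies_def by blast
  qed
  ultimately show "ev (grow a \<cdot> x \<cdot> K) b" by (rule hexp_ev)
qed

lemma supplies_iter_grow:
  assumes "a < n"
  shows "supplies a ((length s + c) ^ j) (iter (enc s) c j (grow a) \<cdot> grow0)"
proof -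
  have "supplies a (0 + (length s + c) ^ j) (iter (enc s) c j (grow a) \<cdot> grow0)"
  proof (rule iter_correct[where R = "supplies a"])
    show "supplies a (Suc i) (grow a \<cdot> X)" if "supplies a i X" for i X
      using supplies_grow that assms .
    show "supplies a i X" if "closed_term X" "X \<leadsto> Y" "supplies a i Y" for i X Y
      using supplies_hexp that .
    show "closed_term X" if "supplies a i X" for i X
      using that by (simp add: supplies_def)
  qed (rule closed_grow supplies_grow0)+
  then show ?thesis by simp
qed

section \<open>Loading the input\<close>

lemma delivers_load:
  assumes X: "delivers t X" and v: "sweeps (length t) v" and l: "l0 < n" "l1 < n"
  shows "delivers (snd (sweep (if b then l1 else l0) t)) (load l0 l1 v \<cdot> Const b \<cdot> X)"
  unfolding delivers_def
proof (intro conjI allI impI)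
  let ?l = "if b then l1 else l0"
  have c: "closed_term v" "closed_term X" using X v by (simp_all add: sweeps_def delivers_def)
  then show "closed_term (load l0 l1 v \<cdot> Const b \<cdot> X)" by (auto simp: load_def)
  fix P b'
  assume P: "closed_term P" "\<forall>T. holds (snd (sweep ?l t)) T \<longrightarrow> ev (P \<cdot> T) b'"
  let ?R = "\<lambda>l t. run_sweep v l t (lam vm P)"
  let ?K = "lam vt (Cond (Const b) (?R l0 (Free vt)) (?R l1 (Free vt)))"
  have "load l0 l1 v \<cdot> Const b \<cdot> X \<cdot> P \<leadsto> X \<cdot> ?K"
    using hexp_beta3[of "Free vg \<cdot> lam vt (Cond (Free vb)
     (run_sweep v l0 (Free vt) (lam vm (Free vP))) (run_sweep v l1 (Free vt) (lam vm (Free vP))))"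
     "Const b" X vb vg vP P] c P(1) by (simp add: load_def run_sweep_def)
  moreover have "ev (X \<cdot> ?K) b'"
  proof -
    have "ev (?K \<cdot> T) b'" if T: "holds t T" for T
    proof -
      have cT: "closed_term T" using T by (rule holds_closed)
      have "?K \<cdot> T \<leadsto> Cond (Const b) (?R l0 T) (?R l1 T)"
        using hexp_beta[of "Cond (Const b) (?R l0 (Free vt)) (?R l1 (Free vt))" vt T] c P(1) cT by simp
      moreover have "ev (?R ?l T) b'"
      proof (rule ev_run_sweep[OF v T])
        fix T' assume T': "holds (snd (sweep ?l t)) T'"
        have "lam vm P \<cdot> fin n (fst (sweep ?l t)) \<cdot> T' \<leadsto> P \<cdot> T'"
          using hexp_beta[of P vm "fin n (fst (sweep ?l t))"] P(1) by (intro hexp_app) simp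
        then show "ev (lam vm P \<cdot> fin n (fst (sweep ?l t)) \<cdot> T') b'"
          using P T' by (blast intro: hexp_ev)
      qed (use l P in auto)
      then have "ev (Cond (Const b) (?R l0 T) (?R l1 T)) b'"
        by (intro ev_Cond[OF ev.Const]) auto
      ultimately show ?thesis by (rule hexp_ev)
    qed
    moreover have "closed_term ?K" using c P by auto
    ultimately show ?thesis using X unfolding delivers_def by blast
  qed
  ultimately show "ev (load l0 l1 v \<cdot> Const b \<cdot> X \<cdot> P) b'" by (rule hexp_ev)
qed

section \<open>Assembling the decider\<close>

text \<open>The outcome is read off from the message that one more sweep returns at the left end. A
  successful test is 0 and selects the first branch, hence \<open>Const True\<close> comes
  first.\<close>

definition verdict :: "nat \<Rightarrow> nat \<Rightarrow> trm \<Rightarrow> trm" where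
  "verdict wall acc v = lam vt (run_sweep v wall (Free vt)
     (lam vm (lam vt (Cond (tst n acc (Free vm)) (Const True) (Const False)))))"

text \<open>v and s occur several times and will be duplicable assumptions; the tuple t occurs
  once.\<close>

definition body :: "nat \<Rightarrow> nat \<Rightarrow> nat \<Rightarrow> nat \<Rightarrow> nat \<Rightarrow> nat \<Rightarrow> nat \<Rightarrow> trm \<Rightarrow> trm \<Rightarrow> trm \<Rightarrow> trm" where
  "body l0 l1 come wall acc c j v t s =
     s \<cdot> load l0 l1 v \<cdot> lam vP (Free vP \<cdot> t) \<cdot> lam vt (run_sweep v come (Free vt) (lam vm (lam vt
       (iter s c j (square v) \<cdot> single wall v \<cdot> Free vt \<cdot> verdict wall acc v))))"

text \<open>Two counters along the same string: (length s + c)^i tape cells, and 2^((length s +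
  c)^j) sweeps.\<close>

definition decider :: "nat \<Rightarrow> nat \<Rightarrow> nat \<Rightarrow> nat \<Rightarrow> nat \<Rightarrow> nat \<Rightarrow> nat \<Rightarrow> nat \<Rightarrow> nat \<Rightarrow> trm \<Rightarrow> trm" where
  "decider a l0 l1 come wall acc c i j s =
     iter s c i (grow a) \<cdot> grow0 \<cdot> lam vt (lam vv (body l0 l1 come wall acc c j (Free vv) (Free vt) s))"

lemma subst_macros [simp]:
  assumes "closed_term L"
  shows "x \<notin> {vb, vg, vP, vt, vr, vm} \<Longrightarrow> subst x L (load l0 l1 v) = load l0 l1 (subst x L v)"
    "x \<notin> {vq, vc, vP, vm, vt} \<Longrightarrow> subst x L (square v) = square (subst x L v)"
    "x \<notin> {vc, vP, vm, vt, vr} \<Longrightarrow> subst x L (single l v) = single l (subst x L v)"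
    "x \<notin> {vP, vm, vt, vr} \<Longrightarrow> subst x L (verdict wall acc v) = verdict wall acc (subst x L v)"
  using assms by (auto simp: load_def square_def single_def verdict_def)

lemma is_term_macros [simp]:
  assumes "is_term v"
  shows "is_term (load l0 l1 v)" "is_term (square v)" "is_term (single l v)" "is_term (verdict wall acc v)"
  using assms by (auto simp: load_def square_def single_def verdict_def)

lemma fv_macros [simp]:
  assumes "fv v \<inter> {vb, vg, vP, vt, vr, vm, vq, vc} = {}"
  shows "fv (load l0 l1 v) = fv v" "fv (square v) = fv v" "fv (single l v) = fv v" "fv (verdict wall acc v) = fv v"
  using assms by (auto simp: load_def square_def single_def verdict_def)

lemma closed_macros [simp]:
  assumes "closed_term v"
  shows "closed_term (load l0 l1 v)" "closed_term (square v)" "closed_term (single l v)"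
    "closed_term (verdict wall acc v)"
  using assms by (auto intro!: closed_termI)

lemma ev_verdict:
  assumes v: "sweeps (length t) v" and T: "holds t T" and l: "wall < n"
  shows "ev (verdict wall acc v \<cdot> T) (fst (sweep wall t) = acc)"
proof -
  let ?K = "lam vm (lam vt (Cond (tst n acc (Free vm)) (Const True) (Const False)))"
  have c: "closed_term v" "closed_term T" using v T by (simp_all add: sweeps_def holds_closed)
  have "verdict wall acc v \<cdot> T \<leadsto> run_sweep v wall T ?K"
    using hexp_beta[of "run_sweep v wall (Free vt) ?K" vt T] c by (simp add: verdict_def)
  moreover have "ev (run_sweep v wall T ?K) (fst (sweep wall t) = acc)"
  proof (rule ev_run_sweep[OF v T l])
    fix T' assume "holds (snd (sweep wall t)) T'"
    let ?m = "fst (sweep wall t)"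
    have "?K \<cdot> fin n ?m \<cdot> T' \<leadsto> Cond (tst n acc (fin n ?m)) (Const True) (Const False)"
      using hexp_beta2[of "Cond (tst n acc (Free vm)) (Const True) (Const False)" "fin n ?m" vm vt T'] by simp
    moreover have "ev (Cond (tst n acc (fin n ?m)) (Const True) (Const False)) (?m = acc)"
      using ev_tst[of ?m n acc] sweep_less[OF l holds_bounds[OF T]] ev.Const[of "?m = acc"]
      by (intro ev_Cond) auto
    ultimately show "ev (?K \<cdot> fin n ?m \<cdot> T') (?m = acc)" by (rule hexp_ev)
  qed auto
  ultimately show ?thesis by (rule hexp_ev)
qed

definition loaded :: "nat \<Rightarrow> nat \<Rightarrow> bool list \<Rightarrow> nat list \<Rightarrow> nat list" where
  "loaded l0 l1 s t = foldr (\<lambda>b t. snd (sweep (if b then l1 else l0) t)) s t"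

lemma length_loaded [simp]: "length (loaded l0 l1 s t) = length t"
  by (induction s) (auto simp: loaded_def)

lemma ev_body:
  fixes s :: "bool list" and c j :: nat
  assumes v: "sweeps (length t) v" and T: "holds t T" and l: "l0 < n" "l1 < n" "come < n" "wall < n"
  defines "u \<equiv> ((\<lambda>t. snd (sweep wall t)) ^^ (2 ^ ((length s + c) ^ j))) (snd (sweep come (loaded l0 l1 s t)))"
  shows "ev (body l0 l1 come wall acc c j v T (enc s)) (fst (sweep wall u) = acc)"
proof -
  let ?b = "fst (sweep wall u) = acc"
  have c: "closed_term v" "closed_term T" using v T by (simp_all add: sweeps_def holds_closed)
  let ?Q = "iter (enc s) c j (square v) \<cdot> single wall v"
  let ?V = "verdict wall acc v"
  let ?M = "run_sweep v come (Free vt) (lam vm (lam vt (?Q \<cdot> Free vt \<cdot> ?V)))"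
  have cQ: "closed_term ?Q" using c(1) by simp
  have cV: "closed_term ?V" using c(1) by simp
  have fold: "delivers (loaded l0 l1 s t) (foldr (\<lambda>b M. load l0 l1 v \<cdot> Const b \<cdot> M) s (lam vP (Free vP \<cdot> T)))"
  proof (induction s)
    case Nil
    have "lam vP (Free vP \<cdot> T) \<cdot> P \<leadsto> P \<cdot> T" if "closed_term P" for P
      using hexp_beta[of "Free vP \<cdot> T" vP P] c by simp
    then have "ev (lam vP (Free vP \<cdot> T) \<cdot> P) b" if "closed_term P" "ev (P \<cdot> T) b" for P b
      using that by (blast intro: hexp_ev)
    moreover have "closed_term (lam vP (Free vP \<cdot> T))" using c by simp
    ultimately show ?case using T by (auto simp: loaded_def delivers_def)
  next
    case (Cons b s)
    have "sweeps (length (loaded l0 l1 s t)) v" using v by simp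
    from delivers_load[OF Cons this l(1,2), of b] show ?case by (simp add: loaded_def)
  qed
  have enc: "enc s \<cdot> load l0 l1 v \<cdot> lam vP (Free vP \<cdot> T) \<leadsto>
      foldr (\<lambda>b M. load l0 l1 v \<cdot> Const b \<cdot> M) s (lam vP (Free vP \<cdot> T))"
    by (rule enc_fold) (use c in auto)
  have "delivers (loaded l0 l1 s t) (enc s \<cdot> load l0 l1 v \<cdot> lam vP (Free vP \<cdot> T))"
    by (rule delivers_hexp[OF _ enc fold]) (use c in simp)
  moreover have "ev (lam vt ?M \<cdot> T') ?b" if T': "holds (loaded l0 l1 s t) T'" for T'
  proof -
    have "lam vt ?M \<cdot> T' \<leadsto> run_sweep v come T' (lam vm (lam vt (?Q \<cdot> Free vt \<cdot> ?V)))"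
      using hexp_beta[of ?M vt T'] c cQ cV holds_closed[OF T'] by simp
    moreover have "ev (run_sweep v come T' (lam vm (lam vt (?Q \<cdot> Free vt \<cdot> ?V)))) ?b"
    proof (rule ev_run_sweep[OF _ T' l(3)])
      show "sweeps (length (loaded l0 l1 s t)) v" using v by simp
      show "closed_term (lam vm (lam vt (?Q \<cdot> Free vt \<cdot> ?V)))" using cQ cV by auto
      let ?t = "snd (sweep come (loaded l0 l1 s t))"
      fix T'' assume T'': "holds ?t T''"
      have "lam vm (lam vt (?Q \<cdot> Free vt \<cdot> ?V)) \<cdot> fin n (fst (sweep come (loaded l0 l1 s t))) \<cdot> T'' \<leadsto> ?Q \<cdot> T'' \<cdot> ?V"
        using hexp_beta2[of "?Q \<cdot> Free vt \<cdot> ?V" "fin n (fst (sweep come (loaded l0 l1 s t)))" vm vt T''] c cQ cV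
        by simp
      moreover have "ev (?Q \<cdot> T'' \<cdot> ?V) ?b"
      proof -
        have "delivers u (?Q \<cdot> T'')"
          using computes_iter_square[OF v computes_single[OF v l(4)], of s c j] T''
          unfolding computes_def u_def by simp
        moreover have "length u = length t"
        proof -
          have "length (((\<lambda>t. snd (sweep wall t)) ^^ i) t') = length t'" for i t'
            by (induction i) auto
          then show ?thesis by (simp add: u_def)
        qed
        ultimately show ?thesis using ev_verdict[OF _ _ l(4), of u v] v cV unfolding delivers_def by simp
      qed
      ultimately show "ev (lam vm (lam vt (?Q \<cdot> Free vt \<cdot> ?V)) \<cdot> fin n (fst (sweep come (loaded l0 l1 s t))) \<cdot> T'') ?b"
        by (rule hexp_ev)
    qed
    ultimately show ?thesis by (rule hexp_ev)
  qed
  moreover have "closed_term (lam vt ?M)" using c cQ cV by auto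
  ultimately show ?thesis unfolding body_def delivers_def by blast
qed

lemma is_term_body [simp]:
  "is_term v \<Longrightarrow> is_term t \<Longrightarrow> is_term s \<Longrightarrow> is_term (body l0 l1 come wall acc c j v t s)"
  by (simp add: body_def)

lemma ev_decider:
  fixes s :: "bool list" and c i j :: nat
  assumes l: "a < n" "l0 < n" "l1 < n" "come < n" "wall < n"
  defines "t \<equiv> replicate ((length s + c) ^ i) a"
  defines "u \<equiv> ((\<lambda>t. snd (sweep wall t)) ^^ (2 ^ ((length s + c) ^ j))) (snd (sweep come (loaded l0 l1 s t)))"
  shows "ev (decider a l0 l1 come wall acc c i j (enc s)) (fst (sweep wall u) = acc)"
proof -
  let ?K = "lam vt (lam vv (body l0 l1 come wall acc c j (Free vv) (Free vt) (enc s)))"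
  have "ev (?K \<cdot> T \<cdot> v) (fst (sweep wall u) = acc)" if T: "holds t T" and v: "sweeps (length t) v" for T v
  proof -
    have "closed_term T" "closed_term v" using T v by (simp_all add: holds_closed sweeps_def)
    then have "?K \<cdot> T \<cdot> v \<leadsto> body l0 l1 come wall acc c j v T (enc s)"
      using hexp_beta2[of "body l0 l1 come wall acc c j (Free vv) (Free vt) (enc s)" T vt vv v]
      by (simp add: body_def subst_fresh)
    with ev_body[OF v T l(2-5)] show ?thesis unfolding u_def by (rule hexp_ev[rotated])
  qed
  moreover have "closed_term ?K"
    by (auto simp: body_def fv_iter)
  ultimately show ?thesis
    using supplies_iter_grow[OF l(1), of s c i] unfolding supplies_def decider_def t_def by simp
qed

lemma is_term_decider: "is_term s \<Longrightarrow> is_term (decider a l0 l1 come wall acc c i j s)"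
  using closed_grow[of a] supplies_grow0[of a] by (simp add: decider_def supplies_def)

lemma fv_decider: "fv (decider a l0 l1 come wall acc c i j (Free vs)) \<subseteq> {vs}"
  using closed_grow[of a] supplies_grow0[of a]
  by (auto simp: decider_def supplies_def fv_iter body_def split: if_splits)

lemma subst_decider: "subst vs (enc s) (decider a l0 l1 come wall acc c i j (Free vs)) = decider a l0 l1 come wall acc c i j (enc s)"
  using closed_grow[of a] supplies_grow0[of a] by (simp add: decider_def supplies_def body_def)

end

section \<open>Typing the program\<close>

lemma typed_cong:
  assumes "\<Psi>; \<Gamma> \<tturnstile> M \<Ztypecolon> \<tau>" "\<And>x. x \<in> fv M \<Longrightarrow> \<Gamma>' x = \<Gamma> x"
  shows "\<Psi>; \<Gamma>' \<tturnstile> M \<Ztypecolon> \<tau>"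
proof -
  have "(bangs r \<Psi> ++ \<Gamma>') |` fv M = (bangs r \<Psi> ++ \<Gamma>) |` fv M" for r
    using assms(2) by (auto simp: restrict_map_def map_add_def)
  with assms(1) show ?thesis by (simp only: typed_def)
qed

lemma typed_upd: "\<Psi>; \<Gamma> \<tturnstile> M \<Ztypecolon> \<tau> \<Longrightarrow> x \<notin> fv M \<Longrightarrow> \<Psi>; \<Gamma>(x \<mapsto> \<sigma>) \<tturnstile> M \<Ztypecolon> \<tau>"
  by (erule typed_cong) auto

lemma bang_pow_simps [simp]:
  "lc_ty k ((Bang ^^ r) \<sigma>) = lc_ty k \<sigma>" "ftv_ty ((Bang ^^ r) \<sigma>) = ftv_ty \<sigma>"
  "open_ty k C ((Bang ^^ r) \<sigma>) = (Bang ^^ r) (open_ty k C \<sigma>)"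
  "close_ty k \<alpha> ((Bang ^^ r) \<sigma>) = (Bang ^^ r) (close_ty k \<alpha> \<sigma>)"
  by (induction r) auto

section \<open>Typing finite types, strings and iterations\<close>

primrec finT :: "nat \<Rightarrow> lty" where
  "finT 0 = TBool"
| "finT (Suc n) = Lin TBool \<multimap> finT n"

lemma finT_simps [simp]:
  "lc_lty k (finT n)" "ftv_lty (finT n) = {}" "open_lty k C (finT n) = finT n" "close_lty k \<alpha> (finT n) = finT n"
  by (induction n) auto

lemma typed_ignore:
  "(\<Psi> ++ \<Gamma>) 19 = Some (Lin TBool) \<Longrightarrow> \<Psi>; \<Gamma> \<tturnstile> ignore n (Free 19) \<Ztypecolon> Lin (finT n)"
proof (induction n arbitrary: \<Gamma>)
  case 0
  then show ?case by (simp add: typed_var)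
next
  case (Suc n)
  have "(\<Psi> ++ \<Gamma>(18 \<mapsto> Lin TBool)) 19 = Some (Lin TBool)" using Suc.prems by simp
  from Suc.IH[OF this] have "\<Psi>; \<Gamma>(18 \<mapsto> Lin TBool) \<tturnstile> ignore n (Free 19) \<Ztypecolon> Lin (finT n)" .
  then show ?case by (simp add: typed_lam)
qed

lemma typed_fin: "\<Psi>; \<Gamma> \<tturnstile> fin n i \<Ztypecolon> Lin (finT n)"
proof (induction n arbitrary: \<Gamma> i)
  case 0
  then show ?case by (simp add: typed_const)
next
  case (Suc n)
  have "\<Psi>; \<Gamma> \<tturnstile> lam 19 (ignore n (Free 19)) \<Ztypecolon> Lin (Lin TBool \<multimap> finT n)"
    by (intro typed_lam typed_ignore) simp_all
  moreover have "\<Psi>; \<Gamma> \<tturnstile> lam 18 (fin n j) \<Ztypecolon> Lin (Lin TBool \<multimap> finT n)" for j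
    by (intro typed_lam Suc.IH) simp_all
  ultimately show ?case by (simp split: nat.split)
qed

lemma typed_tst:
  assumes "\<Psi>; \<Gamma> \<tturnstile> M \<Ztypecolon> Lin (finT n)"
  shows "\<Psi>; \<Gamma> \<tturnstile> tst n j M \<Ztypecolon> Lin TBool"
proof -
  have "\<Psi>; \<Gamma> \<tturnstile> M \<Ztypecolon> Lin (finT (length bs)) \<Longrightarrow> \<Psi>; \<Gamma> \<tturnstile> apps M (map Const bs) \<Ztypecolon> Lin TBool" for bs
  proof (induction bs arbitrary: M)
    case (Cons b bs)
    then have "\<Psi>; \<Gamma> \<tturnstile> M \<cdot> Const b \<Ztypecolon> Lin (finT (length bs))"
      by (intro typed_app[OF _ typed_const]) simp_all
    with Cons.IH show ?case by simp
  qed simp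
  from this[of "map (\<lambda>i. i \<noteq> j) [0..<n]"] assms show ?thesis by (simp add: tst_def comp_def)
qed

lemma typed_switch:
  assumes "\<And>i. i < n \<Longrightarrow> \<Psi>; \<Gamma> \<tturnstile> G i \<Ztypecolon> Lin TBool" "\<And>i. i < n \<Longrightarrow> \<Psi>; \<Gamma> \<tturnstile> X i \<Ztypecolon> Lin TBool"
  shows "\<Psi>; \<Gamma> \<tturnstile> switch n G X \<Ztypecolon> Lin TBool"
proof -
  have "set is \<subseteq> {..<n} \<Longrightarrow> \<Psi>; \<Gamma> \<tturnstile> foldr (\<lambda>i M. Cond (G i) (X i) M) is (Const False) \<Ztypecolon> Lin TBool" for "is"
    by (induction "is") (auto intro!: typed_cond typed_const assms)
  from this[of "[0..<n]"] show ?thesis unfolding switch_def by (simp add: subset_iff)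
qed

text \<open>For r = 1 this is the type S of strings; the further bangs take up the number that
  \<open>typed\<close> leaves open.\<close>

definition stringT :: "nat \<Rightarrow> lty" where
  "stringT r = TAll ((Bang ^^ r) (Lin (Lin TBool \<multimap> Lin (TBound 0) \<multimap> TBound 0)) \<multimap> Lin (TBound 0) \<multimap> TBound 0)"

lemma typed_stringE:
  assumes "\<Psi>; \<Gamma> \<tturnstile> M \<Ztypecolon> Lin (stringT r)" "wf_lty A"
  shows "\<Psi>; \<Gamma> \<tturnstile> M \<Ztypecolon> Lin ((Bang ^^ r) (Lin (Lin TBool \<multimap> Lin A \<multimap> A)) \<multimap> Lin A \<multimap> A)"
  using typed_allE[OF assms(1)[unfolded stringT_def] assms(2)] by simp

text \<open>The step function is used once per bit and so has to be duplicable, while the end of the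
  string stays linear. The number r may depend on s.\<close>

lemma typed_enc: "\<exists>r. Map.empty; Map.empty \<tturnstile> enc s \<Ztypecolon> Lin (stringT r)"
proof -
  let ?A = "TFree 0"
  let ?c = "Lin (Lin TBool \<multimap> Lin ?A \<multimap> ?A)"
  let ?B = "\<lambda>s. foldr (\<lambda>b M. Free 22 \<cdot> Const b \<cdot> M) s (Free 23)"
  have fv: "fv (?B s) \<subseteq> {22, 23}" for s by (induction s) auto
  have "[22 \<mapsto> ?c]; [23 \<mapsto> Lin ?A] \<tturnstile> ?B s \<Ztypecolon> Lin ?A"
  proof (induction s)
    case Nil
    show ?case by (simp add: typed_var)
  next
    case (Cons b s)
    have "[22 \<mapsto> ?c]; [23 \<mapsto> Lin ?A] \<tturnstile> Free 22 \<cdot> Const b \<Ztypecolon> Lin (Lin ?A \<multimap> ?A)"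
      by (rule typed_app[OF typed_var typed_const]) simp_all
    moreover have "fv (Free 22 \<cdot> Const b) \<inter> fv (?B s) \<inter> dom [23 \<mapsto> Lin ?A] = {}" by simp
    ultimately have "[22 \<mapsto> ?c]; [23 \<mapsto> Lin ?A] \<tturnstile> Free 22 \<cdot> Const b \<cdot> ?B s \<Ztypecolon> Lin ?A"
      using Cons by (rule_tac typed_app)
    then show ?case by (simp only: foldr.simps comp_apply)
  qed
  then have "[22 \<mapsto> ?c]; Map.empty \<tturnstile> lam 23 (?B s) \<Ztypecolon> Lin (Lin ?A \<multimap> ?A)"
    by (intro typed_lam) simp_all
  then have "\<exists>r. Map.empty; Map.empty \<tturnstile> lam 22 (lam 23 (?B s)) \<Ztypecolon> Lin ((Bang ^^ r) ?c \<multimap> Lin ?A \<multimap> ?A)"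
    by (intro typed_lam_dup) simp_all
  then obtain r where "Map.empty; Map.empty \<tturnstile> lam 22 (lam 23 (?B s)) \<Ztypecolon> Lin ((Bang ^^ r) ?c \<multimap> Lin ?A \<multimap> ?A)" ..
  then have "Map.empty; Map.empty \<tturnstile> lam 22 (lam 23 (?B s)) \<Ztypecolon> Lin (tall 0 ((Bang ^^ r) ?c \<multimap> Lin ?A \<multimap> ?A))"
    by (rule typed_allI) simp
  moreover have "close_trm 1 22 (close_trm 0 23 (?B s)) = foldr (\<lambda>b M. Bound 1 \<cdot> Const b \<cdot> M) s (Bound 0)"
    by (induction s) auto
  then have "lam 22 (lam 23 (?B s)) = enc s" by (simp add: lam_def enc_def)
  ultimately have "Map.empty; Map.empty \<tturnstile> enc s \<Ztypecolon> Lin (stringT r)"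
    by (simp add: tall_def stringT_def)
  then show ?thesis ..
qed

lemma fv_iter_subset: "fv (iter s c j G) \<subseteq> fv s \<union> fv G"
  by (induction j) (auto simp: fv_app_funpow split: if_splits)

text \<open>A level is promoted to serve as the step of the string and is also applied directly, so
  its free variables must all be duplicable. The type A is the same at every level.\<close>

lemma typed_iter:
  assumes s: "\<Psi>; \<Gamma> \<tturnstile> s \<Ztypecolon> Lin (stringT r)" and G: "\<Psi>; \<Gamma> \<tturnstile> G \<Ztypecolon> Lin (Lin A \<multimap> A)" and A: "wf_lty A"
    and fv: "(fv s \<union> fv G) \<inter> (dom \<Gamma> \<union> {14, 15}) = {}"
  shows "\<Psi>; \<Gamma> \<tturnstile> iter s c j G \<Ztypecolon> Lin (Lin A \<multimap> A)"
proof (induction j)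
  case 0
  then show ?case using G by simp
next
  case (Suc j)
  let ?I = "iter s c j G" and ?\<Gamma> = "\<Gamma>(14 \<mapsto> Lin A)"
  have fvI: "fv ?I \<inter> (dom \<Gamma> \<union> {14, 15}) = {}" using fv fv_iter_subset[of s c j G] by blast
  have I: "\<Psi>; ?\<Gamma> \<tturnstile> ?I \<Ztypecolon> Lin (Lin A \<multimap> A)" using Suc fvI by (intro typed_upd) auto
  have "\<Psi>; ?\<Gamma> \<tturnstile> lam 15 ?I \<Ztypecolon> (Bang ^^ r) (Lin (Lin TBool \<multimap> Lin A \<multimap> A))"
    using Suc fvI by (intro typed_box typed_lam typed_upd) auto
  moreover have "\<Psi>; ?\<Gamma> \<tturnstile> s \<Ztypecolon> Lin ((Bang ^^ r) (Lin (Lin TBool \<multimap> Lin A \<multimap> A)) \<multimap> Lin A \<multimap> A)"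
    using s A fv by (intro typed_stringE typed_upd) auto
  ultimately have "\<Psi>; ?\<Gamma> \<tturnstile> s \<cdot> lam 15 ?I \<Ztypecolon> Lin (Lin A \<multimap> A)"
    using fv by (rule_tac typed_app) auto
  moreover have "\<Psi>; ?\<Gamma> \<tturnstile> ((\<lambda>M. ?I \<cdot> M) ^^ k) (Free 14) \<Ztypecolon> Lin A" for k
  proof (induction k)
    case 0
    show ?case using A by (simp add: typed_var)
  next
    case (Suc k)
    have "fv ?I \<inter> fv (((\<lambda>M. ?I \<cdot> M) ^^ k) (Free 14)) \<inter> dom ?\<Gamma> = {}" using fvI by auto
    from typed_app[OF I Suc this] show ?case by (simp only: funpow.simps comp_apply)
  qed
  ultimately have "\<Psi>; ?\<Gamma> \<tturnstile> s \<cdot> lam 15 ?I \<cdot> ((\<lambda>M. ?I \<cdot> M) ^^ c) (Free 14) \<Ztypecolon> Lin A"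
    using fv fvI by (rule_tac typed_app) auto
  then show ?case using A by (simp add: typed_lam)
qed

context transducer
begin

section \<open>Types of sweepers and supplies\<close>

abbreviation "F \<equiv> finT n"

text \<open>The impredicative product of F and \<beta>, with the answer type fixed to B.\<close>

definition pairT :: "lty \<Rightarrow> lty" where
  "pairT \<beta> = Lin (Lin F \<multimap> Lin \<beta> \<multimap> TBool) \<multimap> TBool"

abbreviation obsT :: "lty \<Rightarrow> lty \<Rightarrow> lty" where
  "obsT \<rho> \<beta> \<equiv> Lin \<rho> \<multimap> Lin (Lin \<beta> \<multimap> TBool) \<multimap> TBool"

abbreviation sweeperT :: "lty \<Rightarrow> lty \<Rightarrow> lty" where
  "sweeperT \<rho> \<beta> \<equiv> Lin \<rho> \<multimap> Lin (obsT \<rho> \<beta>) \<multimap> Lin F \<multimap> Lin (Lin \<rho> \<multimap> Lin F \<multimap> Lin \<beta> \<multimap> TBool) \<multimap> TBool"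

definition V :: "lty \<Rightarrow> lty" where
  "V \<beta> = TAll (sweeperT (TBound 0) \<beta>)"

text \<open>Continuation form of the existential type: some \<beta>, a tuple of type \<beta>, and a
  sweeper of type V \<beta> under r bangs. The index in \<open>V (TBound 1)\<close> skips the
  quantifier inside V.\<close>

definition supplyT :: "nat \<Rightarrow> lty" where
  "supplyT r = Lin (TAll (Lin (TBound 0) \<multimap> (Bang ^^ r) (Lin (V (TBound 1))) \<multimap> TBool)) \<multimap> TBool"

lemma pairT_simps [simp]:
  "lc_lty k (pairT \<beta>) = lc_lty k \<beta>" "ftv_lty (pairT \<beta>) = ftv_lty \<beta>"
  "open_lty k C (pairT \<beta>) = pairT (open_lty k C \<beta>)" "close_lty k \<alpha> (pairT \<beta>) = pairT (close_lty k \<alpha> \<beta>)"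
  by (auto simp: pairT_def)

lemma V_simps [simp]:
  "lc_lty k (V \<beta>) = lc_lty (Suc k) \<beta>" "ftv_lty (V \<beta>) = ftv_lty \<beta>"
  "open_lty k C (V \<beta>) = V (open_lty (Suc k) C \<beta>)" "close_lty k \<alpha> (V \<beta>) = V (close_lty (Suc k) \<alpha> \<beta>)"
  by (auto simp: V_def)

lemma wf_supplyT [simp]: "wf_lty (supplyT r)"
  by (simp add: supplyT_def)

lemma typed_VE:
  assumes "\<Psi>; \<Gamma> \<tturnstile> M \<Ztypecolon> Lin (V \<beta>)" "wf_lty \<beta>" "wf_lty \<rho>"
  shows "\<Psi>; \<Gamma> \<tturnstile> M \<Ztypecolon> Lin (sweeperT \<rho> \<beta>)"
  using typed_allE[OF assms(1)[unfolded V_def] assms(3)] assms(2) by (simp add: open_lty_lc[of 0])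

lemma typed_VI:
  assumes "\<Psi>; \<Gamma> \<tturnstile> M \<Ztypecolon> Lin (sweeperT (TFree \<alpha>) \<beta>)" "\<alpha> \<notin> ftv_lty \<beta>"
    "\<And>x \<sigma>. x \<in> fv M \<Longrightarrow> (\<Psi> ++ \<Gamma>) x = Some \<sigma> \<Longrightarrow> \<alpha> \<notin> ftv_ty \<sigma>"
  shows "\<Psi>; \<Gamma> \<tturnstile> M \<Ztypecolon> Lin (V \<beta>)"
  using typed_allI[OF assms(1,3)] assms(2) by (simp add: V_def tall_def close_lty_fresh)

lemma typed_app_vars:
  assumes "(\<Psi> ++ \<Gamma>) x = Some (Lin (Lin A \<multimap> B))" "(\<Psi> ++ \<Gamma>) y = Some (Lin A)" "wf_lty A" "wf_lty B" "x \<noteq> y"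
  shows "\<Psi>; \<Gamma> \<tturnstile> Free x \<cdot> Free y \<Ztypecolon> Lin B"
  by (rule typed_app[OF typed_var[OF assms(1)] typed_var[OF assms(2)]]) (use assms in auto)

lemma typed_uncons:
  assumes "\<Psi>; \<Gamma>(vp \<mapsto> Lin (pairT \<beta>), va \<mapsto> Lin F, vt \<mapsto> Lin \<beta>) \<tturnstile> M \<Ztypecolon> Lin TBool" "wf_lty \<beta>" "vp \<notin> fv M"
  shows "\<Psi>; \<Gamma> \<tturnstile> uncons M \<Ztypecolon> Lin (Lin (pairT \<beta>) \<multimap> TBool)"
proof -
  let ?\<Gamma> = "\<Gamma>(vp \<mapsto> Lin (pairT \<beta>))"
  have "\<Psi>; ?\<Gamma> \<tturnstile> lam va (lam vt M) \<Ztypecolon> Lin (Lin F \<multimap> Lin \<beta> \<multimap> TBool)"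
    using assms by (intro typed_lam) auto
  moreover have "\<Psi>; ?\<Gamma> \<tturnstile> Free vp \<Ztypecolon> Lin (Lin (Lin F \<multimap> Lin \<beta> \<multimap> TBool) \<multimap> TBool)"
    using assms by (intro typed_var) (auto simp: pairT_def)
  ultimately have "\<Psi>; ?\<Gamma> \<tturnstile> Free vp \<cdot> lam va (lam vt M) \<Ztypecolon> Lin TBool"
    using assms(3) by (rule_tac typed_app) auto
  then show ?thesis unfolding uncons_def using assms by (intro typed_lam) auto
qed

lemma typed_cons:
  assumes "\<Psi>; \<Gamma> \<tturnstile> a \<Ztypecolon> Lin F" "\<Psi>; \<Gamma> \<tturnstile> t \<Ztypecolon> Lin \<beta>" "17 \<notin> fv a \<union> fv t" "fv a \<inter> fv t \<inter> dom \<Gamma> = {}"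
    "wf_lty \<beta>"
  shows "\<Psi>; \<Gamma> \<tturnstile> cons a t \<Ztypecolon> Lin (pairT \<beta>)"
proof -
  let ?\<Gamma> = "\<Gamma>(17 \<mapsto> Lin (Lin F \<multimap> Lin \<beta> \<multimap> TBool))"
  have a: "\<Psi>; ?\<Gamma> \<tturnstile> a \<Ztypecolon> Lin F" and t: "\<Psi>; ?\<Gamma> \<tturnstile> t \<Ztypecolon> Lin \<beta>" using assms by (auto intro: typed_upd)
  have "\<Psi>; ?\<Gamma> \<tturnstile> Free 17 \<Ztypecolon> Lin (Lin F \<multimap> Lin \<beta> \<multimap> TBool)" using assms by (intro typed_var) auto
  from typed_app[OF this a] have "\<Psi>; ?\<Gamma> \<tturnstile> Free 17 \<cdot> a \<Ztypecolon> Lin (Lin \<beta> \<multimap> TBool)" using assms by auto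
  from typed_app[OF this t] have "\<Psi>; ?\<Gamma> \<tturnstile> Free 17 \<cdot> a \<cdot> t \<Ztypecolon> Lin TBool" using assms by auto
  then show ?thesis unfolding cons_def pairT_def using assms by (intro typed_lam) auto
qed

text \<open>The sweeper, the oracle, the resource and the continuation occur once in each branch,
  and guards share their context with the branches, so all four can be linear. No duplicable
  assumption is present, as \<open>typed_box_var\<close> demands.\<close>

lemma typed_ext:
  assumes \<beta>: "wf_lty \<beta>" and \<alpha>: "\<alpha> \<notin> ftv_lty \<beta>"
  shows "Map.empty; [vv \<mapsto> Lin (V \<beta>)] \<tturnstile> ext (Free vv) \<Ztypecolon> Lin (V (pairT \<beta>))"
proof (rule typed_VI)
  let ?\<rho> = "TFree \<alpha>" and ?P = "pairT \<beta>"
  let ?K = "Lin ?\<rho> \<multimap> Lin F \<multimap> Lin ?P \<multimap> TBool"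
  define \<Gamma> where "\<Gamma> = [vv \<mapsto> Lin (V \<beta>), vr \<mapsto> Lin ?\<rho>, vo \<mapsto> Lin (obsT ?\<rho> ?P), vl \<mapsto> Lin F, vk \<mapsto> Lin ?K]"
  have var: "Map.empty; \<Gamma>' \<tturnstile> Free x \<Ztypecolon> Lin A" if "\<Gamma>' x = Some (Lin A)" "wf_lty A" for \<Gamma>' x A
    using that by (intro typed_var) simp_all
  have ask: "Map.empty; \<Gamma>' \<tturnstile> Free vo \<cdot> Free vr \<cdot> uncons M \<Ztypecolon> Lin TBool"
    if "\<Gamma>' vo = Some (Lin (obsT ?\<rho> ?P))" "\<Gamma>' vr = Some (Lin ?\<rho>)" "vo \<notin> fv M" "vr \<notin> fv M" "vp \<notin> fv M"
      "Map.empty; \<Gamma>'(vp \<mapsto> Lin (pairT \<beta>), va \<mapsto> Lin F, vt \<mapsto> Lin \<beta>) \<tturnstile> M \<Ztypecolon> Lin TBool" for \<Gamma>' M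
  proof -
    have "Map.empty; \<Gamma>' \<tturnstile> Free vo \<cdot> Free vr \<Ztypecolon> Lin (Lin (Lin ?P \<multimap> TBool) \<multimap> TBool)"
      by (rule typed_app_vars[where A = ?\<rho>]) (use that \<beta> in auto)
    moreover have "Map.empty; \<Gamma>' \<tturnstile> uncons M \<Ztypecolon> Lin (Lin ?P \<multimap> TBool)"
      using that \<beta> by (intro typed_uncons)
    ultimately show ?thesis by (rule typed_app) (use that in auto)
  qed
  have tail: "Map.empty; \<Gamma> \<tturnstile> tail (Free vo) \<Ztypecolon> Lin (obsT ?\<rho> \<beta>)"
    unfolding tail_def
  proof (intro typed_lam ask)
    show "Map.empty; \<Gamma>(vr \<mapsto> Lin ?\<rho>, vP \<mapsto> Lin (Lin \<beta> \<multimap> TBool), vp \<mapsto> Lin ?P, va \<mapsto> Lin F, vt \<mapsto> Lin \<beta>) \<tturnstile>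
        Free vP \<cdot> Free vt \<Ztypecolon> Lin TBool"
      by (rule typed_app_vars[where A = \<beta>]) (use \<beta> in auto)
  qed (use \<beta> in \<open>auto simp: \<Gamma>_def\<close>)
  have return: "Map.empty; \<Gamma> \<tturnstile> return (Free vk) a l \<Ztypecolon> Lin (Lin ?\<rho> \<multimap> Lin F \<multimap> Lin \<beta> \<multimap> TBool)" for a l
    unfolding return_def
  proof (intro typed_lam typed_switch typed_tst)
    fix m
    let ?\<Gamma> = "\<Gamma>(vr \<mapsto> Lin ?\<rho>, vm \<mapsto> Lin F, vt \<mapsto> Lin \<beta>)"
    show "Map.empty; ?\<Gamma> \<tturnstile> Free vm \<Ztypecolon> Lin F" by (rule var) auto
    have "Map.empty; ?\<Gamma> \<tturnstile> Free vk \<cdot> Free vr \<Ztypecolon> Lin (Lin F \<multimap> Lin ?P \<multimap> TBool)"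
      by (rule typed_app_vars[where A = ?\<rho>]) (use \<beta> in \<open>auto simp: \<Gamma>_def\<close>)
    from typed_app[OF this typed_fin]
    have 1: "Map.empty; ?\<Gamma> \<tturnstile> Free vk \<cdot> Free vr \<cdot> fin n (ro l a m) \<Ztypecolon> Lin (Lin ?P \<multimap> TBool)" by simp
    have "Map.empty; ?\<Gamma> \<tturnstile> cons (fin n (out l a m)) (Free vt) \<Ztypecolon> Lin ?P"
      by (rule typed_cons[OF typed_fin var]) (use \<beta> in auto)
    from typed_app[OF 1 this]
    show "Map.empty; ?\<Gamma> \<tturnstile> Free vk \<cdot> Free vr \<cdot> fin n (ro l a m) \<cdot> cons (fin n (out l a m)) (Free vt) \<Ztypecolon> Lin TBool"
      by simp
  qed (use \<beta> in auto)
  have "Map.empty; \<Gamma> \<tturnstile> Free vv \<cdot> Free vr \<cdot> tail (Free vo) \<cdot> fin n (lo l a) \<cdot> return (Free vk) a l \<Ztypecolon> Lin TBool" for l a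
  proof -
    have "Map.empty; \<Gamma> \<tturnstile> Free vv \<Ztypecolon> Lin (sweeperT ?\<rho> \<beta>)"
      by (rule typed_VE[OF var]) (use \<beta> in \<open>auto simp: \<Gamma>_def lc_ty_mono(1)[of 0]\<close>)
    from typed_app[OF this var[of \<Gamma> vr]]
    have "Map.empty; \<Gamma> \<tturnstile> Free vv \<cdot> Free vr \<Ztypecolon> Lin (Lin (obsT ?\<rho> \<beta>) \<multimap> Lin F \<multimap> Lin (Lin ?\<rho> \<multimap> Lin F \<multimap> Lin \<beta> \<multimap> TBool) \<multimap> TBool)"
      by (simp add: \<Gamma>_def)
    from typed_app[OF typed_app[OF this tail] typed_fin]
    have 1: "Map.empty; \<Gamma> \<tturnstile> Free vv \<cdot> Free vr \<cdot> tail (Free vo) \<cdot> fin n (lo l a) \<Ztypecolon>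
        Lin (Lin (Lin ?\<rho> \<multimap> Lin F \<multimap> Lin \<beta> \<multimap> TBool) \<multimap> TBool)"
      by simp
    show ?thesis
      by (rule typed_app[OF 1 return]) (use return_simps(1)[of "Free vk" a l] in auto)
  qed
  moreover have "Map.empty; \<Gamma> \<tturnstile> Free vl \<Ztypecolon> Lin F" by (rule var) (auto simp: \<Gamma>_def)
  ultimately have "Map.empty; \<Gamma> \<tturnstile> switch n (\<lambda>a. Free vo \<cdot> Free vr \<cdot> uncons (tst n a (Free va)))
       (\<lambda>a. switch n (\<lambda>l. tst n l (Free vl))
         (\<lambda>l. Free vv \<cdot> Free vr \<cdot> tail (Free vo) \<cdot> fin n (lo l a) \<cdot> return (Free vk) a l)) \<Ztypecolon> Lin TBool"
    by (intro typed_switch ask typed_tst var) (auto simp: \<Gamma>_def)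
  then show "Map.empty; [vv \<mapsto> Lin (V \<beta>)] \<tturnstile> ext (Free vv) \<Ztypecolon> Lin (sweeperT (TFree \<alpha>) ?P)"
    unfolding ext_def \<Gamma>_def using \<beta> by (intro typed_lam) auto
qed (use \<alpha> in \<open>auto split: if_splits\<close>)

lemma typed_sweeper0: "\<Psi>; \<Gamma> \<tturnstile> sweeper0 \<Ztypecolon> Lin (V TBool)"
proof (rule typed_VI[where \<alpha> = 0])
  let ?\<rho> = "TFree 0"
  let ?K = "Lin ?\<rho> \<multimap> Lin F \<multimap> Lin TBool \<multimap> TBool"
  let ?\<Gamma> = "\<Gamma>(vr \<mapsto> Lin ?\<rho>, vo \<mapsto> Lin (obsT ?\<rho> TBool), vl \<mapsto> Lin F, vk \<mapsto> Lin ?K)"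
  have "\<Psi>; ?\<Gamma> \<tturnstile> Free vk \<cdot> Free vr \<Ztypecolon> Lin (Lin F \<multimap> Lin TBool \<multimap> TBool)"
    by (rule typed_app_vars[where A = ?\<rho>]) auto
  from typed_app[OF typed_app[OF this typed_fin] typed_const]
  have "\<Psi>; ?\<Gamma> \<tturnstile> Free vk \<cdot> Free vr \<cdot> fin n last \<cdot> Const False \<Ztypecolon> Lin TBool" by simp
  then show "\<Psi>; \<Gamma> \<tturnstile> sweeper0 \<Ztypecolon> Lin (sweeperT ?\<rho> TBool)"
    unfolding sweeper0_def by (intro typed_lam) auto
qed (auto simp: sweeper0_def)


text \<open>The resource type of the sweeper is instantiated with the tuple type \<beta>.\<close>

lemma typed_run_sweep:
  assumes v: "\<Psi>; \<Gamma> \<tturnstile> v \<Ztypecolon> Lin (V \<beta>)" and t: "\<Psi>; \<Gamma> \<tturnstile> t \<Ztypecolon> Lin \<beta>"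
    and K: "\<Psi>; \<Gamma> \<tturnstile> K \<Ztypecolon> Lin (Lin F \<multimap> Lin \<beta> \<multimap> TBool)" and \<beta>: "wf_lty \<beta>"
    and fv: "vr \<notin> fv K" "fv v \<inter> dom \<Gamma> = {}" "fv t \<inter> fv K \<inter> dom \<Gamma> = {}"
  shows "\<Psi>; \<Gamma> \<tturnstile> run_sweep v l t K \<Ztypecolon> Lin TBool"
proof -
  have O: "\<Psi>; \<Gamma> \<tturnstile> lam vr (lam vP (Free vP \<cdot> Free vr)) \<Ztypecolon> Lin (obsT \<beta> \<beta>)"
    by (intro typed_lam typed_app_vars[where A = \<beta>]) (use \<beta> in auto)
  have K': "\<Psi>; \<Gamma> \<tturnstile> lam vr K \<Ztypecolon> Lin (Lin \<beta> \<multimap> Lin F \<multimap> Lin \<beta> \<multimap> TBool)"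
    using K fv(1) \<beta> by (intro typed_lam typed_upd) auto
  have "\<Psi>; \<Gamma> \<tturnstile> v \<cdot> t \<Ztypecolon> Lin (Lin (obsT \<beta> \<beta>) \<multimap> Lin F \<multimap> Lin (Lin \<beta> \<multimap> Lin F \<multimap> Lin \<beta> \<multimap> TBool) \<multimap> TBool)"
    by (rule typed_app[OF typed_VE[OF v \<beta> \<beta>] t]) (use fv in auto)
  from typed_app[OF this O] have "\<Psi>; \<Gamma> \<tturnstile> v \<cdot> t \<cdot> lam vr (lam vP (Free vP \<cdot> Free vr)) \<Ztypecolon>
      Lin (Lin F \<multimap> Lin (Lin \<beta> \<multimap> Lin F \<multimap> Lin \<beta> \<multimap> TBool) \<multimap> TBool)"
    by auto
  from typed_app[OF this typed_fin] have
    "\<Psi>; \<Gamma> \<tturnstile> v \<cdot> t \<cdot> lam vr (lam vP (Free vP \<cdot> Free vr)) \<cdot> fin n l \<Ztypecolon> Lin (Lin (Lin \<beta> \<multimap> Lin F \<multimap> Lin \<beta> \<multimap> TBool) \<multimap> TBool)"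
    by simp
  from typed_app[OF this K'] show ?thesis unfolding run_sweep_def using fv by auto
qed

section \<open>Typing the parts that share a duplicable sweeper\<close>

context
  fixes \<Psi> :: ctx and \<beta> :: lty
  assumes v: "\<Psi> vv = Some (Lin (V \<beta>))" and \<beta>: "wf_lty \<beta>"
begin

lemma typed_v: "\<Gamma> vv = None \<Longrightarrow> \<Psi>; \<Gamma> \<tturnstile> Free vv \<Ztypecolon> Lin (V \<beta>)"
  using v \<beta> by (intro typed_var) (auto simp: map_add_def lc_ty_mono(1)[of 0])

lemma typed_single:
  assumes "\<Gamma> vv = None"
  shows "\<Psi>; \<Gamma> \<tturnstile> single l (Free vv) \<Ztypecolon> Lin (obsT \<beta> \<beta>)"
  unfolding single_def
proof (intro typed_lam typed_run_sweep)
  let ?\<Gamma> = "\<Gamma>(vc \<mapsto> Lin \<beta>, vP \<mapsto> Lin (Lin \<beta> \<multimap> TBool))"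
  show "\<Psi>; ?\<Gamma> \<tturnstile> Free vc \<Ztypecolon> Lin \<beta>" by (rule typed_var) (use \<beta> in auto)
  show "\<Psi>; ?\<Gamma>(vm \<mapsto> Lin F, vt \<mapsto> Lin \<beta>) \<tturnstile> Free vP \<cdot> Free vt \<Ztypecolon> Lin TBool"
    by (rule typed_app_vars[where A = \<beta>]) (use \<beta> in auto)
qed (use \<beta> assms in \<open>auto intro!: typed_v\<close>)

text \<open>The resource type is instantiated with \<open>obsT \<beta> \<beta>\<close>, the type of
  q. Argument and result have this same type, as iteration requires.\<close>

lemma typed_square:
  assumes "\<Gamma> vv = None"
  shows "\<Psi>; \<Gamma> \<tturnstile> square (Free vv) \<Ztypecolon> Lin (Lin (obsT \<beta> \<beta>) \<multimap> obsT \<beta> \<beta>)"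
  unfolding square_def
proof (intro typed_lam)
  let ?Q = "obsT \<beta> \<beta>" and ?P = "Lin \<beta> \<multimap> TBool"
  let ?K = "Lin ?Q \<multimap> Lin F \<multimap> Lin \<beta> \<multimap> TBool"
  let ?\<Gamma> = "\<Gamma>(vq \<mapsto> Lin ?Q, vc \<mapsto> Lin \<beta>, vP \<mapsto> Lin ?P)"
  have "\<Psi>; ?\<Gamma> \<tturnstile> Free vv \<Ztypecolon> Lin (V \<beta>)" by (rule typed_v) (use assms in auto)
  moreover have "wf_lty ?Q" using \<beta> by simp
  ultimately have V: "\<Psi>; ?\<Gamma> \<tturnstile> Free vv \<Ztypecolon> Lin (sweeperT ?Q \<beta>)" by (intro typed_VE \<beta>)
  have "\<Psi>; ?\<Gamma> \<tturnstile> Free vq \<Ztypecolon> Lin ?Q" by (rule typed_var) (use \<beta> in auto)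
  from typed_app[OF V this] assms
  have 1: "\<Psi>; ?\<Gamma> \<tturnstile> Free vv \<cdot> Free vq \<Ztypecolon> Lin (Lin (obsT ?Q \<beta>) \<multimap> Lin F \<multimap> Lin ?K \<multimap> TBool)" by simp
  have "\<Psi>; ?\<Gamma> \<tturnstile> lam vq (Free vq \<cdot> Free vc) \<Ztypecolon> Lin (obsT ?Q \<beta>)"
    by (intro typed_lam typed_app_vars[where A = \<beta>]) (use \<beta> in auto)
  from typed_app[OF 1 this] assms
  have "\<Psi>; ?\<Gamma> \<tturnstile> Free vv \<cdot> Free vq \<cdot> lam vq (Free vq \<cdot> Free vc) \<Ztypecolon> Lin (Lin F \<multimap> Lin ?K \<multimap> TBool)" by simp
  from typed_app[OF this typed_fin]
  have 2: "\<Psi>; ?\<Gamma> \<tturnstile> Free vv \<cdot> Free vq \<cdot> lam vq (Free vq \<cdot> Free vc) \<cdot> fin n idle \<Ztypecolon> Lin (Lin ?K \<multimap> TBool)" by simp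
  have "\<Psi>; ?\<Gamma> \<tturnstile> lam vq (lam vm (lam vt (Free vq \<cdot> Free vt \<cdot> Free vP))) \<Ztypecolon> Lin ?K"
  proof (intro typed_lam)
    let ?\<Delta> = "?\<Gamma>(vq \<mapsto> Lin ?Q, vm \<mapsto> Lin F, vt \<mapsto> Lin \<beta>)"
    have "\<Psi>; ?\<Delta> \<tturnstile> Free vq \<cdot> Free vt \<Ztypecolon> Lin (Lin ?P \<multimap> TBool)"
      by (rule typed_app_vars[where A = \<beta>]) (use \<beta> in auto)
    moreover have "\<Psi>; ?\<Delta> \<tturnstile> Free vP \<Ztypecolon> Lin ?P" by (rule typed_var) (use \<beta> in auto)
    ultimately show "\<Psi>; ?\<Delta> \<tturnstile> Free vq \<cdot> Free vt \<cdot> Free vP \<Ztypecolon> Lin TBool" by (rule typed_app) simp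
  qed (use \<beta> in auto)
  then show "\<Psi>; ?\<Gamma> \<tturnstile> Free vv \<cdot> Free vq \<cdot> lam vq (Free vq \<cdot> Free vc) \<cdot> fin n idle \<cdot>
      lam vq (lam vm (lam vt (Free vq \<cdot> Free vt \<cdot> Free vP))) \<Ztypecolon> Lin TBool"
    by (rule typed_app[OF 2]) (use assms in auto)
qed (use \<beta> in auto)

text \<open>G is the type of delivered tuples; the string is later instantiated at G to fold over
  this term.\<close>

lemma typed_load:
  assumes "\<Gamma> vv = None"
  defines "G \<equiv> Lin (Lin \<beta> \<multimap> TBool) \<multimap> TBool"
  shows "\<Psi>; \<Gamma> \<tturnstile> load l0 l1 (Free vv) \<Ztypecolon> Lin (Lin TBool \<multimap> Lin G \<multimap> G)"
proof -
  let ?P = "Lin \<beta> \<multimap> TBool"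
  let ?\<Gamma> = "\<Gamma>(vb \<mapsto> Lin TBool, vg \<mapsto> Lin G, vP \<mapsto> Lin ?P)"
  have R: "\<Psi>; ?\<Gamma>(vt \<mapsto> Lin \<beta>) \<tturnstile> run_sweep (Free vv) l (Free vt) (lam vm (Free vP)) \<Ztypecolon> Lin TBool" for l
  proof (intro typed_run_sweep typed_lam)
    show "\<Psi>; ?\<Gamma>(vt \<mapsto> Lin \<beta>) \<tturnstile> Free vt \<Ztypecolon> Lin \<beta>" by (rule typed_var) (use \<beta> in auto)
    show "\<Psi>; ?\<Gamma>(vt \<mapsto> Lin \<beta>, vm \<mapsto> Lin F) \<tturnstile> Free vP \<Ztypecolon> Lin ?P" by (rule typed_var) (use \<beta> in auto)
  qed (use \<beta> assms in \<open>auto intro!: typed_v\<close>)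
  have "\<Psi>; ?\<Gamma>(vt \<mapsto> Lin \<beta>) \<tturnstile> Free vb \<Ztypecolon> Lin TBool" by (rule typed_var) auto
  then have "\<Psi>; ?\<Gamma> \<tturnstile> lam vt (Cond (Free vb) (run_sweep (Free vv) l0 (Free vt) (lam vm (Free vP)))
      (run_sweep (Free vv) l1 (Free vt) (lam vm (Free vP)))) \<Ztypecolon> Lin ?P" (is "_; _ \<tturnstile> ?M \<Ztypecolon> _")
    using R \<beta> by (intro typed_lam typed_cond) auto
  moreover have "\<Psi>; ?\<Gamma> \<tturnstile> Free vg \<Ztypecolon> Lin (Lin ?P \<multimap> TBool)"
    by (rule typed_var) (use \<beta> in \<open>auto simp: G_def\<close>)
  ultimately have "\<Psi>; ?\<Gamma> \<tturnstile> Free vg \<cdot> ?M \<Ztypecolon> Lin TBool"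
    using assms by (rule_tac typed_app) auto
  then have "\<Psi>; \<Gamma>(vb \<mapsto> Lin TBool, vg \<mapsto> Lin G) \<tturnstile> lam vP (Free vg \<cdot> ?M) \<Ztypecolon> Lin G"
    unfolding G_def using \<beta> by (intro typed_lam) auto
  then show ?thesis
    unfolding load_def using \<beta> by (intro typed_lam) (auto simp: G_def)
qed

lemma typed_verdict:
  assumes "\<Gamma> vv = None"
  shows "\<Psi>; \<Gamma> \<tturnstile> verdict wall acc (Free vv) \<Ztypecolon> Lin (Lin \<beta> \<multimap> TBool)"
  unfolding verdict_def
proof (intro typed_lam typed_run_sweep typed_cond typed_tst typed_const)
  show "\<Psi>; \<Gamma>(vt \<mapsto> Lin \<beta>) \<tturnstile> Free vt \<Ztypecolon> Lin \<beta>" by (rule typed_var) (use \<beta> in auto)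
  show "\<Psi>; \<Gamma>(vt \<mapsto> Lin \<beta>, vm \<mapsto> Lin F, vt \<mapsto> Lin \<beta>) \<tturnstile> Free vm \<Ztypecolon> Lin F" by (rule typed_var) auto
qed (use \<beta> assms in \<open>auto intro!: typed_v\<close>)

lemma typed_body:
  assumes s: "\<Psi> vs = Some (Lin (stringT r))"
  shows "\<Psi>; [vt \<mapsto> Lin \<beta>] \<tturnstile> body l0 l1 come wall acc c j (Free vv) (Free vt) (Free vs) \<Ztypecolon> Lin TBool"
proof -
  let ?P = "Lin \<beta> \<multimap> TBool" and ?\<Gamma> = "[vt \<mapsto> Lin \<beta>]"
  let ?G = "Lin ?P \<multimap> TBool"
  let ?Q = "iter (Free vs) c j (square (Free vv)) \<cdot> single wall (Free vv)"
  let ?R = "lam vm (lam vt (?Q \<cdot> Free vt \<cdot> verdict wall acc (Free vv)))"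
  have s: "\<Psi>; \<Gamma> \<tturnstile> Free vs \<Ztypecolon> Lin (stringT r)" if "\<Gamma> vs = None" for \<Gamma>
    using s that by (intro typed_var) (auto simp: map_add_def stringT_def)
  have "\<Psi>; ?\<Gamma> \<tturnstile> load l0 l1 (Free vv) \<Ztypecolon> (Bang ^^ r) (Lin (Lin TBool \<multimap> Lin ?G \<multimap> ?G))"
    by (rule typed_box[OF typed_load]) auto
  moreover have "\<Psi>; ?\<Gamma> \<tturnstile> Free vs \<Ztypecolon> Lin ((Bang ^^ r) (Lin (Lin TBool \<multimap> Lin ?G \<multimap> ?G)) \<multimap> Lin ?G \<multimap> ?G)"
    by (intro typed_stringE s) (use \<beta> in auto)
  ultimately have 1: "\<Psi>; ?\<Gamma> \<tturnstile> Free vs \<cdot> load l0 l1 (Free vv) \<Ztypecolon> Lin (Lin ?G \<multimap> ?G)"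
    by (rule_tac typed_app) auto
  have "\<Psi>; ?\<Gamma> \<tturnstile> lam vP (Free vP \<cdot> Free vt) \<Ztypecolon> Lin ?G"
    by (intro typed_lam typed_app_vars[where A = \<beta>]) (use \<beta> in auto)
  from typed_app[OF 1 this]
  have 2: "\<Psi>; ?\<Gamma> \<tturnstile> Free vs \<cdot> load l0 l1 (Free vv) \<cdot> lam vP (Free vP \<cdot> Free vt) \<Ztypecolon> Lin ?G" by simp
  have "\<Psi>; \<Gamma> \<tturnstile> iter (Free vs) c j (square (Free vv)) \<Ztypecolon> Lin (Lin (obsT \<beta> \<beta>) \<multimap> obsT \<beta> \<beta>)"
    if "\<Gamma> vs = None" "\<Gamma> vv = None" for \<Gamma>
    using that \<beta> by (intro typed_iter[OF s typed_square]) auto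
  from typed_app[OF this typed_single]
  have Q: "\<Psi>; \<Gamma> \<tturnstile> ?Q \<Ztypecolon> Lin (obsT \<beta> \<beta>)" if "\<Gamma> vs = None" "\<Gamma> vv = None" for \<Gamma>
    using that by auto
  have R: "\<Psi>; ?\<Gamma> \<tturnstile> ?R \<Ztypecolon> Lin (Lin F \<multimap> Lin \<beta> \<multimap> TBool)"
  proof (intro typed_lam)
    let ?\<Delta> = "?\<Gamma>(vm \<mapsto> Lin F, vt \<mapsto> Lin \<beta>)"
    have "\<Psi>; ?\<Delta> \<tturnstile> ?Q \<Ztypecolon> Lin (obsT \<beta> \<beta>)" by (rule Q) auto
    moreover have "\<Psi>; ?\<Delta> \<tturnstile> Free vt \<Ztypecolon> Lin \<beta>" by (rule typed_var) (use \<beta> in auto)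
    ultimately have "\<Psi>; ?\<Delta> \<tturnstile> ?Q \<cdot> Free vt \<Ztypecolon> Lin (Lin ?P \<multimap> TBool)"
      by (rule typed_app) (auto simp: fv_iter)
    then show "\<Psi>; ?\<Delta> \<tturnstile> ?Q \<cdot> Free vt \<cdot> verdict wall acc (Free vv) \<Ztypecolon> Lin TBool"
      by (rule typed_app[OF _ typed_verdict]) auto
  qed (use \<beta> in auto)
  have "\<Psi>; ?\<Gamma> \<tturnstile> lam vt (run_sweep (Free vv) come (Free vt) ?R) \<Ztypecolon> Lin ?P"
  proof (rule typed_lam[rotated], rule typed_run_sweep)
    show "\<Psi>; ?\<Gamma>(vt \<mapsto> Lin \<beta>) \<tturnstile> Free vv \<Ztypecolon> Lin (V \<beta>)" by (rule typed_v) simp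
    show "\<Psi>; ?\<Gamma>(vt \<mapsto> Lin \<beta>) \<tturnstile> ?R \<Ztypecolon> Lin (Lin F \<multimap> Lin \<beta> \<multimap> TBool)" using R by simp
    show "\<Psi>; ?\<Gamma>(vt \<mapsto> Lin \<beta>) \<tturnstile> Free vt \<Ztypecolon> Lin \<beta>" by (rule typed_var) (use \<beta> in auto)
  qed (use \<beta> in \<open>auto simp: fv_iter intro!: typed_v\<close>)
  from typed_app[OF 2 this] show ?thesis unfolding body_def by (auto simp: fv_iter)
qed

end

section \<open>Typing the supply and the decider\<close>

text \<open>The continuation vk accepts tuples of every type and is used at
  \<open>pairT \<beta>\<close>, where \<beta> is the unknown type of the old tuple. Thus the tuple
  type grows while \<open>supplyT r\<close> stays the same.\<close>

lemma typed_grow: "\<Psi>; \<Gamma> \<tturnstile> grow a \<Ztypecolon> Lin (Lin (supplyT r) \<multimap> supplyT r)"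
  unfolding grow_def
proof -
  let ?\<beta> = "TFree 0"
  let ?kT = "TAll (Lin (TBound 0) \<multimap> (Bang ^^ r) (Lin (V (TBound 1))) \<multimap> TBool)"
  let ?\<Gamma> = "\<Gamma>(vx \<mapsto> Lin (supplyT r), vk \<mapsto> Lin ?kT)"
  let ?\<Delta> = "?\<Gamma>(vt \<mapsto> Lin ?\<beta>, vv \<mapsto> (Bang ^^ r) (Lin (V ?\<beta>)))"
  let ?M = "lam vt (lam vv (Free vk \<cdot> cons (fin n a) (Free vt) \<cdot> ext (Free vv)))"
  have "\<Psi>; ?\<Delta> \<tturnstile> Free vk \<Ztypecolon> Lin ?kT" by (rule typed_var) auto
  from typed_allE[OF this, of "pairT ?\<beta>"]
  have k: "\<Psi>; ?\<Delta> \<tturnstile> Free vk \<Ztypecolon> Lin (Lin (pairT ?\<beta>) \<multimap> (Bang ^^ r) (Lin (V (pairT ?\<beta>))) \<multimap> TBool)"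
    by simp
  have "\<Psi>; ?\<Delta> \<tturnstile> cons (fin n a) (Free vt) \<Ztypecolon> Lin (pairT ?\<beta>)"
    by (rule typed_cons[OF typed_fin typed_var]) auto
  from typed_app[OF k this]
  have 1: "\<Psi>; ?\<Delta> \<tturnstile> Free vk \<cdot> cons (fin n a) (Free vt) \<Ztypecolon> Lin ((Bang ^^ r) (Lin (V (pairT ?\<beta>))) \<multimap> TBool)"
    by simp
  \<comment> \<open>The new sweeper has again exactly r bangs, as the type of vk prescribes.\<close>
  have "\<Psi>; ?\<Delta> \<tturnstile> ext (Free vv) \<Ztypecolon> (Bang ^^ r) (Lin (V (pairT ?\<beta>)))"
    by (rule typed_box_var[OF typed_ext[of ?\<beta> 1]]) (use fv_ext[of "Free vv"] in auto)
  moreover have "fv (Free vk \<cdot> cons (fin n a) (Free vt)) \<inter> fv (ext (Free vv)) \<inter> dom ?\<Delta> = {}"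
    using fv_ext[of "Free vv"] by auto
  ultimately have "\<Psi>; ?\<Delta> \<tturnstile> Free vk \<cdot> cons (fin n a) (Free vt) \<cdot> ext (Free vv) \<Ztypecolon> Lin TBool"
    by (rule typed_app[OF 1])
  then have "\<Psi>; ?\<Gamma> \<tturnstile> ?M \<Ztypecolon> Lin (Lin ?\<beta> \<multimap> (Bang ^^ r) (Lin (V ?\<beta>)) \<multimap> TBool)"
    by (intro typed_lam) auto
  then have "\<Psi>; ?\<Gamma> \<tturnstile> ?M \<Ztypecolon> Lin (tall 0 (Lin ?\<beta> \<multimap> (Bang ^^ r) (Lin (V ?\<beta>)) \<multimap> TBool))"
    by (rule typed_allI) (use fv_ext[of "Free vv"] in \<open>auto split: if_splits\<close>)
  then have M: "\<Psi>; ?\<Gamma> \<tturnstile> ?M \<Ztypecolon> Lin ?kT" by (simp add: tall_def)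
  have "\<Psi>; ?\<Gamma> \<tturnstile> Free vx \<Ztypecolon> Lin (Lin ?kT \<multimap> TBool)"
    by (rule typed_var) (auto simp: supplyT_def)
  then have "\<Psi>; ?\<Gamma> \<tturnstile> Free vx \<cdot> ?M \<Ztypecolon> Lin TBool"
    by (rule typed_app[OF _ M]) (use fv_ext[of "Free vv"] in auto)
  then have "\<Psi>; \<Gamma>(vx \<mapsto> Lin (supplyT r)) \<tturnstile> lam vk (Free vx \<cdot> ?M) \<Ztypecolon> Lin (supplyT r)"
    unfolding supplyT_def by (intro typed_lam) auto
  then show "\<Psi>; \<Gamma> \<tturnstile> lam vx (lam vk (Free vx \<cdot> ?M)) \<Ztypecolon> Lin (Lin (supplyT r) \<multimap> supplyT r)"
    by (intro typed_lam) auto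
qed

lemma typed_grow0: "\<Psi>; \<Gamma> \<tturnstile> grow0 \<Ztypecolon> Lin (supplyT r)"
proof -
  let ?kT = "TAll (Lin (TBound 0) \<multimap> (Bang ^^ r) (Lin (V (TBound 1))) \<multimap> TBool)"
  let ?\<Gamma> = "\<Gamma>(vk \<mapsto> Lin ?kT)"
  have c: "fv sweeper0 = {}" by (auto simp: sweeper0_def)
  have "\<Psi>; ?\<Gamma> \<tturnstile> Free vk \<Ztypecolon> Lin ?kT" by (rule typed_var) auto
  from typed_allE[OF this, of TBool]
  have k: "\<Psi>; ?\<Gamma> \<tturnstile> Free vk \<Ztypecolon> Lin (Lin TBool \<multimap> (Bang ^^ r) (Lin (V TBool)) \<multimap> TBool)" by simp
  have "\<Psi>; ?\<Gamma> \<tturnstile> sweeper0 \<Ztypecolon> (Bang ^^ r) (Lin (V TBool))"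
    by (rule typed_box[OF typed_sweeper0]) (simp add: c)
  from typed_app[OF typed_app[OF k typed_const] this]
  have "\<Psi>; ?\<Gamma> \<tturnstile> Free vk \<cdot> Const False \<cdot> sweeper0 \<Ztypecolon> Lin TBool" by (simp add: c)
  then show ?thesis unfolding grow0_def supplyT_def by (intro typed_lam) auto
qed

text \<open>The body uses its sweeper several times, which yields some number r' of bangs; the
  supply is then typed for this r', since \<open>typed_grow\<close> and \<open>typed_grow0\<close>
  hold for any number.\<close>

lemma typed_decider:
  "[vs \<mapsto> Lin (stringT r)]; Map.empty \<tturnstile> decider a l0 l1 come wall acc c i j (Free vs) \<Ztypecolon> Lin TBool"
proof -
  let ?\<beta> = "TFree 0" and ?\<Psi> = "[vs \<mapsto> Lin (stringT r)]"
  let ?M = "body l0 l1 come wall acc c j (Free vv) (Free vt) (Free vs)"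
  have fvM: "fv (lam vt (lam vv ?M)) \<subseteq> {vs}" by (auto simp: body_def fv_iter split: if_splits)
  have "\<exists>r'. ?\<Psi>; [vt \<mapsto> Lin ?\<beta>] \<tturnstile> lam vv ?M \<Ztypecolon> Lin ((Bang ^^ r') (Lin (V ?\<beta>)) \<multimap> TBool)"
    by (intro typed_lam_dup typed_body) auto
  then obtain r' where "?\<Psi>; [vt \<mapsto> Lin ?\<beta>] \<tturnstile> lam vv ?M \<Ztypecolon> Lin ((Bang ^^ r') (Lin (V ?\<beta>)) \<multimap> TBool)" ..
  then have "?\<Psi>; Map.empty \<tturnstile> lam vt (lam vv ?M) \<Ztypecolon> Lin (Lin ?\<beta> \<multimap> (Bang ^^ r') (Lin (V ?\<beta>)) \<multimap> TBool)"
    by (rule typed_lam[rotated]) simp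
  then have "?\<Psi>; Map.empty \<tturnstile> lam vt (lam vv ?M) \<Ztypecolon> Lin (tall 0 (Lin ?\<beta> \<multimap> (Bang ^^ r') (Lin (V ?\<beta>)) \<multimap> TBool))"
    by (rule typed_allI) (use fvM in \<open>auto simp: stringT_def split: if_splits\<close>)
  then have M: "?\<Psi>; Map.empty \<tturnstile> lam vt (lam vv ?M) \<Ztypecolon>
      Lin (TAll (Lin (TBound 0) \<multimap> (Bang ^^ r') (Lin (V (TBound 1))) \<multimap> TBool))"
    by (simp add: tall_def)
  have s: "?\<Psi>; Map.empty \<tturnstile> Free vs \<Ztypecolon> Lin (stringT r)"
    by (rule typed_var) (auto simp: stringT_def)
  have "?\<Psi>; Map.empty \<tturnstile> iter (Free vs) c i (grow a) \<Ztypecolon> Lin (Lin (supplyT r') \<multimap> supplyT r')"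
    by (rule typed_iter[OF s typed_grow]) (use closed_grow[of a] in auto)
  from typed_app[OF this typed_grow0]
  have "?\<Psi>; Map.empty \<tturnstile> iter (Free vs) c i (grow a) \<cdot> grow0 \<Ztypecolon>
      Lin (Lin (TAll (Lin (TBound 0) \<multimap> (Bang ^^ r') (Lin (V (TBound 1))) \<multimap> TBool)) \<multimap> TBool)"
    by (simp add: supplyT_def)
  from typed_app[OF this M] show ?thesis unfolding decider_def by simp
qed

text \<open>Only the derivation varies with s, through the numbers of bangs on the string type and
  on the argument; the decider is the same term for all s.\<close>

lemma program_decider: "program (lam vs (decider a l0 l1 come wall acc c i j (Free vs)) \<cdot> enc s)"
proof -
  let ?D = "decider a l0 l1 come wall acc c i j (Free vs)"
  have closed: "closed_term (lam vs ?D)" by (simp add: is_term_decider fv_decider)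
  obtain r where s: "Map.empty; Map.empty \<tturnstile> enc s \<Ztypecolon> Lin (stringT r)" using typed_enc by blast
  have "\<exists>r'. Map.empty; Map.empty \<tturnstile> lam vs ?D \<Ztypecolon> Lin ((Bang ^^ r') (Lin (stringT r)) \<multimap> TBool)"
    by (intro typed_lam_dup typed_decider) (auto simp: stringT_def)
  then obtain r' where D: "Map.empty; Map.empty \<tturnstile> lam vs ?D \<Ztypecolon> Lin ((Bang ^^ r') (Lin (stringT r)) \<multimap> TBool)" ..
  have "Map.empty; Map.empty \<tturnstile> enc s \<Ztypecolon> (Bang ^^ r') (Lin (stringT r))" by (rule typed_box[OF s]) simp
  with D have "Map.empty; Map.empty \<tturnstile> lam vs ?D \<cdot> enc s \<Ztypecolon> Lin TBool" by (rule typed_app) simp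
  then have "Map.empty \<turnstile> lam vs ?D \<cdot> enc s \<Ztypecolon> Lin TBool"
    by (rule typed_closed) (simp only: fv.simps closed_termD(2)[OF closed] closed_termD(2)[OF closed_enc] Un_absorb)
  then show ?thesis using closed by (simp add: program_def)
qed

end

section \<open>Turing machines as transducers\<close>

(* Cell a h is a tape cell with content a, scanned in state q iff h = Some q. The other symbols are
   messages between neighbouring cells: Wall enters the leftmost cell, Come q announces the
   arrival of the head, Put a shifts the tape, Accepted reports acceptance to the left. *)
datatype symbol = Cell nat "nat option" | Idle | Wall | Silent | Come nat | Put nat | Accepted

definition halted :: "turing_machine \<Rightarrow> nat \<Rightarrow> bool" where
  "halted T q \<longleftrightarrow> q \<in> {accept T, reject T}"

fun tm_lo :: "turing_machine \<Rightarrow> symbol \<Rightarrow> symbol \<Rightarrow> symbol" where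
  "tm_lo T Idle c = Idle"
| "tm_lo T (Put x) (Cell a h) = Put a"
| "tm_lo T l (Cell a (Some q)) = (if halted T q then Silent else
     case trans T q a of (q', b, d) \<Rightarrow> if d = MoveR then Come q' else Silent)"
| "tm_lo T l c = Silent"

text \<open>A head arrives from the left with the message l, or from the right with the answer m. A
  left move at the wall keeps the head in its cell, as in \<open>step\<close>.\<close>

fun tm_out :: "turing_machine \<Rightarrow> symbol \<Rightarrow> symbol \<Rightarrow> symbol \<Rightarrow> symbol" where
  "tm_out T Idle c m = c"
| "tm_out T (Put x) c m = Cell x None"
| "tm_out T l (Cell a (Some q)) m = (if halted T q then Cell a (Some q) else
     case trans T q a of (q', b, d) \<Rightarrow> Cell b (if d = MoveL \<and> l = Wall then Some q' else None))"
| "tm_out T (Come q) (Cell a None) m = Cell a (Some q)"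
| "tm_out T l (Cell a None) (Come q) = Cell a (Some q)"
| "tm_out T l c m = c"

fun tm_ro :: "turing_machine \<Rightarrow> symbol \<Rightarrow> symbol \<Rightarrow> symbol \<Rightarrow> symbol" where
  "tm_ro T l (Cell a (Some q)) m = (if q = accept T then Accepted else if q = reject T then Silent else
     case trans T q a of (q', b, d) \<Rightarrow> if d = MoveL \<and> l \<noteq> Wall then Come q' else Silent)"
| "tm_ro T l c Accepted = Accepted"
| "tm_ro T l c m = Silent"

fun tm_sweep :: "turing_machine \<Rightarrow> symbol \<Rightarrow> symbol list \<Rightarrow> symbol \<times> symbol list" where
  "tm_sweep T l [] = (Silent, [])"
| "tm_sweep T l (c # cs) = (let (m, cs') = tm_sweep T (tm_lo T l c) cs in (tm_ro T l c m, tm_out T l c m # cs'))"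

definition cell :: "config \<Rightarrow> nat \<Rightarrow> symbol" where
  "cell c i = (case c of (q, h, t) \<Rightarrow> Cell (t i) (if i = h then Some q else None))"

definition cells :: "nat \<Rightarrow> nat \<Rightarrow> config \<Rightarrow> symbol list" where
  "cells k m c = map (cell c) [k..<m]"

lemma length_cells [simp]: "length (cells k m c) = m - k"
  by (simp add: cells_def)

section \<open>Sweeps that simulate machine steps\<close>

lemma tm_sweep_silent:
  "tm_sweep T Silent (map (\<lambda>i. Cell (t i) None) is) = (Silent, map (\<lambda>i. Cell (t i) None) is)"
  by (induction "is") auto

lemma tm_sweep_come:
  "k < m \<Longrightarrow> tm_sweep T (Come q) (map (\<lambda>i. Cell (t i) None) [k..<m]) = (Silent, cells k m (q, k, t))"
  by (subst (1 2) upt_conv_Cons | simp add: cells_def cell_def tm_sweep_silent upt_conv_Cons)+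

text \<open>Induction from the head position down to the left end, for the part of the tape that
  starts at cell k: it meets the wall only if k = 0, and it answers \<open>Come q'\<close> when the
  head leaves it to the left. The bound on h' keeps the head from getting lost at the right
  end.\<close>

lemma tm_sweep_step:
  assumes "k \<le> h" "h < m" "step T (q, h, t) = (q', h', t')" "h' < m"
  shows "tm_sweep T (if k = 0 then Wall else Silent) (cells k m (q, h, t)) =
    (if q = accept T then Accepted else if h' < k then Come q' else Silent, cells k m (q', h', t'))"
  using assms(1)
proof (induction k rule: inc_induct)
  case base
  have rest: "map (cell (q'', h'', t'')) [Suc h..<m] = map (\<lambda>i. Cell (t'' i) None) [Suc h..<m]" if "h'' \<le> h" for q'' h'' t''
    using that by (auto simp: cell_def)
  have h: "cells h m c = cell c h # map (cell c) [Suc h..<m]" for c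
    using assms(2) by (simp add: cells_def upt_conv_Cons)
  show ?case
  proof (cases "halted T q")
    case True
    then have "q' = q" "h' = h" "t' = t" using assms(3) by (auto simp: step_def halted_def)
    then show ?thesis using True
      by (auto simp: h rest tm_sweep_silent cell_def halted_def)
  next
    case False
    obtain p b d where tr: "trans T q (t h) = (p, b, d)" by (cases "trans T q (t h)") auto
    with False assms(3) have s: "q' = p" "h' = (case d of MoveL \<Rightarrow> h - 1 | MoveR \<Rightarrow> Suc h)" "t' = t(h := b)"
      by (auto simp: step_def halted_def)
    have t: "map (\<lambda>i. Cell (t' i) None) [Suc h..<m] = map (\<lambda>i. Cell (t i) None) [Suc h..<m]"
      by (auto simp: s)
    show ?thesis
    proof (cases d)
      case MoveL
      then have "h' \<le> h" using s by simp
      then show ?thesis using False MoveL tr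
        by (auto simp: h rest t tm_sweep_silent halted_def) (auto simp: cell_def s tm_sweep_silent halted_def)
    next
      case MoveR
      then have h': "h' = Suc h" using s by simp
      have "tm_sweep T (Come q') (map (\<lambda>i. Cell (t i) None) [Suc h..<m]) = (Silent, cells (Suc h) m (q', h', t))"
        using tm_sweep_come[of "Suc h" m] assms(4) h' by simp
      moreover have "cells (Suc h) m (q', h', t) = cells (Suc h) m (q', h', t')"
        by (auto simp: cells_def cell_def s)
      ultimately have "tm_sweep T (Come q') (map (\<lambda>i. Cell (t i) None) [Suc h..<m]) =
          (Silent, map (cell (q', h', t')) [Suc h..<m])"
        by (simp add: cells_def)
      then show ?thesis using False MoveR tr h'
        by (auto simp: h rest halted_def cell_def s)
    qed
  qed
next
  case (step k)
  have k: "cells k m c = cell c k # cells (Suc k) m c" for c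
    using step.hyps assms(2) by (simp add: cells_def upt_conv_Cons)
  \<comment> \<open>The head moves left by at most one cell, so from the right of k it can enter k
    but not pass it.\<close>
  have tk: "t' k = t k" "h' \<ge> h - 1"
    using assms(3) step.hyps by (auto simp: step_def Let_def split: if_splits prod.splits direction.splits)
  define l where "l = (if k = 0 then Wall else Silent)"
  have c: "cell (q, h, t) k = Cell (t k) None" using step.hyps by (simp add: cell_def)
  have l: "tm_lo T l (Cell (t k) None) = Silent" "l = Wall \<or> l = Silent" by (auto simp: l_def)
  let ?m = "if q = accept T then Accepted else if h' < Suc k then Come q' else Silent"
  have "tm_sweep T l (cells k m (q, h, t)) =
      (tm_ro T l (Cell (t k) None) ?m, tm_out T l (Cell (t k) None) ?m # cells (Suc k) m (q', h', t'))"
    using step.IH by (simp add: k c l)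
  moreover have "q = accept T \<Longrightarrow> h' = h" using assms(3) by (simp add: step_def)
  then have "tm_ro T l (Cell (t k) None) ?m = (if q = accept T then Accepted else if h' < k then Come q' else Silent)"
    "tm_out T l (Cell (t k) None) ?m = cell (q', h', t') k"
    using l(2) tk step.hyps by (auto simp: cell_def)
  ultimately show ?case by (simp add: k l_def)
qed

section \<open>Sweeps that load the input\<close>

text \<open>Each cell hands its old content on to the right; the content of the last cell is lost,
  hence \<open>butlast\<close>.\<close>

lemma tm_sweep_put:
  "snd (tm_sweep T (Put x) (map (\<lambda>a. Cell a None) as)) = map (\<lambda>a. Cell a None) (butlast (x # as))"
  by (induction "as" arbitrary: x) (simp_all add: Let_def case_prod_unfold)

lemma butlast_take_Cons: "m \<le> length ys \<Longrightarrow> butlast (x # take m ys) = take m (x # ys)"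
  by (cases m) (simp_all add: take_Suc_conv_app_nth butlast_append butlast_conv_take min_def)

text \<open>Induction with the first m symbols of the input followed by blanks: inserting a bit in
  front and losing the last symbol preserves this form. If the input is longer than m, its excess is
  cut off, which is harmless for a head that stays below m.\<close>

lemma tm_sweep_load:
  "foldr (\<lambda>b cs. snd (tm_sweep T (Put (of_bool b)) cs)) s (replicate m (Cell (blank T) None)) =
     map (\<lambda>i. Cell (if i < length s then of_bool (s ! i) else blank T) None) [0..<m]"
proof -
  have "foldr (\<lambda>b cs. snd (tm_sweep T (Put (of_bool b)) cs)) s (map (\<lambda>a. Cell a None) (replicate m (blank T))) =
      map (\<lambda>a. Cell a None) (take m (map of_bool s @ replicate m (blank T)))"
  proof (induction s)
    case (Cons b s)
    have "foldr (\<lambda>b cs. snd (tm_sweep T (Put (of_bool b)) cs)) (b # s) (map (\<lambda>a. Cell a None) (replicate m (blank T))) =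
        snd (tm_sweep T (Put (of_bool b)) (map (\<lambda>a. Cell a None) (take m (map of_bool s @ replicate m (blank T)))))"
      by (simp only: Cons foldr.simps comp_apply)
    also have "\<dots> = map (\<lambda>a. Cell a None) (butlast (of_bool b # take m (map of_bool s @ replicate m (blank T))))"
      by (rule tm_sweep_put)
    also have "butlast (of_bool b # take m (map of_bool s @ replicate m (blank T))) =
        take m (of_bool b # map of_bool s @ replicate m (blank T))"
      by (rule butlast_take_Cons) simp
    finally show ?case by (simp only: list.map append_Cons)
  qed simp
  also have "\<dots> = map (\<lambda>i. Cell (if i < length s then of_bool (s ! i) else blank T) None) [0..<m]"
    by (rule nth_equalityI) (auto simp: nth_append)
  finally show ?thesis by simp
qed

section \<open>Space and time bounds\<close>

lemma run_Suc: "run T s (Suc i) = step T (run T s i)"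
  by (simp add: run_def)

abbreviation "state_at T s i \<equiv> fst (run T s i)"
abbreviation "head_at T s i \<equiv> fst (snd (run T s i))"
abbreviation "tape_at T s i \<equiv> snd (snd (run T s i))"

text \<open>The head starts at cell 0 and advances by at most one cell per step, so it cannot skip a
  cell.\<close>

lemma head_at_scanned: "h \<le> head_at T s i \<Longrightarrow> h \<in> scanned_cells T s"
proof (induction i arbitrary: h)
  case 0
  then have "h = head_at T s 0" by (simp add: run_def init_config_def)
  then show ?case unfolding scanned_cells_def by blast
next
  case (Suc i)
  have "head_at T s (Suc i) \<le> Suc (head_at T s i)"
    by (auto simp: run_Suc step_def Let_def split: prod.splits direction.splits)
  with Suc consider "h \<le> head_at T s i" | "h = head_at T s (Suc i)" by linarith
  then show ?case
  proof cases
    case 1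
    then show ?thesis by (rule Suc.IH)
  next
    case 2
    then show ?thesis unfolding scanned_cells_def by blast
  qed
qed

text \<open>Turns the bound on the number of scanned cells into a bound on their positions.\<close>

lemma head_at_less:
  assumes "runs_in_space T f"
  shows "head_at T s i < f (length s)"
proof -
  have "card {..head_at T s i} \<le> card (scanned_cells T s)"
    using assms head_at_scanned by (intro card_mono) (auto simp: runs_in_space_def)
  also have "\<dots> \<le> f (length s)" using assms by (simp add: runs_in_space_def)
  finally show ?thesis by simp
qed

lemma trans_alphabet:
  assumes "wf_tm T" "q \<in> states T" "a \<in> tape_symbols T" "\<not> halted T q" "trans T q a = (q', b, d)"
  shows "q' \<in> states T \<and> b \<in> tape_symbols T"
proof -
  have "trans T q a \<in> states T \<times> tape_symbols T \<times> UNIV"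
    using assms(1-4) unfolding wf_tm_def halted_def by blast
  with assms(5) show ?thesis by simp
qed

lemma run_invariant:
  assumes "wf_tm T"
  shows "state_at T s i \<in> states T \<and> range (tape_at T s i) \<subseteq> tape_symbols T"
proof (induction i)
  case 0
  show ?case using assms by (auto simp: run_def init_config_def wf_tm_def of_bool_def)
next
  case (Suc i)
  obtain q h t where c: "run T s i = (q, h, t)" by (cases "run T s i") auto
  obtain p b d where tr: "trans T q (t h) = (p, b, d)" by (cases "trans T q (t h)") auto
  have q: "q \<in> states T" and t: "range t \<subseteq> tape_symbols T" using Suc c by simp_all
  show ?case
  proof (cases "halted T q")
    case True
    then have "run T s (Suc i) = (q, h, t)" using c by (simp add: run_Suc step_def halted_def)
    with q t show ?thesis by simp
  next
    case False
    then have "run T s (Suc i) = (p, case d of MoveL \<Rightarrow> h - 1 | MoveR \<Rightarrow> Suc h, t(h := b))"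
      using c tr by (simp add: run_Suc step_def halted_def)
    moreover have "t h \<in> tape_symbols T" using t by (rule range_subsetD)
    then have "p \<in> states T \<and> b \<in> tape_symbols T" by (rule trans_alphabet[OF assms q _ False tr])
    moreover from this have "range (t(h := b)) \<subseteq> tape_symbols T"
      using range_subsetD[OF t] by (simp add: image_subset_iff)
    ultimately show ?thesis by (simp only: fst_conv snd_conv simp_thms)
  qed
qed

lemma halted_stable:
  assumes "halted T (state_at T s i)" "i \<le> j"
  shows "state_at T s j = state_at T s i"
  using assms(2)
proof (induction j rule: dec_induct)
  case (step j)
  then show ?case using assms(1) by (cases "run T s j") (auto simp: run_Suc step_def halted_def)
qed simp

lemma tm_sweep_run:
  assumes "head_at T s i < m" "head_at T s (Suc i) < m"
  shows "tm_sweep T Wall (cells 0 m (run T s i)) =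
    (if state_at T s i = accept T then Accepted else Silent, cells 0 m (run T s (Suc i)))"
proof -
  obtain q h t where c: "run T s i = (q, h, t)" by (cases "run T s i") auto
  obtain q' h' t' where c': "run T s (Suc i) = (q', h', t')" by (cases "run T s (Suc i)") auto
  show ?thesis
    using tm_sweep_step[of 0 h m T q t q' h' t'] assms c c' by (simp add: run_Suc)
qed

lemma cells_state:
  assumes "cells 0 m (q, h, t) = cells 0 m (q', h', t')" "h < m"
  shows "q = q'"
proof -
  have "cells 0 m (q, h, t) ! h = cells 0 m (q', h', t') ! h" using assms by simp
  then show ?thesis using assms(2) by (auto simp: cells_def cell_def split: if_splits)
qed

section \<open>A finite alphabet closed under the transducer\<close>

definition alphabet :: "turing_machine \<Rightarrow> symbol set" where
  "alphabet T = {Idle, Wall, Silent, Accepted} \<union> Come ` states T \<union> Put ` tape_symbols T \<union>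
     (\<lambda>(a, h). Cell a h) ` (tape_symbols T \<times> insert None (Some ` states T))"

lemma finite_alphabet: "wf_tm T \<Longrightarrow> finite (alphabet T)"
  by (simp add: alphabet_def wf_tm_def)

lemma Cell_alphabet:
  "Cell a h \<in> alphabet T \<longleftrightarrow> a \<in> tape_symbols T \<and> (\<forall>q. h = Some q \<longrightarrow> q \<in> states T)"
  by (cases h) (auto simp: alphabet_def)

lemma Come_alphabet: "Come q \<in> alphabet T \<longleftrightarrow> q \<in> states T"
  by (auto simp: alphabet_def)

lemma Put_alphabet: "Put a \<in> alphabet T \<longleftrightarrow> a \<in> tape_symbols T"
  by (auto simp: alphabet_def)

lemma constants_alphabet:
  "Idle \<in> alphabet T" "Wall \<in> alphabet T" "Silent \<in> alphabet T" "Accepted \<in> alphabet T"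
  by (auto simp: alphabet_def)

lemmas alphabet_simps = Cell_alphabet Come_alphabet Put_alphabet constants_alphabet

lemma tm_lo_alphabet: "wf_tm T \<Longrightarrow> l \<in> alphabet T \<Longrightarrow> c \<in> alphabet T \<Longrightarrow> tm_lo T l c \<in> alphabet T"
  by (cases "(T, l, c)" rule: tm_lo.cases) (auto simp: alphabet_simps dest: trans_alphabet split: prod.splits)

lemma tm_out_alphabet:
  "wf_tm T \<Longrightarrow> l \<in> alphabet T \<Longrightarrow> c \<in> alphabet T \<Longrightarrow> m \<in> alphabet T \<Longrightarrow> tm_out T l c m \<in> alphabet T"
  by (cases "(T, l, c, m)" rule: tm_out.cases) (auto simp: alphabet_simps dest: trans_alphabet split: prod.splits)

lemma tm_ro_alphabet:
  "wf_tm T \<Longrightarrow> l \<in> alphabet T \<Longrightarrow> c \<in> alphabet T \<Longrightarrow> m \<in> alphabet T \<Longrightarrow> tm_ro T l c m \<in> alphabet T"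
  by (cases "(T, l, c, m)" rule: tm_ro.cases)
    (auto simp: alphabet_simps halted_def dest: trans_alphabet split: prod.splits)

lemma cells_alphabet: "wf_tm T \<Longrightarrow> set (cells k m (run T s i)) \<subseteq> alphabet T"
  using run_invariant[of T s i]
  by (cases "run T s i") (auto simp: cells_def cell_def alphabet_simps image_subset_iff split: if_splits)

section \<open>Exponential bound on the halting time\<close>

text \<open>Up to the first halting time k the contents of the m cells never repeat, for a
  repetition would produce a halting state earlier than k. So k is below |U|^m, and |U| \<le> 2^|U|
  gives the power of 2.\<close>

lemma halting_time:
  assumes T: "wf_tm T" and halt: "halted T (state_at T s i)" and m: "\<And>i. head_at T s i < m"
  shows "halted T (state_at T s (2 ^ (card (alphabet T) * m)))"
proof -
  define k where "k = (LEAST i. halted T (state_at T s i))"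
  have k: "halted T (state_at T s k)" unfolding k_def using halt by (rule LeastI)
  define x where "x = (\<lambda>i. cells 0 m (run T s i))"
  \<comment> \<open>The m cells determine their own future, because a sweep computes the next
    contents from them alone.\<close>
  have step: "x (Suc i) = snd (tm_sweep T Wall (x i))" for i
    using tm_sweep_run[OF m m] by (simp add: x_def)
  have shift: "x (i + r) = x (j + r)" if "x i = x j" for i j r
    by (induction r) (use that step in auto)
  have state: "state_at T s i = state_at T s j" if "x i = x j" for i j
    using that cells_state[of m "state_at T s i" "head_at T s i" "tape_at T s i" "state_at T s j" "head_at T s j" "tape_at T s j"] m
    by (simp add: x_def)
  have neq: "x i \<noteq> x j" if "i < j" "j \<le> k" for i j
  proof
    assume "x i = x j"
    from state[OF shift[OF this, of "k - j"]] that have "state_at T s (i + (k - j)) = state_at T s k" by simp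
    with k have "halted T (state_at T s (i + (k - j)))" by simp
    then have "k \<le> i + (k - j)" unfolding k_def by (rule Least_le)
    with that show False by simp
  qed
  have "inj_on x {..k}"
    using neq by (intro linorder_inj_onI) auto
  then have "Suc k = card (x ` {..k})" by (simp add: card_image)
  also have "\<dots> \<le> card {cs. set cs \<subseteq> alphabet T \<and> length cs = m}"
    using finite_alphabet[OF T] cells_alphabet[OF T, of 0 m s]
    by (intro card_mono finite_lists_length_eq) (auto simp: x_def)
  also have "\<dots> = card (alphabet T) ^ m" using finite_alphabet[OF T] by (rule card_lists_length_eq)
  also have "\<dots> \<le> (2 ^ card (alphabet T)) ^ m" by (intro power_mono) (simp_all add: less_imp_le)
  finally have "k \<le> 2 ^ (card (alphabet T) * m)" by (simp add: power_mult)
  from halted_stable[OF k this] k show ?thesis by (simp only:)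
qed

text \<open>The bound has the form to which \<open>iter\<close> can count. The summand 1 in the new
  constant keeps the base positive, so that the power absorbs the coefficient a.\<close>

lemma poly_le_power: "\<exists>c d. \<forall>n. poly p (n::nat) \<le> (n + c) ^ d"
proof (induction p)
  case 0
  then show ?case by auto
next
  case (pCons a p)
  then obtain c d where cd: "\<And>n. poly p n \<le> (n + c) ^ d" by auto
  have "poly (pCons a p) n \<le> (n + (c + a + 1)) ^ Suc d" for n
  proof -
    let ?C = "c + a + 1"
    have "(n + c) ^ d \<le> (n + ?C) ^ d" by (intro power_mono) simp_all
    then have "n * poly p n \<le> n * (n + ?C) ^ d" using cd[of n] by (intro mult_le_mono) auto
    moreover have "1 \<le> (n + ?C) ^ d" by simp
    then have "a \<le> ?C * (n + ?C) ^ d" by (metis add_leE le_add2 mult.right_neutral mult_le_mono add.commute)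
    ultimately have "poly (pCons a p) n \<le> ?C * (n + ?C) ^ d + n * (n + ?C) ^ d"
      unfolding poly_pCons by linarith
    also have "\<dots> = (n + ?C) ^ Suc d" by (simp add: algebra_simps)
    finally show ?thesis .
  qed
  then show ?case by blast
qed

section \<open>Deciding PSPACE\<close>

text \<open>The functions on symbols are conjugated with a numbering of the alphabet; as the
  alphabet is closed under them, sweeps correspond entry by entry. The right end answers
  \<open>Silent\<close>.\<close>

lemma transducer_of_tm:
  assumes T: "wf_tm T"
  obtains code lo ro out where
    "bij_betw code (alphabet T) {..<card (alphabet T)}"
    "transducer (card (alphabet T)) lo ro out (code Silent) (code Idle)"
    "\<And>l cs. l \<in> alphabet T \<Longrightarrow> set cs \<subseteq> alphabet T \<Longrightarrow>
       transducer.sweep lo ro out (code Silent) (code l) (map code cs) =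
         (code (fst (tm_sweep T l cs)), map code (snd (tm_sweep T l cs)))"
    "\<And>l cs. l \<in> alphabet T \<Longrightarrow> set cs \<subseteq> alphabet T \<Longrightarrow>
       fst (tm_sweep T l cs) \<in> alphabet T \<and> set (snd (tm_sweep T l cs)) \<subseteq> alphabet T"
proof -
  let ?U = "alphabet T"
  let ?n = "card ?U"
  obtain code where code: "bij_betw code ?U {..<?n}"
    using ex_bij_betw_finite_nat[OF finite_alphabet[OF T]] by (auto simp: atLeast0LessThan)
  define dec where "dec = inv_into ?U code"
  have dec: "dec i \<in> ?U" "code (dec i) = i" if "i < ?n" for i
    using code that bij_betw_inv_into[OF code]
    by (auto simp: dec_def bij_betw_def intro: inv_into_into f_inv_into_f)
  have dec_code: "dec (code x) = x" if "x \<in> ?U" for x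
    using code that by (simp add: dec_def bij_betw_inv_into_left)
  have less: "code x < ?n" if "x \<in> ?U" for x using code that by (auto simp: bij_betw_def)
  define lo where "lo = (\<lambda>l a. code (tm_lo T (dec l) (dec a)))"
  define ro where "ro = (\<lambda>l a m. code (tm_ro T (dec l) (dec a) (dec m)))"
  define out where "out = (\<lambda>l a m. code (tm_out T (dec l) (dec a) (dec m)))"
  note closed = tm_lo_alphabet[OF T] tm_ro_alphabet[OF T] tm_out_alphabet[OF T]
  have tr: "transducer ?n lo ro out (code Silent) (code Idle)"
    by unfold_locales (auto simp: lo_def ro_def out_def dec_code constants_alphabet intro!: less closed dec)
  have alph: "fst (tm_sweep T l cs) \<in> ?U \<and> set (snd (tm_sweep T l cs)) \<subseteq> ?U" if "l \<in> ?U" "set cs \<subseteq> ?U" for l cs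
    using that
  proof (induction cs arbitrary: l)
    case (Cons c cs)
    obtain m cs' where m: "tm_sweep T (tm_lo T l c) cs = (m, cs')" by fastforce
    with Cons closed have "m \<in> ?U" "set cs' \<subseteq> ?U" by (metis fst_conv list.set_intros(1) set_subset_Cons subset_iff, metis snd_conv list.set_intros(1) set_subset_Cons subset_iff)
    with m Cons.prems closed show ?case by simp
  qed (simp add: constants_alphabet)
  have "transducer.sweep lo ro out (code Silent) (code l) (map code cs) =
         (code (fst (tm_sweep T l cs)), map code (snd (tm_sweep T l cs)))" if "l \<in> ?U" "set cs \<subseteq> ?U" for l cs
    using that
  proof (induction cs arbitrary: l)
    case Nil
    show ?case by (simp add: transducer.sweep.simps[OF tr])
  next
    case (Cons c cs)
    obtain m cs' where m: "tm_sweep T (tm_lo T l c) cs = (m, cs')" by fastforce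
    have c: "c \<in> ?U" "set cs \<subseteq> ?U" "tm_lo T l c \<in> ?U" using Cons.prems closed by auto
    with alph[OF c(3,2)] m have "m \<in> ?U" by simp
    then have e: "lo (code l) (code c) = code (tm_lo T l c)" "ro (code l) (code c) (code m) = code (tm_ro T l c m)"
      "out (code l) (code c) (code m) = code (tm_out T l c m)"
      using c Cons.prems by (simp_all add: lo_def ro_def out_def dec_code)
    show ?case using Cons.IH[OF c(3,2)] by (simp add: transducer.sweep.simps[OF tr] e m)
  qed
  with code tr alph show ?thesis using that by blast
qed

theorem theorem5:
  fixes D :: "bool list \<Rightarrow> bool"
  assumes "D \<in> PSPACE"
  shows "\<exists>f. is_term f \<and>
    (\<forall>s. program (f \<cdot> enc s) \<and> (\<forall>b. D s = b \<longleftrightarrow> (\<Turnstile> f \<cdot> enc s \<Down> b)))"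
proof -
  from assms obtain T p where T: "wf_tm T" "decides T D" "runs_in_space T (poly p)"
    by (auto simp: PSPACE_def)
  let ?U = "alphabet T"
  let ?n = "card ?U"
  obtain c0 d where poly: "\<And>n. poly p n \<le> (n + c0) ^ d" using poly_le_power by blast
  \<comment> \<open>With |U| included in the constant, |U| times the number (length s + c)^d of
    cells is at most (length s + c)^(d + 1); hence the exponents d and \<open>Suc d\<close>
    below.\<close>
  define c where "c = c0 + ?n"
  obtain code lo ro out where code: "bij_betw code ?U {..<?n}"
    and tr: "transducer ?n lo ro out (code Silent) (code Idle)"
    and sim: "\<And>l cs. l \<in> ?U \<Longrightarrow> set cs \<subseteq> ?U \<Longrightarrow>
       transducer.sweep lo ro out (code Silent) (code l) (map code cs) =
         (code (fst (tm_sweep T l cs)), map code (snd (tm_sweep T l cs)))"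
    and alph: "\<And>l cs. l \<in> ?U \<Longrightarrow> set cs \<subseteq> ?U \<Longrightarrow>
       fst (tm_sweep T l cs) \<in> ?U \<and> set (snd (tm_sweep T l cs)) \<subseteq> ?U"
    using transducer_of_tm[OF T(1)] by blast
  interpret transducer ?n lo ro out "code Silent" "code Idle" by (rule tr)
  have less: "code x < ?n" if "x \<in> ?U" for x using code that by (auto simp: bij_betw_def)
  have U: "Cell (blank T) None \<in> ?U" "Put 0 \<in> ?U" "Put 1 \<in> ?U" "Come (start T) \<in> ?U" "Wall \<in> ?U" "Accepted \<in> ?U"
    using T(1) by (auto simp: alphabet_simps wf_tm_def)
  define F where "F = decider (code (Cell (blank T) None)) (code (Put 0)) (code (Put 1)) (code (Come (start T)))
    (code Wall) (code Accepted) c d (Suc d)"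
  define f where "f = lam vs (F (Free vs))"
  have "ev (f \<cdot> enc s) (D s)" for s
  proof -
    define m where "m = (length s + c) ^ d"
    define e where "e = (length s + c) ^ Suc d"
    have "poly p (length s) \<le> m"
    proof -
      have "(length s + c0) ^ d \<le> m" unfolding m_def c_def by (intro power_mono) simp_all
      with poly[of "length s"] show ?thesis by linarith
    qed
    then have head: "head_at T s i < m" for i using head_at_less[OF T(3), of s i] by linarith
    have "?n * m \<le> e" unfolding m_def e_def c_def by simp
    define t where "t = loaded (code (Put 0)) (code (Put 1)) s (replicate m (code (Cell (blank T) None)))"
    define init where "init = map (\<lambda>i. Cell (if i < length s then of_bool (s ! i) else blank T) None) [0..<m]"
    have bits: "Put (of_bool b) \<in> ?U" for b using U by (cases b) auto
    have "t = map code (foldr (\<lambda>b cs. snd (tm_sweep T (Put (of_bool b)) cs)) s (replicate m (Cell (blank T) None))) \<and>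
        set (foldr (\<lambda>b cs. snd (tm_sweep T (Put (of_bool b)) cs)) s (replicate m (Cell (blank T) None))) \<subseteq> ?U"
      unfolding t_def loaded_def
    proof (induction s)
      case Nil
      show ?case using U(1) by auto
    next
      case (Cons b s)
      have "(if b then code (Put 1) else code (Put 0)) = code (Put (of_bool b))" by simp
      with Cons sim[OF bits[of b]] alph[OF bits[of b]] show ?case by simp
    qed
    then have t: "t = map code init" "set init \<subseteq> ?U" unfolding init_def tm_sweep_load by auto
    have m0: "0 < m" using head[of 0] by simp
    \<comment> \<open>The loaded tape has no head yet; the message \<open>Come (start T)\<close>
      places it on cell 0 in the start state.\<close>
    have come: "tm_sweep T (Come (start T)) init = (Silent, cells 0 m (run T s 0))"
      unfolding init_def using tm_sweep_come[OF m0, of T "start T" "\<lambda>i. if i < length s then of_bool (s ! i) else blank T"]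
      by (simp add: run_def init_config_def)
    have 0: "snd (sweep (code (Come (start T))) t) = map code (cells 0 m (run T s 0))"
      using sim[OF U(4) t(2)] come by (simp add: t)
    have wall: "sweep (code Wall) (map code (cells 0 m (run T s i))) =
        (code (if state_at T s i = accept T then Accepted else Silent), map code (cells 0 m (run T s (Suc i))))" for i
      using sim[OF U(5) cells_alphabet[OF T(1)]] tm_sweep_run[OF head head] by simp
    define u where "u = ((\<lambda>t. snd (sweep (code Wall) t)) ^^ (2 ^ e)) (snd (sweep (code (Come (start T))) t))"
    have "((\<lambda>t. snd (sweep (code Wall) t)) ^^ i) (map code (cells 0 m (run T s 0))) = map code (cells 0 m (run T s i))" for i
      by (induction i) (simp_all add: wall)
    then have u: "u = map code (cells 0 m (run T s (2 ^ e)))" by (simp add: u_def 0)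
    have "fst (sweep (code Wall) u) = code Accepted \<longleftrightarrow> state_at T s (2 ^ e) = accept T"
      using code U(6) constants_alphabet(3)[of T]
      by (auto simp: u wall bij_betw_def inj_on_eq_iff[of code ?U])
    moreover obtain k where k: "state_at T s k = (if D s then accept T else reject T)"
      using T(2) unfolding decides_def by blast
    have kh: "halted T (state_at T s k)" using k by (simp add: halted_def)
    have "halted T (state_at T s (2 ^ (?n * m)))" by (rule halting_time[OF T(1) kh head])
    then have "halted T (state_at T s (2 ^ e))"
      using halted_stable[of T s "2 ^ (?n * m)" "2 ^ e"] \<open>?n * m \<le> e\<close> by (simp add: power_increasing)
    \<comment> \<open>Whichever of the times 2^e and k comes first, the machine has halted by then
      and keeps its state.\<close>
    then have "state_at T s (2 ^ e) = state_at T s k"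
      using halted_stable[of T s "2 ^ e" k] halted_stable[OF kh, of "2 ^ e"] by (cases "2 ^ e \<le> k") auto
    with k have "state_at T s (2 ^ e) = accept T \<longleftrightarrow> D s" using T(1) by (auto simp: wf_tm_def)
    ultimately have result: "(fst (sweep (code Wall) u) = code Accepted) = D s" by simp
    have "ev (F (enc s)) (fst (sweep (code Wall) u) = code Accepted)"
      unfolding F_def u_def t_def m_def e_def by (intro ev_decider less U)
    moreover have "f \<cdot> enc s \<leadsto> F (enc s)"
      using hexp_beta[of "F (Free vs)" vs "enc s"] by (simp add: f_def F_def is_term_decider subst_decider)
    ultimately show "ev (f \<cdot> enc s) (D s)" unfolding result by (blast intro: hexp_ev)
  qed
  \<comment> \<open>The program evaluates to D s; determinism excludes the other value and gives the
    converse.\<close>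
  then have "(D s = b) \<longleftrightarrow> ev (f \<cdot> enc s) b" for s b using ev_deterministic by blast
  moreover have prog: "program (f \<cdot> enc s)" for s unfolding f_def F_def by (rule program_decider)
  moreover have "(\<Turnstile> f \<cdot> enc s \<Down> b) \<longleftrightarrow> ev (f \<cdot> enc s) b" for s b
    using prog[of s] by (intro evaluates_iff_ev) (simp add: program_def)
  moreover have "is_term f" by (simp add: f_def F_def is_term_decider)
  ultimately show ?thesis by auto
qed

end
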